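(* For every positive integer $k$ and any $c_v>1$, there is an online $(k^2 m c_v^{-1/2}\log n\,\log_{c_v} m,\ k c_v\log n\,\log_{c_v} m)$-scheme for $F_k$ in the strict turnstile model, for a stream of sparsity $m$ over a universe of size $n$. Any online scheme for this problem with annotation length $c_a\ge\log n$ and space $c_v$ (and error at most $1/3$) requires $c_a c_v=\Omega(m\log(n/m))$.
   Context: Data streams: a stream $\mathbf x$ is a sequence of updates $(i,\delta)$, $i\in[n]$, $\delta\in\mathbb Z$; $f_i=\sum_{(j,\delta)\in\mathbf x:\,j=i}\delta$. In the strict turnstile model $\delta$ may be negative but frequencies always remain nonnegative. The sparsity $m$ is the number of items with nonzero final frequency. $F_k(\mathbf x)=\sum_{i\in[n]}f_i^k$. Schemes: a scheme for $F$ is a pair $(\mathfrak h,V)$. A prover with private randomness $r_P$ supplies after the $i$th stream element an annotation string $\mathfrak h_i(\mathbf x,r_P)$; the verifier $V$ is a streaming algorithm with $w$ bits of memory and private randomness $r_V$ reading the interleaved annotated stream and outputting a value or $\bot$. Completeness error $\delta_c$: for all $\mathbf x$, $\Pr_{r_P,r_V}[\text{output}\ne F(\mathbf x)]\le\delta_c$. Soundness error $\delta_s$: for all $\mathbf x$ and all annotation sequences, $\Pr_{r_V}[\text{output}\notin\{F(\mathbf x),\bot\}]\le\delta_s$. An online $(c_a,c_v)$-scheme has total annotation length $O(c_a)$, space $O(c_v)$, error $\max\{\delta_s,\delta_c\}\le 1/3$, and each $\mathfrak h_i$ depends only on $x_1,\dots,x_i$ and $r_P$.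
   Formalization: Final frequencies are at most n^C (upper-bound constant depends on C) and stream length is fixed and known; the scheme is for m ≥ 2 (at m = 1 it would need zero space); the lower bound is for k ≥ 2 (F_1 needs only an O(log n)-bit counter). *)

theory Defs
  imports "HOL-Probability.Probability"
begin

section \<open>Data streams\<close>

type_synonym update = "nat \<times> int"
type_synonym stream = "update list"

definition freq :: "stream \<Rightarrow> nat \<Rightarrow> int" where
  "freq x i = (\<Sum>(j, d)\<leftarrow>x. if j = i then d else 0)"

definition strict_turnstile :: "nat \<Rightarrow> stream \<Rightarrow> bool" where
  "strict_turnstile n x \<longleftrightarrow>
     (\<forall>(j, d) \<in> set x. j \<in> {1..n}) \<and>
     (\<forall>t \<le> length x. \<forall>i \<in> {1..n}. 0 \<le> freq (take t x) i)"

definition sparsity :: "nat \<Rightarrow> stream \<Rightarrow> nat" where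
  "sparsity n x = card {i \<in> {1..n}. freq x i \<noteq> 0}"

definition freq_moment :: "nat \<Rightarrow> nat \<Rightarrow> stream \<Rightarrow> int" where
  "freq_moment k n x = (\<Sum>i\<in>{1..n}. freq x i ^ k)"

text \<open>
  The inputs: strict turnstile streams over the universe \<open>{1..n}\<close> with \<open>N\<close> updates whose final
  frequency vector has at most \<open>m\<close> nonzero entries, none of them larger than \<open>B\<close>.
  The length \<open>N\<close> is a parameter of the problem, as for functions on \<open>U\<^sup>N\<close>: an online prover
  can thereby tell when the stream has ended.  The bound \<open>B\<close> (a power of \<open>n\<close> below) is the usual
  assumption under which a frequency fits in \<open>O(log n)\<close> bits; without any such bound the
  values of a frequency moment cannot be told apart in bounded memory.
\<close>

definition sparse_streams :: "nat \<Rightarrow> nat \<Rightarrow> nat \<Rightarrow> nat \<Rightarrow> stream set" where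
  "sparse_streams n m B N =
     {x. length x = N \<and> strict_turnstile n x \<and> sparsity n x \<le> m \<and>
         (\<forall>i \<in> {1..n}. freq x i \<le> int B)}"

section \<open>Annotation schemes\<close>

text \<open>\<open>annot P i x r\<close> is the annotation that follows the \<open>i\<close>th update of \<open>x\<close>, for \<open>1 \<le> i \<le> length x\<close>.\<close>

record prover =
  prover_coins :: "bool list pmf"
  annot :: "nat \<Rightarrow> stream \<Rightarrow> bool list \<Rightarrow> bool list"

text \<open>The annotated stream is read one update or one annotation bit at a time.\<close>

datatype token = Update update | Bit bool

text \<open>
  The first argument of \<open>init\<close>, \<open>step\<close> and \<open>outp\<close> is the verifier's random string, the
  other \<open>bool list\<close> is the content of its memory; the output \<open>None\<close> stands for \<open>\<bottom>\<close>.
\<close>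

record verifier =
  verifier_coins :: "bool list pmf"
  init :: "bool list \<Rightarrow> bool list"
  step :: "bool list \<Rightarrow> token \<Rightarrow> bool list \<Rightarrow> bool list"
  outp :: "bool list \<Rightarrow> bool list \<Rightarrow> int option"

definition memory_bits :: "verifier \<Rightarrow> nat \<Rightarrow> bool" where
  "memory_bits V w \<longleftrightarrow>
     (\<forall>r. length (init V r) = w) \<and>
     (\<forall>r t s. length s = w \<longrightarrow> length (step V r t s) = w)"

text \<open>
  A verifier may consult its random string at any time.  It is charged for that string if the string
  influences the computation only through the initial memory content.
\<close>

definition coins_in_memory :: "verifier \<Rightarrow> bool" where
  "coins_in_memory V \<longleftrightarrow> (\<forall>r r'. step V r = step V r' \<and> outp V r = outp V r')"

definition annotations :: "prover \<Rightarrow> stream \<Rightarrow> bool list \<Rightarrow> bool list list" where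
  "annotations P x r = map (\<lambda>i. annot P i x r) [1..<Suc (length x)]"

definition interleave :: "stream \<Rightarrow> bool list list \<Rightarrow> token list" where
  "interleave x a = concat (map2 (\<lambda>u s. Update u # map Bit s) x a)"

definition result :: "verifier \<Rightarrow> token list \<Rightarrow> bool list \<Rightarrow> int option" where
  "result V ts r = outp V r (fold (step V r) ts (init V r))"

definition completeness_error ::
  "stream set \<Rightarrow> (stream \<Rightarrow> int) \<Rightarrow> prover \<Rightarrow> verifier \<Rightarrow> real \<Rightarrow> bool" where
  "completeness_error X F P V \<delta> \<longleftrightarrow>
     (\<forall>x \<in> X. measure_pmf.prob (pair_pmf (prover_coins P) (verifier_coins V))
        {(rP, rV). result V (interleave x (annotations P x rP)) rV \<noteq> Some (F x)} \<le> \<delta>)"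

definition soundness_error ::
  "stream set \<Rightarrow> (stream \<Rightarrow> int) \<Rightarrow> verifier \<Rightarrow> real \<Rightarrow> bool" where
  "soundness_error X F V \<delta> \<longleftrightarrow>
     (\<forall>x \<in> X. \<forall>a. length a = length x \<longrightarrow>
        measure_pmf.prob (verifier_coins V)
          {rV. result V (interleave x a) rV \<notin> {Some (F x), None}} \<le> \<delta>)"

definition online :: "prover \<Rightarrow> bool" where
  "online P \<longleftrightarrow>
     (\<forall>x y i r. i \<le> length x \<and> i \<le> length y \<and> take i x = take i y \<longrightarrow>
        annot P i x r = annot P i y r)"

text \<open>
  The costs are \<open>\<le> ca\<close> and \<open>\<le> cv\<close> here; the constants hidden in \<open>O(ca)\<close> and \<open>O(cv)\<close> are to be
  made explicit where the notion is used.
\<close>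

definition online_scheme ::
  "stream set \<Rightarrow> (stream \<Rightarrow> int) \<Rightarrow> real \<Rightarrow> real \<Rightarrow> prover \<Rightarrow> verifier \<Rightarrow> bool" where
  "online_scheme X F ca cv P V \<longleftrightarrow>
     online P \<and>
     (\<forall>x \<in> X. \<forall>r \<in> set_pmf (prover_coins P).
        real (sum_list (map length (annotations P x r))) \<le> ca) \<and>
     (\<exists>w. real w \<le> cv \<and> memory_bits V w) \<and>
     completeness_error X F P V (1/3) \<and>
     soundness_error X F V (1/3)"

end

theory Submission
  imports Defs "HOL-Number_Theory.Cong" "HOL-Computational_Algebra.Polynomial"
begin

text \<open>
  \<^emph>\<open>Lower bound.\<close>  Alice inserts a set \<open>S\<close> of \<open>m - 1\<close> items and Bob one more item \<open>i\<close>; for \<open>k \<ge> 2\<close> the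
  moment tells whether \<open>i \<in> S\<close>.  As the prover is online, Alice can produce all annotations but the
  last one; she fixes prover coins that are good for a constant fraction of the \<open>i \<in> S\<close> and sends
  \<open>O(ca)\<close> independent memory contents.  The majority error is then so small, because
  \<open>ca \<ge> log n\<close>, that a union bound over all \<open>i\<close> and all last annotations shows that Bob
  recovers, without the help of the prover, some \<open>T \<subseteq> S\<close> with \<open>5 * card T \<ge> card S\<close>.  Only an
  \<open>(card S / n)\<^bsup>card T\<^esup>\<close> fraction of all sets contains a given \<open>T\<close>, which bounds \<open>ca * cv\<close>
  from below.

  \<^emph>\<open>Scheme.\<close>  For \<open>cv \<ge> m\<close> the \<open>2 * m\<close> power sums of the frequency vector modulo a prime determine it.
  For \<open>cv < m\<close> put \<open>s \<approx> \<surd>cv\<close> and hash the items into \<open>m * s\<close> buckets on \<open>O(log\<^bsub>cv\<^esub> m)\<close> levels.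
  The expected number of items which collide on level 0 is \<open>m / s\<close>; the prover lists them, together
  with their frequencies and a level on which each is isolated.  On a level \<open>t > 0\<close> let \<open>z\<close> be the
  number of items in a bucket which are listed for \<open>t\<close> and \<open>A, B, C\<close> the moments of order 0, 1, 2
  of the item numbers under the frequencies minus the listed frequencies.  As frequencies are nonnegative,
  \<open>z * (z - 1) = 0\<close> and \<open>z * (A\<^sup>2 + B\<^sup>2 + C\<^sup>2) = 0\<close> force the listed frequencies to be right.
  On level 0, \<open>A * C - B\<^sup>2 = 0\<close> then forces every bucket to contain at most one unlisted item, so that
  \<open>A ^ k\<close> is its contribution to the moment.  All these conditions and the moment itself are
  encoded in a single sum over the buckets, which is verified modulo a prime by a low degree extension
  that the verifier evaluates at a secret point.
\<close>

section \<open>Tail bounds and one-way communication\<close>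

text \<open>In the lower bound the coins of the runs are shared and finally fixed by averaging, so
  that only memory contents are charged. In the scheme, the grid of at least \<open>m * s\<close>
  buckets has \<open>a\<close> about \<open>m / s\<close> columns and \<open>b = s * s\<close> about
  \<open>cv\<close> rows. The prover sends a polynomial in the column of degree below
  \<open>d = (k + 2) * a\<close>; the verifier keeps one register per row, level and moment. Proof
  and list thus both have about \<open>m / s\<close> blocks, up to factors of k. Since k-th powers
  must survive reduction modulo \<open>p\<close>, a block takes O(k log n) bits, which is the second
  factor k of the annotation length. Random hash functions would not fit into the memory. A fixed
  family with \<open>48 * n\<close> members is therefore built in, and the prover draws the key and
  sends it right after the first update, as the registers depend on it from the start. A bad key
  harms completeness only; soundness holds for every key, and the one secret of the verifier is the
  evaluation point. The weights \<open>\<Omega>\<close> and \<open>\<Omega> * \<Lambda>\<close> make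
  the three groups of conditions digits of a single number.\<close>

lemma Pi_pmf_count_tail:
  fixes M :: "'a pmf"
  assumes q: "measure_pmf.prob M E \<le> q" and l: "l \<ge> 1"
  shows "measure_pmf.prob (Pi_pmf {..<t} d (\<lambda>_. M)) {\<omega>. \<theta> \<le> card {j. j < t \<and> \<omega> j \<in> E}}
           \<le> (1 + (l - 1) * q) ^ t / l ^ \<theta>"
proof -
  \<comment> \<open>Exponential Markov inequality: every hit of \<open>E\<close> contributes a
    factor \<open>l\<close>, so the product over the runs is \<open>l\<close> to the number of hits,
    and its expectation factorises by independence.\<close>
  define f where "f v = 1 + (l - 1) * indicat_real E v" for v
  define P where "P = Pi_pmf {..<t} d (\<lambda>_. M)"
  have f_cases: "f v = (if v \<in> E then l else 1)" for v by (simp add: f_def)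
  have prod_f: "(\<Prod>j<t. f (\<omega> j)) = l ^ card {j. j < t \<and> \<omega> j \<in> E}" for \<omega>
  proof -
    have "(\<Prod>j<t. f (\<omega> j)) = (\<Prod>j\<in>{j\<in>{..<t}. \<omega> j \<in> E}. l)"
      by (subst prod.inter_filter) (simp_all add: f_cases)
    then show ?thesis by simp
  qed
  have intf: "integrable (measure_pmf M) f"
    by (rule measure_pmf.integrable_const_bound[where B = l]) (use l in \<open>auto simp: f_cases\<close>)
  have Ef: "measure_pmf.expectation M f = 1 + (l - 1) * measure_pmf.prob M E"
  proof -
    have "integrable (measure_pmf M) (indicat_real E)"
      by (rule measure_pmf.integrable_const_bound[where B = 1]) auto
    then show ?thesis unfolding f_def by (subst Bochner_Integration.integral_add) auto
  qed
  have EP: "measure_pmf.expectation P (\<lambda>\<omega>. \<Prod>j<t. f (\<omega> j)) = (1 + (l - 1) * measure_pmf.prob M E) ^ t"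
    unfolding P_def
    by (subst expectation_prod_Pi_pmf) (use intf l in \<open>auto simp: Ef, auto simp: f_cases\<close>)
  let ?A = "{\<omega>. \<theta> \<le> card {j. j < t \<and> \<omega> j \<in> E}}"
  have "l ^ \<theta> * measure_pmf.prob P ?A = measure_pmf.expectation P (\<lambda>\<omega>. l ^ \<theta> * indicator ?A \<omega>)"
    by simp
  also have "\<dots> \<le> measure_pmf.expectation P (\<lambda>\<omega>. \<Prod>j<t. f (\<omega> j))"
  proof (rule integral_mono)
    show "integrable (measure_pmf P) (\<lambda>\<omega>. \<Prod>j<t. f (\<omega> j))"
    proof (rule measure_pmf.integrable_const_bound[where B = "l ^ t"])
      have "l ^ card {j. j < t \<and> \<omega> j \<in> E} \<le> l ^ t" for \<omega>
      proof (rule power_increasing)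
        have "card {j. j < t \<and> \<omega> j \<in> E} \<le> card {..<t}" by (rule card_mono) auto
        then show "card {j. j < t \<and> \<omega> j \<in> E} \<le> t" by simp
      qed (use l in auto)
      then show "AE \<omega> in measure_pmf P. norm (\<Prod>j<t. f (\<omega> j)) \<le> l ^ t"
        unfolding prod_f using l by simp
    qed simp
    show "l ^ \<theta> * indicator ?A \<omega> \<le> (\<Prod>j<t. f (\<omega> j))" for \<omega>
      unfolding prod_f using l by (auto simp: indicator_def intro: power_increasing)
  qed (rule measure_pmf.integrable_const_bound[where B = "l ^ \<theta>"], use l in \<open>auto simp: indicator_def\<close>)
  also have "\<dots> \<le> (1 + (l - 1) * q) ^ t"
    unfolding EP using q l by (intro power_mono add_left_mono mult_left_mono) auto
  finally show ?thesis
    using l by (simp add: P_def field_simps)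
qed

lemma pmf_exists_le_expectation:
  fixes f :: "'a \<Rightarrow> real"
  assumes "measure_pmf.expectation M f \<le> c" "integrable (measure_pmf M) f"
  obtains x where "x \<in> set_pmf M" "f x \<le> c"
proof -
  have "\<exists>x\<in>set_pmf M. f x \<le> c"
  proof (rule ccontr)
    assume "\<not> ?thesis"
    then have gt: "\<forall>x\<in>set_pmf M. c < f x" by auto
    have "measure_pmf.expectation M (\<lambda>x. f x - c) \<le> 0" using assms by simp
    moreover have nn: "AE x in measure_pmf M. 0 \<le> f x - c"
      using gt by (auto simp: AE_measure_pmf_iff less_imp_le)
    ultimately have "measure_pmf.expectation M (\<lambda>x. f x - c) = 0"
      using integral_nonneg_AE[OF nn] by simp
    then have "AE x in measure_pmf M. f x - c = 0"
      using assms(2) by (subst (asm) integral_nonneg_eq_0_iff_AE[OF _ nn]) auto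
    then have "\<forall>x\<in>set_pmf M. f x = c" by (simp add: AE_measure_pmf_iff)
    with gt show False using set_pmf_not_empty[of M] by force
  qed
  then show thesis using that by blast
qed

lemma prob_pair_pmf_eq_expectation:
  "measure_pmf.prob (pair_pmf M N) {(x, y). R x y} =
     measure_pmf.expectation M (\<lambda>x. measure_pmf.prob N {y. R x y})"
proof -
  have "ennreal (measure_pmf.prob (pair_pmf M N) {(x, y). R x y}) =
      (\<integral>\<^sup>+z. indicator {(x, y). R x y} z \<partial>pair_pmf M N)"
    by (simp add: measure_pmf.emeasure_eq_measure)
  also have "\<dots> = (\<integral>\<^sup>+x. \<integral>\<^sup>+y. indicator {y. R x y} y \<partial>N \<partial>M)"
    unfolding nn_integral_pair_pmf' by (simp add: indicator_def)
  also have "\<dots> = (\<integral>\<^sup>+x. ennreal (measure_pmf.prob N {y. R x y}) \<partial>M)"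
    by (simp add: measure_pmf.emeasure_eq_measure)
  also have "\<dots> = ennreal (measure_pmf.expectation M (\<lambda>x. measure_pmf.prob N {y. R x y}))"
    by (rule nn_integral_eq_integral)
      (auto intro!: measure_pmf.integrable_const_bound[where B = 1])
  finally show ?thesis
    by (subst (asm) ennreal_inj) (auto intro!: integral_nonneg_AE)
qed

lemma card_supersets:
  assumes "finite U" "T \<subseteq> U" "card T \<le> s"
  shows "card {S. T \<subseteq> S \<and> S \<subseteq> U \<and> card S = s} \<le> (card U - card T) choose (s - card T)"
proof -
  have finT: "finite T" using assms finite_subset by blast
  have "card {S. T \<subseteq> S \<and> S \<subseteq> U \<and> card S = s} \<le> card {A. A \<subseteq> U - T \<and> card A = s - card T}"
  proof (rule card_inj_on_le[where f = "\<lambda>S. S - T"])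
    show "inj_on (\<lambda>S. S - T) {S. T \<subseteq> S \<and> S \<subseteq> U \<and> card S = s}"
      by (rule inj_onI) blast
    show "(\<lambda>S. S - T) ` {S. T \<subseteq> S \<and> S \<subseteq> U \<and> card S = s} \<subseteq> {A. A \<subseteq> U - T \<and> card A = s - card T}"
      using finT by (auto simp: card_Diff_subset)
    show "finite {A. A \<subseteq> U - T \<and> card A = s - card T}" using assms(1) by simp
  qed
  also have "\<dots> = (card U - card T) choose (s - card T)"
    using assms finT by (subst n_subsets) (auto simp: card_Diff_subset)
  finally show ?thesis .
qed

text \<open>The quotient of the two binomials is the product of \<open>(s - j) / (n - j)\<close>
  over \<open>j < \<tau>\<close>, and each factor is at most \<open>s / n\<close>. It is the chance
  that a random set of size \<open>s\<close> contains \<open>\<tau>\<close> given items.\<close>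

lemma choose_diff_bound:
  assumes "\<tau> \<le> s" "s \<le> n"
  shows "((n - \<tau>) choose (s - \<tau>)) * n ^ \<tau> \<le> (n choose s) * s ^ \<tau>"
  using assms
proof (induction \<tau>)
  case (Suc \<tau>)
  define n' s' where "n' = n - Suc \<tau>" and "s' = s - Suc \<tau>"
  have n: "n - \<tau> = Suc n'" and s: "s - \<tau> = Suc s'" using Suc.prems by (auto simp: n'_def s'_def)
  have le: "n * Suc s' \<le> s * Suc n'"
  proof -
    have "n * (s - \<tau>) \<le> s * (n - \<tau>)"
      using Suc.prems by (simp add: right_diff_distrib' mult.commute mult_le_mono1 diff_le_mono2)
    then show ?thesis by (simp only: n s)
  qed
  have "((n' choose s') * n ^ Suc \<tau>) * Suc s' = ((n' choose s') * n ^ \<tau>) * (n * Suc s')"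
    by (simp only: power_Suc ac_simps)
  also have "\<dots> \<le> ((n' choose s') * n ^ \<tau>) * (s * Suc n')"
    by (rule mult_le_mono2[OF le])
  also have "\<dots> = (Suc n' * (n' choose s')) * n ^ \<tau> * s"
    by (simp only: ac_simps)
  also have "\<dots> = ((Suc n' choose Suc s') * n ^ \<tau>) * (s * Suc s')"
    by (simp only: Suc_times_binomial_eq ac_simps)
  also have "\<dots> \<le> ((n choose s) * s ^ \<tau>) * (s * Suc s')"
    using Suc.IH Suc.prems unfolding n s by (intro mult_le_mono1) simp
  also have "\<dots> = ((n choose s) * s ^ Suc \<tau>) * Suc s'"
    by (simp only: power_Suc ac_simps)
  finally have "(n' choose s') * n ^ Suc \<tau> \<le> (n choose s) * s ^ Suc \<tau>"
    by (simp only: mult_le_cancel2)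
  then show ?case by (simp only: n'_def s'_def)
qed simp

lemma card_bool_lists_le: "card {a :: bool list. length a \<le> q} \<le> 2 ^ Suc q"
proof -
  have "card {a :: bool list. length a \<le> q} = (\<Sum>i\<le>q. 2 ^ i)"
    using card_lists_length_le[of "UNIV :: bool set" q] by simp
  also have "\<dots> = 2 ^ Suc q - 1"
    using sum_power2[of "Suc q"] by (simp add: atLeast0LessThan lessThan_Suc_atMost)
  finally show ?thesis by simp
qed

lemma card_bool_lists_eq: "card {a :: bool list. length a = w} = 2 ^ w"
  using card_lists_length_eq[of "UNIV :: bool set" w] by simp

lemma finite_bool_lists_le: "finite {a :: bool list. length a \<le> q}"
  using finite_lists_length_le[of "UNIV :: bool set" q] by simp

lemma finite_bool_lists_eq: "finite {a :: bool list. length a = w}"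
  using finite_lists_length_eq[of "UNIV :: bool set" w] by simp

text \<open>The index game in the abstract: \<open>mem\<close> is the message of Alice from one run,
  \<open>acc\<close> is the test by which Bob examines item \<open>i\<close> with a guessed last
  annotation \<open>a\<close>. Since \<open>acc\<close> reads the coins as well, only memory
  contents count as communication. The bound comes from counting the sets that one message can
  serve.\<close>

lemma one_way_decoding_bound:
  fixes M :: "'r pmf" and mem :: "nat set \<Rightarrow> 'r \<Rightarrow> bool list"
    and acc :: "'r \<Rightarrow> bool list \<Rightarrow> nat \<Rightarrow> bool list \<Rightarrow> bool"
  assumes s: "1 \<le> s" "s < n" and w: "1 \<le> w" and u1: "1 \<le> u"
    and mem: "\<And>S r. S \<subseteq> {1..n} \<Longrightarrow> card S = s \<Longrightarrow> length (mem S r) = w"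
    and sound: "\<And>S i a. S \<subseteq> {1..n} \<Longrightarrow> card S = s \<Longrightarrow> i \<in> {1..n} - S \<Longrightarrow>
        measure_pmf.prob M {r. acc r (mem S r) i a} \<le> 5/12"
    and complete: "\<And>S. S \<subseteq> {1..n} \<Longrightarrow> card S = s \<Longrightarrow>
        \<exists>G\<subseteq>S. s \<le> 5 * card G \<and> (\<forall>i\<in>G. \<exists>a. length a \<le> q \<and>
          measure_pmf.prob M {r. \<not> acc r (mem S r) i a} \<le> 5/12)"
    and u: "2 * (real n * 2 ^ (q + 2)) * (35/36) ^ u \<le> 1"
  shows "real s / 5 * log 2 (real n / real s) \<le> 2 * (2 * real u * real w)"
proof -
  define P where "P = Pi_pmf {..<2*u} undefined (\<lambda>_. M)"
  define memv where "memv S \<omega> = map (\<lambda>j. mem S (\<omega> j)) [0..<2*u]" for S and \<omega> :: "nat \<Rightarrow> 'r"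
  \<comment> \<open>A strict majority of \<open>2 * u\<close> runs. A false acceptance and a missed
    item both imply at least \<open>u\<close> wrong answers, which is the event that
    \<open>tail\<close> bounds.\<close>
  define dec where "dec \<omega> L = {i \<in> {1..n}. \<exists>a. length a \<le> q \<and>
      u < card {j. j < 2*u \<and> acc (\<omega> j) (L ! j) i a}}" for \<omega> :: "nat \<Rightarrow> 'r" and L
  define good where "good S \<omega> \<longleftrightarrow> dec \<omega> (memv S \<omega>) \<subseteq> S \<and> s \<le> 5 * card (dec \<omega> (memv S \<omega>))"
    for S \<omega>
  define \<S> where "\<S> = {S. S \<subseteq> {1..n} \<and> card S = s}"
  have fin\<S>: "finite \<S>" by (simp add: \<S>_def)
  have card\<S>: "card \<S> = n choose s" by (simp add: \<S>_def n_subsets)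

  have tail: "measure_pmf.prob P {\<omega>. u \<le> card {j. j < 2*u \<and> \<omega> j \<in> E}} \<le> (35/36) ^ u"
    if "measure_pmf.prob M E \<le> 5/12" for E
  proof -
    \<comment> \<open>The base 7/5 is the odds (7/12) / (5/12), which minimises the bound; a pair of
      runs then contributes the factor 4 * (5/12) * (7/12) = 35/36.\<close>
    have "measure_pmf.prob P {\<omega>. u \<le> card {j. j < 2*u \<and> \<omega> j \<in> E}}
        \<le> (1 + (7/5 - 1) * (5/12)) ^ (2*u) / (7/5) ^ u"
      unfolding P_def by (rule Pi_pmf_count_tail[OF that]) simp
    also have "\<dots> = ((1 + (7/5 - 1) * (5/12))\<^sup>2 / (7/5)) ^ u"
      by (simp only: power_mult power_divide)
    also have "(1 + (7/5 - 1) * (5/12))\<^sup>2 / (7/5) = (35/36 :: real)"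
      by (simp add: power2_eq_square)
    finally show ?thesis .
  qed

  have bad: "measure_pmf.prob P {\<omega>. \<not> good S \<omega>} \<le> 1/2" if S: "S \<in> \<S>" for S
  proof -
    have S': "S \<subseteq> {1..n}" "card S = s" using S by (auto simp: \<S>_def)
    obtain G where G: "G \<subseteq> S" "s \<le> 5 * card G" and "\<forall>i\<in>G. \<exists>a. length a \<le> q \<and>
          measure_pmf.prob M {r. \<not> acc r (mem S r) i a} \<le> 5/12"
      using complete[OF S'] by blast
    then obtain hint where hint: "\<And>i. i \<in> G \<Longrightarrow> length (hint i) \<le> q"
      "\<And>i. i \<in> G \<Longrightarrow> measure_pmf.prob M {r. \<not> acc r (mem S r) i (hint i)} \<le> 5/12"
      by metis
    define E1 where "E1 = (\<lambda>(i,a). {\<omega>. u \<le> card {j. j < 2*u \<and> \<omega> j \<in> {r. acc r (mem S r) i a}}})"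
    define E2 where "E2 i = {\<omega>. u \<le> card {j. j < 2*u \<and> \<omega> j \<in> {r. \<not> acc r (mem S r) i (hint i)}}}" for i
    \<comment> \<open>False acceptance must be excluded for every hint, because Bob tries them all;
      completeness needs just the one \<open>hint i\<close> per item of \<open>G\<close>.\<close>
    define I where "I = ({1..n} - S) \<times> {a :: bool list. length a \<le> q}"
    have finI: "finite I" unfolding I_def using finite_bool_lists_le by auto
    have finG: "finite G" using G(1) S' finite_subset by (metis finite_atLeastAtMost)
    have sub: "{\<omega>. \<not> good S \<omega>} \<subseteq> (\<Union>ia\<in>I. E1 ia) \<union> (\<Union>i\<in>G. E2 i)"
    proof
      fix \<omega> assume "\<omega> \<in> {\<omega>. \<not> good S \<omega>}"
      then have ng: "\<not> good S \<omega>" by simp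
      show "\<omega> \<in> (\<Union>ia\<in>I. E1 ia) \<union> (\<Union>i\<in>G. E2 i)"
      proof (rule ccontr)
        assume H: "\<omega> \<notin> (\<Union>ia\<in>I. E1 ia) \<union> (\<Union>i\<in>G. E2 i)"
        have nth: "memv S \<omega> ! j = mem S (\<omega> j)" if "j < 2*u" for j using that by (simp add: memv_def)
        have eq: "{j. j < 2*u \<and> acc (\<omega> j) (memv S \<omega> ! j) i a} = {j. j < 2*u \<and> acc (\<omega> j) (mem S (\<omega> j)) i a}" for i a
          using nth by auto
        have "dec \<omega> (memv S \<omega>) \<subseteq> S"
          using H unfolding dec_def eq by (force simp: E1_def I_def)
        moreover have "G \<subseteq> dec \<omega> (memv S \<omega>)"
        proof
          fix i assume i: "i \<in> G"
          let ?A = "{j. j < 2*u \<and> acc (\<omega> j) (mem S (\<omega> j)) i (hint i)}"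
          let ?B = "{j. j < 2*u \<and> \<not> acc (\<omega> j) (mem S (\<omega> j)) i (hint i)}"
          have "card ?B < u" using H i by (auto simp: E2_def)
          moreover have "card (?A \<union> ?B) = card ?A + card ?B" by (rule card_Un_disjoint) auto
          moreover have "?A \<union> ?B = {..<2*u}" by auto
          ultimately have "u < card ?A" by simp
          then show "i \<in> dec \<omega> (memv S \<omega>)"
            using hint(1)[OF i] i G(1) S'(1) by (auto simp: dec_def eq)
        qed
        moreover have "finite (dec \<omega> (memv S \<omega>))" by (simp add: dec_def)
        ultimately have "good S \<omega>"
          using G(2) card_mono[of "dec \<omega> (memv S \<omega>)" G] unfolding good_def by linarith
        with ng show False by simp
      qed
    qed
    have "measure_pmf.prob P {\<omega>. \<not> good S \<omega>}
        \<le> measure_pmf.prob P ((\<Union>ia\<in>I. E1 ia) \<union> (\<Union>i\<in>G. E2 i))"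
      by (rule measure_pmf.finite_measure_mono[OF sub]) simp
    also have "\<dots> \<le> measure_pmf.prob P (\<Union>ia\<in>I. E1 ia) + measure_pmf.prob P (\<Union>i\<in>G. E2 i)"
      by (rule measure_Un_le) auto
    also have "measure_pmf.prob P (\<Union>ia\<in>I. E1 ia) \<le> (\<Sum>ia\<in>I. measure_pmf.prob P (E1 ia))"
      by (rule measure_pmf.finite_measure_subadditive_finite[OF finI]) auto
    also have "\<dots> \<le> (\<Sum>ia\<in>I. (35/36) ^ u)"
    proof (rule sum_mono)
      fix ia assume "ia \<in> I"
      then obtain i a where ia: "ia = (i, a)" and i: "i \<in> {1..n} - S" by (auto simp: I_def)
      show "measure_pmf.prob P (E1 ia) \<le> (35/36) ^ u"
        using tail[OF sound[OF S' i, of a]] by (simp add: E1_def ia)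
    qed
    also have "measure_pmf.prob P (\<Union>i\<in>G. E2 i) \<le> (\<Sum>i\<in>G. measure_pmf.prob P (E2 i))"
      by (rule measure_pmf.finite_measure_subadditive_finite[OF finG]) auto
    also have "\<dots> \<le> (\<Sum>i\<in>G. (35/36) ^ u)"
      by (rule sum_mono) (unfold E2_def, rule tail, rule hint(2))
    finally have "measure_pmf.prob P {\<omega>. \<not> good S \<omega>} \<le> (real (card I) + real (card G)) * (35/36) ^ u"
      by (simp add: algebra_simps)
    also have "\<dots> \<le> (real n * 2 ^ (q + 2)) * (35/36) ^ u"
    proof (rule mult_right_mono)
      have "card I \<le> n * 2 ^ Suc q"
        unfolding I_def card_cartesian_product
        using card_bool_lists_le[of q] card_mono[of "{1..n}" "{1..n} - S"] by (intro mult_le_mono) auto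
      moreover have "card G \<le> n * 2 ^ Suc q"
      proof -
        have "card G \<le> card {1..n}" using G(1) S'(1) by (intro card_mono) auto
        also have "\<dots> \<le> n * 2 ^ Suc q" by (simp add: Suc_le_eq)
        finally show ?thesis .
      qed
      ultimately have "card I + card G \<le> n * 2 ^ (q + 2)" by simp
      then have "real (card I + card G) \<le> real (n * 2 ^ (q + 2))" by (simp only: of_nat_le_iff)
      then show "real (card I) + real (card G) \<le> real n * 2 ^ (q + 2)" by simp
    qed simp
    also have "\<dots> \<le> 1/2" using u by simp
    finally show ?thesis .
  qed

  \<comment> \<open>Averaging yields one choice of shared coins that is good for at least half of
    all sets; from here on the argument is deterministic.\<close>
  obtain \<omega> where \<omega>: "(\<Sum>S\<in>\<S>. indicator {\<omega>. \<not> good S \<omega>} \<omega>) \<le> real (card \<S>) / 2"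
  proof (rule pmf_exists_le_expectation[of P "\<lambda>\<omega>. \<Sum>S\<in>\<S>. indicator {\<omega>. \<not> good S \<omega>} \<omega>" "real (card \<S>) / 2"])
    have int: "integrable (measure_pmf P) (\<lambda>\<omega>. indicat_real {\<omega>. \<not> good S \<omega>} \<omega>)" for S
      by (rule measure_pmf.integrable_const_bound[where B = 1]) auto
    then show "integrable (measure_pmf P) (\<lambda>\<omega>. \<Sum>S\<in>\<S>. indicat_real {\<omega>. \<not> good S \<omega>} \<omega>)"
      by (intro Bochner_Integration.integrable_sum)
    have "measure_pmf.expectation P (\<lambda>\<omega>. \<Sum>S\<in>\<S>. indicat_real {\<omega>. \<not> good S \<omega>} \<omega>) =
        (\<Sum>S\<in>\<S>. measure_pmf.prob P {\<omega>. \<not> good S \<omega>})"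
      using int by (subst Bochner_Integration.integral_sum) auto
    also have "\<dots> \<le> (\<Sum>S\<in>\<S>. 1/2)" by (rule sum_mono) (rule bad)
    finally show "measure_pmf.expectation P (\<lambda>\<omega>. \<Sum>S\<in>\<S>. indicat_real {\<omega>. \<not> good S \<omega>} \<omega>)
        \<le> real (card \<S>) / 2" by simp
  qed (use that in auto)
  have "(\<Sum>S\<in>\<S>. indicator {\<omega>. \<not> good S \<omega>} \<omega>) = real (card {S\<in>\<S>. \<not> good S \<omega>})"
    using fin\<S> by (simp add: indicator_def sum.If_cases Int_def)
  moreover have "card \<S> = card {S\<in>\<S>. good S \<omega>} + card {S\<in>\<S>. \<not> good S \<omega>}"
    using fin\<S> by (subst card_Un_disjoint[symmetric]) (auto intro: arg_cong[where f = card])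
  ultimately have half: "real (n choose s) / 2 \<le> real (card {S\<in>\<S>. good S \<omega>})"
    using \<omega> card\<S> by simp

  define Ls where "Ls = {L. set L \<subseteq> {a :: bool list. length a = w} \<and> length L = 2*u}"
  have finLs: "finite Ls" unfolding Ls_def by (rule finite_lists_length_eq[OF finite_bool_lists_eq])
  have cardLs: "card Ls = 2 ^ (w * (2*u))"
    unfolding Ls_def using card_lists_length_eq[OF finite_bool_lists_eq, of w "2*u"]
    by (simp add: card_bool_lists_eq power_mult)
  define B where "B L = {S \<in> \<S>. dec \<omega> L \<subseteq> S \<and> s \<le> 5 * card (dec \<omega> L)}" for L
  define \<rho> where "\<rho> = (real s / real n) powr (real s / 5)"
  have cardB: "real (card (B L)) \<le> real (n choose s) * \<rho>" for L
  proof (cases "B L = {}")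
    case True
    then show ?thesis by (simp add: \<rho>_def)
  next
    case False
    define \<tau> where "\<tau> = card (dec \<omega> L)"
    obtain S0 where S0: "S0 \<in> B L" using False by auto
    then have dS: "dec \<omega> L \<subseteq> S0" "finite S0" "card S0 = s"
      by (auto simp: B_def \<S>_def intro: finite_subset[OF _ finite_atLeastAtMost])
    have \<tau>: "\<tau> \<le> s" "s \<le> 5 * \<tau>" using card_mono[OF dS(2,1)] dS S0 by (auto simp: \<tau>_def B_def)
    have "card (B L) \<le> card {S. dec \<omega> L \<subseteq> S \<and> S \<subseteq> {1..n} \<and> card S = s}"
      by (rule card_mono) (auto simp: B_def \<S>_def intro: finite_subset[of _ "Pow {1..n}"])
    also have "\<dots> \<le> (n - \<tau>) choose (s - \<tau>)"
    proof -
      have "dec \<omega> L \<subseteq> {1..n}" by (auto simp: dec_def)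
      from card_supersets[OF _ this, of s] show ?thesis using \<tau> by (simp add: \<tau>_def)
    qed
    finally have "real (card (B L)) \<le> real ((n - \<tau>) choose (s - \<tau>))" by simp
    also have "\<dots> \<le> real (n choose s) * (real s / real n) ^ \<tau>"
    proof -
      have "real (((n - \<tau>) choose (s - \<tau>)) * n ^ \<tau>) \<le> real ((n choose s) * s ^ \<tau>)"
        using choose_diff_bound[of \<tau> s n] \<tau> s by (simp only: of_nat_le_iff)
      then show ?thesis using s by (simp add: power_divide field_simps)
    qed
    also have "(real s / real n) ^ \<tau> = (real s / real n) powr real \<tau>"
      using s by (simp add: powr_realpow)
    also have "\<dots> \<le> \<rho>"
      unfolding \<rho>_def using s \<tau> by (intro powr_mono') (auto simp: field_simps)
    finally show ?thesis by (simp add: mult_left_mono)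
  qed
  have "{S\<in>\<S>. good S \<omega>} \<subseteq> (\<Union>L\<in>Ls. B L)"
  proof
    fix S assume "S \<in> {S\<in>\<S>. good S \<omega>}"
    then have "S \<in> B (memv S \<omega>)" by (auto simp: B_def good_def)
    moreover have "memv S \<omega> \<in> Ls"
      using \<open>S \<in> {S\<in>\<S>. good S \<omega>}\<close> mem by (auto simp: Ls_def memv_def \<S>_def)
    ultimately show "S \<in> (\<Union>L\<in>Ls. B L)" by blast
  qed
  then have "card {S\<in>\<S>. good S \<omega>} \<le> card (\<Union>L\<in>Ls. B L)"
    using finLs fin\<S> by (intro card_mono) (auto simp: B_def)
  also have "\<dots> \<le> (\<Sum>L\<in>Ls. card (B L))" by (rule card_UN_le[OF finLs])
  finally have "real (card {S\<in>\<S>. good S \<omega>}) \<le> (\<Sum>L\<in>Ls. real (card (B L)))"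
    by (metis of_nat_mono of_nat_sum)
  also have "\<dots> \<le> (\<Sum>L\<in>Ls. real (n choose s) * \<rho>)" by (rule sum_mono) (rule cardB)
  also have "\<dots> = 2 ^ (w * (2*u)) * (real (n choose s) * \<rho>)" by (simp add: cardLs)
  finally have "real (n choose s) * (1/2) \<le> real (n choose s) * (2 ^ (w * (2*u)) * \<rho>)"
    using half by (simp add: mult_ac)
  moreover have "0 < real (n choose s)" using s by simp
  ultimately have "1/2 \<le> 2 ^ (w * (2*u)) * \<rho>" by (simp only: mult_le_cancel_left_pos)
  then have "log 2 (1/2) \<le> log 2 (2 ^ (w * (2*u)) * \<rho>)"
    by (subst log_le_cancel_iff) (use s in \<open>auto simp: \<rho>_def\<close>)
  also have "\<dots> = real (w * (2*u)) + log 2 \<rho>"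
    using s by (subst log_mult) (auto simp: \<rho>_def log_nat_power)
  also have "log 2 \<rho> = real s / 5 * log 2 (real s / real n)"
    using s by (simp add: \<rho>_def log_powr)
  also have "log 2 (real s / real n) = - log 2 (real n / real s)"
    using s by (simp add: log_divide)
  finally have "real s / 5 * log 2 (real n / real s) \<le> real (w * (2*u)) + 1"
    by (simp add: log_divide)
  \<comment> \<open>The additive 1, lost because only half of the sets are decoded, is absorbed
    here; hence the outer factor 2 in the conclusion.\<close>
  moreover have "1 \<le> real (w * (2*u))"
    using w u1 by (metis One_nat_def Suc_leI mult_is_0 not_gr_zero not_one_le_zero of_nat_1 of_nat_le_iff zero_neq_numeral)
  ultimately show ?thesis by (simp add: algebra_simps)
qed

section \<open>The hard input streams\<close>

lemma freq_Nil [simp]: "freq [] i = 0"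
  by (simp add: freq_def)

lemma freq_Cons [simp]: "freq (u # x) i = (if fst u = i then snd u else 0) + freq x i"
  by (cases u) (simp add: freq_def)

lemma freq_append: "freq (x @ y) i = freq x i + freq y i"
  by (induction x) auto

lemma freq_nonneg:
  assumes "\<And>u. u \<in> set x \<Longrightarrow> 0 \<le> snd u"
  shows "0 \<le> freq x i"
  using assms by (induction x) auto

text \<open>Updates of weight 0 pad the stream to the prescribed length \<open>N\<close>. The item
  of Bob comes last, so that all annotations but one depend only on \<open>S\<close> and the coins
  of the prover.\<close>

definition index_stream :: "nat \<Rightarrow> nat set \<Rightarrow> nat \<Rightarrow> stream" where
  "index_stream N S i =
     (replicate (N - Suc (card S)) (1, 0) @ map (\<lambda>j. (j, 1)) (sorted_list_of_set S)) @ [(i, 1)]"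

lemma freq_index_stream:
  assumes "finite S"
  shows "freq (index_stream N S i) j = of_bool (j \<in> S) + of_bool (j = i)"
proof -
  have "freq (replicate l (1, 0)) j = 0" for l by (induction l) auto
  moreover have "freq (map (\<lambda>j. (j, 1)) xs) j = of_bool (j \<in> set xs)" if "distinct xs" for xs
    using that by (induction xs) auto
  ultimately show ?thesis
    using assms by (auto simp: index_stream_def freq_append)
qed

lemma length_index_stream:
  assumes "finite S" "Suc (card S) \<le> N"
  shows "length (index_stream N S i) = N"
  using assms by (simp add: index_stream_def)

lemma index_stream_in_sparse_streams:
  assumes S: "S \<subseteq> {1..n}" and i: "i \<in> {1..n}" and m: "Suc (card S) = m" and N: "m \<le> N"
    and B: "2 \<le> B"
  shows "index_stream N S i \<in> sparse_streams n m B N"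
proof -
  have fin: "finite S" using S finite_subset by blast
  let ?x = "index_stream N S i"
  have set_x: "fst u \<in> {1..n} \<and> 0 \<le> snd u" if "u \<in> set ?x" for u
    using that S i fin by (auto simp: index_stream_def)
  have "strict_turnstile n ?x"
    unfolding strict_turnstile_def
  proof (intro conjI allI impI ballI)
    show "case u of (j, d) \<Rightarrow> j \<in> {1..n}" if "u \<in> set ?x" for u using set_x[OF that] by (cases u) auto
    show "0 \<le> freq (take t ?x) j" for t j
      by (rule freq_nonneg) (use set_x in \<open>auto dest: in_set_takeD\<close>)
  qed
  moreover have "sparsity n ?x \<le> m"
  proof -
    have "{j \<in> {1..n}. freq ?x j \<noteq> 0} \<subseteq> insert i S"
      using fin by (auto simp: freq_index_stream)
    then have "sparsity n ?x \<le> card (insert i S)"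
      unfolding sparsity_def using fin by (intro card_mono) auto
    also have "\<dots> \<le> m" using m card_insert_le_m1[of "Suc (card S)" S i] fin by (simp add: card_insert_if)
    finally show ?thesis .
  qed
  moreover have "length ?x = N" using length_index_stream[OF fin] m N by simp
  ultimately show ?thesis
    using B fin by (auto simp: sparse_streams_def freq_index_stream)
qed

lemma freq_moment_index_stream:
  assumes S: "S \<subseteq> {1..n}" and i: "i \<in> {1..n}" and k: "1 \<le> k"
  shows "freq_moment k n (index_stream N S i) =
    (if i \<in> S then int (card S) - 1 + 2 ^ k else int (card S) + 1)"
proof -
  have fin: "finite S" using S finite_subset by blast
  have "freq_moment k n (index_stream N S i) =
      (\<Sum>j\<in>{1..n}. of_bool (j \<in> S) + (if j = i then (if i \<in> S then 2 ^ k - 1 else 1) else 0))"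
    unfolding freq_moment_def freq_index_stream[OF fin]
    by (intro sum.cong refl) (use k in auto)
  also have "\<dots> = int (card S) + (if i \<in> S then 2 ^ k - 1 else 1)"
    using S i by (simp add: sum.distrib of_bool_def sum.If_cases Int_absorb1 del: atLeastAtMost_iff)
  finally show ?thesis by auto
qed

lemma interleave_append:
  "length x = length a \<Longrightarrow> interleave (x @ y) (a @ b) = interleave x a @ interleave y b"
  by (simp add: interleave_def)

text \<open>\<open>y\<close> is any stream with the same first \<open>l\<close> updates: Alice can
  produce all but the last annotation from a completion of her own choice.\<close>

lemma online_annotations_snoc:
  assumes "online P" "length x = length y" "take l x = take l y" "length x = Suc l"
  shows "annotations P x r =
    map (\<lambda>j. annot P j y r) [1..<Suc l] @ [annot P (Suc l) x r]"
proof -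
  have "annot P j x r = annot P j y r" if "j < Suc l" for j
  proof -
    have "take j x = take j y"
      using assms(3) that by (metis less_Suc_eq_le min.absorb1 take_take)
    then show ?thesis
      using assms that unfolding online_def by auto
  qed
  then show ?thesis
    using assms(4) by (auto simp: annotations_def)
qed

section \<open>The lower bound\<close>

lemma length_memory:
  assumes "memory_bits V w"
  shows "length (fold (step V r) ts (init V r)) = w"
proof -
  have "length (fold (step V r) ts s) = w" if "length s = w" for s
    using that assms by (induction ts arbitrary: s) (auto simp: memory_bits_def)
  then show ?thesis using assms by (auto simp: memory_bits_def)
qed

text \<open>Without memory the output is independent of the stream, but a stream of zero updates and
  a stream with a single item have moments 0 and 1, and no random output can equal each of them with
  probability 2/3. The result settles the case \<open>m = 1\<close> and lets the decoding bound
  absorb its additive constant.\<close>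

lemma memory_positive:
  assumes sch: "online_scheme (sparse_streams n m B N) (freq_moment k n) ca cv P V"
    and w: "memory_bits V w" and k: "1 \<le> k" and m: "1 \<le> m" "m \<le> n" "m \<le> N" and B: "2 \<le> B"
  shows "1 \<le> w"
proof (rule ccontr)
  assume "\<not> 1 \<le> w"
  then have w0: "memory_bits V 0" using w by (cases w) auto
  have res: "result V ts r = outp V r []" for ts r
    using length_memory[OF w0] by (simp add: result_def)
  have err: "measure_pmf.prob (verifier_coins V) {r. outp V r [] \<noteq> Some (freq_moment k n x)} \<le> 1/3"
    if "x \<in> sparse_streams n m B N" for x
  proof -
    have "measure_pmf.prob (pair_pmf (prover_coins P) (verifier_coins V))
        {(rP, rV). outp V rV [] \<noteq> Some (freq_moment k n x)} \<le> 1/3"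
      using sch that by (simp add: online_scheme_def completeness_error_def res)
    then show ?thesis by (subst (asm) prob_pair_pmf_eq_expectation) simp
  qed
  define x0 where "x0 = replicate N (1 :: nat, 0 :: int)"
  have f0: "freq (replicate l (1, 0)) i = 0" for l i by (induction l) auto
  note f0' = f0[unfolded One_nat_def]
  have "x0 \<in> sparse_streams n m B N"
    using m by (auto simp: x0_def sparse_streams_def strict_turnstile_def sparsity_def f0')
  moreover have "freq_moment k n x0 = 0"
    using k by (simp add: freq_moment_def x0_def f0')
  ultimately have e0: "measure_pmf.prob (verifier_coins V) {r. outp V r [] \<noteq> Some 0} \<le> 1/3"
    using err by metis
  define x1 where "x1 = replicate (N - 1) (1 :: nat, 0 :: int) @ [(1, 1)]"
  have f1: "freq x1 i = of_bool (i = 1)" for i by (simp add: x1_def freq_append f0')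
  have "0 \<le> freq (take t x1) i" for t i
    by (rule freq_nonneg) (auto simp: x1_def dest!: in_set_takeD split: if_splits)
  moreover have "sparsity n x1 \<le> m"
  proof -
    have "{i \<in> {1..n}. freq x1 i \<noteq> 0} \<subseteq> {1}" by (auto simp: f1)
    then have "sparsity n x1 \<le> card {1 :: nat}" unfolding sparsity_def by (intro card_mono) auto
    then show ?thesis using m by simp
  qed
  ultimately have "x1 \<in> sparse_streams n m B N"
    using m B by (auto simp: sparse_streams_def strict_turnstile_def f1) (auto simp: x1_def split: if_splits)
  moreover have "freq_moment k n x1 = 1"
  proof -
    have "freq_moment k n x1 = (\<Sum>i\<in>{1..n}. if i = 1 then 1 else 0)"
      unfolding freq_moment_def f1 by (intro sum.cong refl) (use k in auto)
    then show ?thesis using m by simp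
  qed
  ultimately have e1: "measure_pmf.prob (verifier_coins V) {r. outp V r [] \<noteq> Some 1} \<le> 1/3"
    using err by metis
  have "{r. outp V r [] \<noteq> Some 0} \<union> {r. outp V r [] \<noteq> Some 1} = UNIV" by auto
  then have "1 = measure_pmf.prob (verifier_coins V) ({r. outp V r [] \<noteq> Some 0} \<union> {r. outp V r [] \<noteq> Some 1})"
    by simp
  also have "\<dots> \<le> 1/3 + 1/3"
    by (rule order_trans[OF measure_Un_le add_mono[OF e0 e1]]) auto
  finally show False by simp
qed

lemma annotated_space_lower_bound:
  assumes sch: "online_scheme (sparse_streams n m B N) (freq_moment k n) ca cv P V"
    and k: "2 \<le> k" and m: "1 \<le> m" "m \<le> n" "m \<le> N" and B: "n \<le> B" and ca: "log 2 (real n) \<le> ca"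
  shows "1 / 6000 * (real m * log 2 (real n / real m)) \<le> ca * cv"
proof -
  from sch obtain w where wcv: "real w \<le> cv" and w: "memory_bits V w"
    and on: "online P" and comp: "completeness_error (sparse_streams n m B N) (freq_moment k n) P V (1/3)"
    and snd: "soundness_error (sparse_streams n m B N) (freq_moment k n) V (1/3)"
    and len: "\<And>x r. x \<in> sparse_streams n m B N \<Longrightarrow> r \<in> set_pmf (prover_coins P) \<Longrightarrow>
        real (sum_list (map length (annotations P x r))) \<le> ca"
    unfolding online_scheme_def by blast
  have ca0: "0 \<le> ca" using ca m by (intro order_trans[OF _ ca]) simp
  have cv0: "0 \<le> cv" using wcv by linarith
  show ?thesis
  proof (cases "m = n")
    case True
    then show ?thesis using ca0 cv0 m by simp
  next
    case False
    with m have mn: "m < n" by simp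
    have n2: "2 \<le> n" using mn m by simp
    have w1: "1 \<le> w" using memory_positive[OF sch w] k m B n2 by simp
    have ca1: "1 \<le> ca"
    proof -
      have "log 2 2 \<le> log 2 (real n)" using n2 by (subst log_le_cancel_iff) auto
      then show ?thesis using ca by simp
    qed
    have lognm: "0 \<le> log 2 (real n / real m)" "log 2 (real n / real m) \<le> log 2 (real n)"
      using m mn by (auto simp: divide_le_eq)
    show ?thesis
    proof (cases "m = 1")
      case True
      have "log 2 (real n) * 1 \<le> ca * cv"
        using ca w1 wcv ca0 lognm by (intro mult_mono) auto
      then show ?thesis using True lognm by simp
    next
      case False
      with m have m2: "2 \<le> m" by simp
      define s where "s = m - 1"
      have s: "1 \<le> s" "s < n" "Suc s = m" using m2 mn by (auto simp: s_def)
      obtain l where l: "N = Suc l" using m by (cases N) auto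
      define q where "q = nat \<lfloor>ca\<rfloor>"
      have q: "real q \<le> ca" "ca \<le> real q + 1" using ca0 by (auto simp: q_def)
      \<comment> \<open>\<open>(35/36) ^ 25\<close> is below 1/2, and
        \<open>ca \<ge> log 2 n\<close> gives \<open>n \<le> 2 ^ (q + 1)\<close>, so that twice the
        bound \<open>n * 2 ^ (q + 2)\<close> on the number of failure events is at most
        \<open>2 ^ (2 * q + 4)\<close>.\<close>
      define u where "u = 25 * (2 * q + 4)"
      define x where "x = index_stream N"
      have x_in: "x S i \<in> sparse_streams n m B N"
        if "S \<subseteq> {1..n}" "card S = s" "i \<in> {1..n}" for S i
        unfolding x_def using that s m B n2 by (intro index_stream_in_sparse_streams) auto
      define fin where "fin = int s - 1 + 2 ^ k"
      have F: "freq_moment k n (x S i) = (if i \<in> S then fin else int s + 1)"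
        if "S \<subseteq> {1..n}" "card S = s" "i \<in> {1..n}" for S i
        unfolding x_def fin_def using that k by (subst freq_moment_index_stream) auto
      have fin_neq: "int s + 1 \<noteq> fin"
      proof -
        have "(2::int) ^ 2 \<le> 2 ^ k" using k by (intro power_increasing) auto
        then show ?thesis by (simp add: fin_def)
      qed
      define err where "err S rP i = measure_pmf.prob (verifier_coins V)
          {rV. result V (interleave (x S i) (annotations P (x S i) rP)) rV \<noteq> Some fin}" for S rP i
      \<comment> \<open>Alice does not know \<open>i\<close>, so one string of prover coins must
        serve many \<open>i \<in> S\<close> at once; it is found by averaging the sum of the
        errors.\<close>
      have fail: "\<exists>rP \<in> set_pmf (prover_coins P).
          (\<Sum>i\<in>S. err S rP i) \<le> real s / 3"
        if S: "S \<subseteq> {1..n}" "card S = s" for S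
      proof -
        have int: "integrable (measure_pmf (prover_coins P)) (\<lambda>rP. err S rP i)" for i
          by (rule measure_pmf.integrable_const_bound[where B = 1]) (auto simp: err_def)
        have "measure_pmf.expectation (prover_coins P) (\<lambda>rP. \<Sum>i\<in>S. err S rP i) =
            (\<Sum>i\<in>S. measure_pmf.expectation (prover_coins P) (\<lambda>rP. err S rP i))"
          using int by (rule Bochner_Integration.integral_sum)
        also have "\<dots> \<le> (\<Sum>i\<in>S. 1/3)"
        proof (rule sum_mono)
          fix i assume i: "i \<in> S"
          then have i': "i \<in> {1..n}" using S by auto
          have "measure_pmf.prob (pair_pmf (prover_coins P) (verifier_coins V))
              {(rP, rV). result V (interleave (x S i) (annotations P (x S i) rP)) rV \<noteq> Some fin} \<le> 1/3"
            using comp[unfolded completeness_error_def, rule_format, OF x_in[OF S i']] F[OF S i'] i by simp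
          then show "measure_pmf.expectation (prover_coins P) (\<lambda>rP. err S rP i) \<le> 1/3"
            unfolding err_def by (subst (asm) prob_pair_pmf_eq_expectation)
        qed
        also have "\<dots> = real s / 3" using S by simp
        finally obtain rP where "rP \<in> set_pmf (prover_coins P)" "(\<Sum>i\<in>S. err S rP i) \<le> real s / 3"
          by (rule pmf_exists_le_expectation) (use int in \<open>auto intro!: Bochner_Integration.integrable_sum\<close>)
        then show ?thesis by blast
      qed
      then obtain rP where rP: "\<And>S. S \<subseteq> {1..n} \<Longrightarrow> card S = s \<Longrightarrow> rP S \<in> set_pmf (prover_coins P)"
          "\<And>S. S \<subseteq> {1..n} \<Longrightarrow> card S = s \<Longrightarrow> (\<Sum>i\<in>S. err S (rP S) i) \<le> real s / 3"
        by metis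
      define pre where "pre S = replicate (N - Suc (card S)) (1 :: nat, 0 :: int) @ map (\<lambda>j. (j, 1)) (sorted_list_of_set S)" for S
      have x_pre: "x S i = pre S @ [(i, 1)]" for S i by (simp add: x_def pre_def index_stream_def)
      have length_x: "length (x S i) = Suc l" and length_pre: "length (pre S) = l"
        if "S \<subseteq> {1..n}" "card S = s" for S i
      proof -
        have "finite S" using that finite_subset by blast
        then show "length (x S i) = Suc l" using length_index_stream[of S N i] that s m l by (simp add: x_def)
        then show "length (pre S) = l" by (simp add: x_pre)
      qed
      \<comment> \<open>Item 1 stands in for the unknown item of Bob, on which these annotations do
        not depend.\<close>
      define hints where "hints S = map (\<lambda>j. annot P j (x S 1) (rP S)) [1..<Suc l]" for S
      define mem where "mem S r = fold (step V r) (interleave (pre S) (hints S)) (init V r)" for S r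
      define acc where "acc r \<sigma> i a \<longleftrightarrow> outp V r (fold (step V r) (Update (i, 1) # map Bit a) \<sigma>) = Some fin"
        for r \<sigma> and i :: nat and a
      have acc_iff: "acc r (mem S r) i a \<longleftrightarrow> result V (interleave (x S i) (hints S @ [a])) r = Some fin"
        if "S \<subseteq> {1..n}" "card S = s" for S r i a
        using length_pre[OF that]
        by (simp add: acc_def mem_def result_def x_pre interleave_append hints_def)
          (simp add: interleave_def)
      have "real s / 5 * log 2 (real n / real s) \<le> 2 * (2 * real u * real w)"
      proof (rule one_way_decoding_bound[where M = "verifier_coins V" and mem = mem and acc = acc and q = q])
        show "length (mem S r) = w" for S r
          unfolding mem_def by (rule length_memory[OF w])
      next
        fix S i a assume S: "S \<subseteq> {1..n}" "card S = s" and i: "i \<in> {1..n} - S"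
        have "measure_pmf.prob (verifier_coins V) {r. acc r (mem S r) i a}
            \<le> measure_pmf.prob (verifier_coins V)
              {r. result V (interleave (x S i) (hints S @ [a])) r \<notin> {Some (freq_moment k n (x S i)), None}}"
          using i fin_neq by (intro measure_pmf.finite_measure_mono) (auto simp: acc_iff[OF S] F[OF S])
        also have "\<dots> \<le> 1/3"
          by (rule snd[unfolded soundness_error_def, rule_format, OF x_in[OF S]])
            (use i length_x[OF S, of i] in \<open>auto simp: hints_def\<close>)
        finally show "measure_pmf.prob (verifier_coins V) {r. acc r (mem S r) i a} \<le> 5/12" by simp
      next
        fix S assume S: "S \<subseteq> {1..n}" "card S = s"
        have finS: "finite S" using S finite_subset by blast
        define G where "G = {i\<in>S. err S (rP S) i \<le> 5/12}"
        \<comment> \<open>Markov with a threshold between 1/3 and 1/2: at most the fraction (1/3) /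
          (5/12) = 4/5 of the items fail, which leaves one fifth.\<close>
        have "5/12 * real (card (S - G)) = (\<Sum>i\<in>S - G. 5/12)" by simp
        also have "\<dots> \<le> (\<Sum>i\<in>S - G. err S (rP S) i)" by (rule sum_mono) (auto simp: G_def)
        also have "\<dots> \<le> (\<Sum>i\<in>S. err S (rP S) i)" by (rule sum_mono2) (use finS in \<open>auto simp: err_def\<close>)
        also have "\<dots> \<le> real s / 3" by (rule rP(2)[OF S])
        finally have "5 * card (S - G) \<le> 4 * s" by simp
        moreover have "card (S - G) = s - card G" "card G \<le> s"
          using finS S by (auto simp: G_def card_Diff_subset intro: card_mono)
        ultimately have cG: "s \<le> 5 * card G" by simp
        have "\<exists>a. length a \<le> q \<and> measure_pmf.prob (verifier_coins V) {r. \<not> acc r (mem S r) i a} \<le> 5/12"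
          if i: "i \<in> G" for i
        proof (intro exI conjI)
          have i': "i \<in> {1..n}" using i S by (auto simp: G_def)
          let ?a = "annot P (Suc l) (x S i) (rP S)"
          have ann: "annotations P (x S i) (rP S) = hints S @ [?a]"
            unfolding hints_def using length_x[OF S] length_pre[OF S]
            by (intro online_annotations_snoc[OF on]) (auto simp: x_pre)
          have "real (length ?a) \<le> real (sum_list (map length (annotations P (x S i) (rP S))))"
            unfolding ann by simp
          also have "\<dots> \<le> ca" by (rule len[OF x_in[OF S i'] rP(1)[OF S]])
          finally show "length ?a \<le> q" using ca0 by (simp add: q_def le_nat_floor)
          show "measure_pmf.prob (verifier_coins V) {r. \<not> acc r (mem S r) i ?a} \<le> 5/12"
            using i by (simp add: acc_iff[OF S] G_def ann err_def)
        qed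
        then show "\<exists>G\<subseteq>S. s \<le> 5 * card G \<and> (\<forall>i\<in>G. \<exists>a. length a \<le> q \<and>
            measure_pmf.prob (verifier_coins V) {r. \<not> acc r (mem S r) i a} \<le> 5/12)"
          using cG by (intro exI[of _ G]) (auto simp: G_def)
      next
        have "real n = 2 powr (log 2 (real n))" using n2 by simp
        also have "\<dots> \<le> 2 powr (real (q + 1))" using ca q by (intro powr_mono) auto
        also have "\<dots> = 2 ^ (q + 1)" by (subst powr_realpow) auto
        finally have nq: "real n \<le> 2 ^ (q + 1)" .
        have "2 * (real n * 2 ^ (q + 2)) \<le> 2 * (2 ^ (q + 1) * 2 ^ (q + 2))"
          using nq by (intro mult_left_mono mult_right_mono) auto
        also have "\<dots> = 2 ^ Suc ((q + 1) + (q + 2))" by (simp only: power_Suc power_add)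
        also have "Suc ((q + 1) + (q + 2)) = 2 * q + 4" by simp
        finally have 1: "2 * (real n * 2 ^ (q + 2)) \<le> 2 ^ (2 * q + 4)" .
        have "(35/36 :: real) ^ u = ((35/36) ^ 25) ^ (2 * q + 4)" by (simp only: u_def power_mult)
        also have "\<dots> \<le> (1/2) ^ (2 * q + 4)" by (intro power_mono) (simp_all add: power_divide)
        finally have "2 * (real n * 2 ^ (q + 2)) * (35/36) ^ u \<le> 2 ^ (2 * q + 4) * (1/2) ^ (2 * q + 4)"
          using 1 by (intro mult_mono) auto
        also have "\<dots> = 1" by (simp add: power_mult_distrib[symmetric])
        finally show "2 * (real n * 2 ^ (q + 2)) * (35/36) ^ u \<le> 1" .
      qed (use s w1 in \<open>auto simp: u_def\<close>)
      moreover have "real m / 10 * log 2 (real n / real m) \<le> real s / 5 * log 2 (real n / real s)"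
      proof (rule mult_mono)
        show "log 2 (real n / real m) \<le> log 2 (real n / real s)"
          using s m2 n2 by (subst log_le_cancel_iff) (auto intro!: divide_left_mono)
      qed (use s lognm in auto)
      \<comment> \<open>\<open>u = 50 * q + 100 \<le> 150 * ca\<close> because
        \<open>1 \<le> ca\<close>. The resulting 600, the 5 of the decoding bound and
        \<open>s \<ge> m / 2\<close> multiply to 6000.\<close>
      moreover have "2 * (2 * real u * real w) \<le> 2 * (2 * (150 * ca) * cv)"
        using q ca1 wcv cv0 by (intro mult_mono) (auto simp: u_def)
      ultimately show ?thesis by (simp add: algebra_simps)
    qed
  qed
qed

section \<open>Verifiers from summaries of the token stream\<close>

text \<open>Myhill--Nerode: the memory of a verifier only has to represent a right-congruent summary of the coins and
  of the tokens read so far.\<close>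

lemma verifier_of_summary:
  fixes \<phi> :: "nat \<Rightarrow> token list \<Rightarrow> 'q" and out :: "'q \<Rightarrow> int option" and M :: "nat pmf"
  assumes Q: "finite Q" "card Q \<le> 2 ^ w" "\<And>r ts. \<phi> r ts \<in> Q"
    and cong: "\<And>r r' ts ts' t. \<phi> r ts = \<phi> r' ts' \<Longrightarrow> \<phi> r (ts @ [t]) = \<phi> r' (ts' @ [t])"
  obtains V where "memory_bits V w" "coins_in_memory V"
    "verifier_coins V = map_pmf (\<lambda>i. replicate i True) M"
    "\<And>ts i. result V ts (replicate i True) = out (\<phi> i ts)"
proof -
  have "\<exists>enc. enc ` Q \<subseteq> {a :: bool list. length a = w} \<and> inj_on enc Q"
    using Q by (intro card_le_inj) (auto simp: finite_bool_lists_eq card_bool_lists_eq)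
  then obtain enc where enc: "\<And>q. q \<in> Q \<Longrightarrow> length (enc q :: bool list) = w" "inj_on enc Q" by blast
  \<comment> \<open>Any representative of the summary will do, by \<open>cong\<close>. The default
    for strings that encode no reachable summary keeps the length \<open>w\<close>, as
    \<open>memory_bits\<close> demands it of all strings.\<close>
  define nxt where "nxt t s = (SOME s'. (\<exists>i ts. s = enc (\<phi> i ts) \<and> s' = enc (\<phi> i (ts @ [t]))) \<or>
      (\<not> (\<exists>i ts. s = enc (\<phi> i ts)) \<and> s' = replicate w False))" for t s
  have nxt_cases: "(\<exists>i ts. s = enc (\<phi> i ts) \<and> nxt t s = enc (\<phi> i (ts @ [t]))) \<or>
      (\<not> (\<exists>i ts. s = enc (\<phi> i ts)) \<and> nxt t s = replicate w False)" for t s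
    unfolding nxt_def by (rule someI_ex) blast
  have nxt: "nxt t (enc (\<phi> i ts)) = enc (\<phi> i (ts @ [t]))" for t i ts
  proof -
    obtain j us where j: "enc (\<phi> i ts) = enc (\<phi> j us)" "nxt t (enc (\<phi> i ts)) = enc (\<phi> j (us @ [t]))"
      using nxt_cases[of "enc (\<phi> i ts)" t] by blast
    then have "\<phi> i ts = \<phi> j us" using enc(2) Q(3) by (auto dest: inj_onD)
    then show ?thesis using j(2) cong by metis
  qed
  \<comment> \<open>Coins are numbers in unary: \<open>length r\<close> recovers them, and only
    \<open>init\<close> reads them.\<close>
  define V where "V = \<lparr>verifier_coins = map_pmf (\<lambda>i. replicate i True) M,
    init = (\<lambda>r. enc (\<phi> (length r) [])), step = (\<lambda>r. nxt), outp = (\<lambda>r s. out (inv_into Q enc s))\<rparr>"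
  show thesis
  proof
    show "memory_bits V w"
      unfolding memory_bits_def
    proof (intro conjI allI impI)
      show "length (init V r) = w" for r by (simp add: V_def enc Q)
      show "length (step V r t s) = w" for r t s
        using nxt_cases[of s t] enc(1)[OF Q(3)] by (auto simp: V_def)
    qed
    show "coins_in_memory V" by (simp add: coins_in_memory_def V_def)
    show "verifier_coins V = map_pmf (\<lambda>i. replicate i True) M" by (simp add: V_def)
    show "result V ts (replicate i True) = out (\<phi> i ts)" for ts i
    proof -
      have "fold nxt ts (enc (\<phi> i [])) = enc (\<phi> i ts)"
        by (induction ts rule: rev_induct) (simp_all add: nxt)
      then show ?thesis using enc(2) Q(3) by (simp add: result_def V_def)
    qed
  qed
qed

text \<open>The annotation is cut into blocks of \<open>E\<close> bits.  A parser state consists of the updates, the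
  block values and a flag which says whether the blocks are where an honest prover puts them:
  one block after the first update, all others after the last update.\<close>

type_synonym parser_state = "stream \<times> nat list \<times> bool"

definition read_update :: "update \<Rightarrow> parser_state \<Rightarrow> parser_state" where
  "read_update u = (\<lambda>(us, cs, ok). (us @ [u], cs, ok \<and> (us = [] \<and> cs = [] \<or> us \<noteq> [] \<and> length cs = 1)))"

definition read_block :: "nat \<Rightarrow> parser_state \<Rightarrow> parser_state" where
  "read_block v = (\<lambda>(us, cs, ok). (us, cs @ [v], ok \<and> us \<noteq> [] \<and> (cs = [] \<longrightarrow> length us = 1)))"

definition read_token :: "nat \<Rightarrow> token \<Rightarrow> parser_state \<times> bool list \<Rightarrow> parser_state \<times> bool list" where
  "read_token E t = (\<lambda>(s, buf). case t of
      Update u \<Rightarrow> if buf = [] then (read_update u s, []) else (([], [], False), [])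
    | Bit c \<Rightarrow> if Suc (length buf) < E then (s, buf @ [c])
               else (read_block (horner_sum of_bool 2 (buf @ [c])) s, []))"

definition parse :: "nat \<Rightarrow> token list \<Rightarrow> parser_state \<times> bool list" where
  "parse E ts = fold (read_token E) ts (([], [], True), [])"

lemma parse_snoc: "parse E (ts @ [t]) = read_token E t (parse E ts)"
  by (simp add: parse_def)

lemma length_parse_buffer: "1 \<le> E \<Longrightarrow> length (snd (parse E ts)) < E"
  by (induction ts rule: rev_induct)
    (auto simp: parse_snoc read_token_def split: token.splits prod.splits, simp add: parse_def)

text \<open>The unfinished block has fewer than \<open>E\<close> bits, so it takes fewer than
  \<open>2 ^ E\<close> values and costs \<open>E\<close> further bits of memory. \<open>rej\<close>
  is there because an update inside a block throws the parser into one fixed state.\<close>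

lemma block_verifier:
  fixes \<psi> :: "nat \<Rightarrow> parser_state \<Rightarrow> 'q" and out :: "'q \<Rightarrow> int option" and M :: "nat pmf"
  assumes E: "1 \<le> E" and Q: "finite Q" "card Q \<le> 2 ^ w" "\<And>r s. \<psi> r s \<in> Q"
    and upd: "\<And>r r' s s' u. \<psi> r s = \<psi> r' s' \<Longrightarrow> \<psi> r (read_update u s) = \<psi> r' (read_update u s')"
    and blk: "\<And>r r' s s' v. \<psi> r s = \<psi> r' s' \<Longrightarrow> \<psi> r (read_block v s) = \<psi> r' (read_block v s')"
    and rej: "\<And>r r'. \<psi> r ([], [], False) = \<psi> r' ([], [], False)"
  obtains V where "memory_bits V (w + E)" "coins_in_memory V"
    "verifier_coins V = map_pmf (\<lambda>i. replicate i True) M"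
    "\<And>ts i. result V ts (replicate i True) =
      (if snd (parse E ts) = [] then out (\<psi> i (fst (parse E ts))) else None)"
proof -
  define \<phi> where "\<phi> r ts = (\<psi> r (fst (parse E ts)), snd (parse E ts))" for r ts
  define Q' where "Q' = Q \<times> {a :: bool list. length a \<le> E - 1}"
  have "\<exists>V. memory_bits V (w + E) \<and> coins_in_memory V \<and>
      verifier_coins V = map_pmf (\<lambda>i. replicate i True) M \<and>
      (\<forall>ts i. result V ts (replicate i True) =
         (\<lambda>(q, buf). if buf = [] then out q else None) (\<phi> i ts))"
  proof (rule verifier_of_summary[where \<phi> = \<phi> and Q = Q' and w = "w + E" and M = M
        and out = "\<lambda>(q, buf). if buf = [] then out q else None"])
    show "finite Q'" using Q(1) finite_bool_lists_le by (simp add: Q'_def)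
    have "card {a :: bool list. length a \<le> E - 1} \<le> 2 ^ E"
      using card_bool_lists_le[of "E - 1"] E by simp
    then show "card Q' \<le> 2 ^ (w + E)"
      using Q(2) by (simp add: Q'_def card_cartesian_product power_add mult_mono)
    show "\<phi> r ts \<in> Q'" for r ts
      using Q(3) length_parse_buffer[OF E, of ts] by (auto simp: Q'_def \<phi>_def)
    show "\<phi> r (ts @ [t]) = \<phi> r' (ts' @ [t])" if "\<phi> r ts = \<phi> r' ts'" for r r' ts ts' t
    proof -
      obtain s buf where p: "parse E ts = (s, buf)" by (metis surj_pair)
      obtain s' buf' where p': "parse E ts' = (s', buf')" by (metis surj_pair)
      have \<psi>: "\<psi> r s = \<psi> r' s'" and "buf' = buf" using that by (simp_all add: \<phi>_def p p')
      show ?thesis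
        using upd[OF \<psi>] blk[OF \<psi>] rej[of r r'] \<psi>
        by (cases t) (simp_all add: \<phi>_def parse_snoc read_token_def p p' \<open>buf' = buf\<close>)
    qed
  qed blast
  then show thesis using that by (auto simp: \<phi>_def)
qed

definition word :: "nat \<Rightarrow> nat \<Rightarrow> bool list" where
  "word E v = map (bit v) [0..<E]"

lemma length_word [simp]: "length (word E v) = E"
  by (simp add: word_def)

lemma read_word_aux:
  assumes "length buf + length bs = E" "bs \<noteq> []"
  shows "fold (read_token E) (map Bit bs) (s, buf) = (read_block (horner_sum of_bool 2 (buf @ bs)) s, [])"
  using assms
proof (induction bs arbitrary: buf)
  case (Cons b bs)
  show ?case
  proof (cases "bs = []")
    case True
    then show ?thesis using Cons.prems by (simp add: read_token_def)
  next
    case False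
    then have "Suc (length buf) < E" using Cons.prems by (cases bs) auto
    then show ?thesis using Cons.IH[of "buf @ [b]"] Cons.prems False by (simp add: read_token_def)
  qed
qed simp

lemma read_words:
  assumes E: "1 \<le> E" and "\<forall>v\<in>set vs. v < 2 ^ E"
  shows "fold (read_token E) (map Bit (concat (map (word E) vs))) (s, []) = (fold read_block vs s, [])"
  using assms(2)
proof (induction vs arbitrary: s)
  case (Cons v vs)
  have "fold (read_token E) (map Bit (word E v)) (s, []) = (read_block (horner_sum of_bool 2 (word E v)) s, [])"
    using read_word_aux[of "[]" "word E v" E s] E by (auto simp: word_def)
  also have "horner_sum of_bool 2 (word E v) = v"
    using Cons.prems by (simp add: word_def horner_sum_bit_eq_take_bit take_bit_nat_eq_self)
  finally show ?case using Cons by simp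
qed simp

definition token_updates :: "token list \<Rightarrow> stream" where
  "token_updates ts = concat (map (\<lambda>t. case t of Update u \<Rightarrow> [u] | Bit _ \<Rightarrow> []) ts)"

text \<open>Annotations cannot tamper with the stream: as long as the flag holds, the parser has
  recorded exactly the real updates, whatever the prover wrote.\<close>

lemma parse_updates:
  "fst (parse E ts) = (us, cs, True) \<Longrightarrow> us = token_updates ts"
proof (induction ts arbitrary: us cs rule: rev_induct)
  case (snoc t ts)
  obtain us' cs' ok buf where p: "parse E ts = ((us', cs', ok), buf)" by (metis surj_pair)
  show ?case
    using snoc p by (cases t)
      (auto simp: parse_snoc token_updates_def read_token_def read_update_def read_block_def split: if_splits)
qed (simp add: parse_def token_updates_def)

lemma token_updates_interleave:
  "length a = length x \<Longrightarrow> token_updates (interleave x a) = x"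
proof (induction x a rule: list_induct2')
  case (4 u x s a)
  have "concat (map (\<lambda>t. case t of Update u \<Rightarrow> [u] | Bit _ \<Rightarrow> []) (map Bit s)) = ([] :: stream)"
    by (induction s) auto
  then show ?case using 4 by (simp add: token_updates_def interleave_def)
qed (simp_all add: token_updates_def interleave_def)

section \<open>Primes and polynomials modulo a prime\<close>

text \<open>The reciprocals of the numbers \<open>m * (m + r choose m)\<close> are Beta integrals.  They satisfy
  \<open>\<beta> m (r + 1) = \<beta> m r - \<beta> (m + 1) r\<close>, so that they stay integral when multiplied by \<open>D\<close>.\<close>

lemma mult_choose_dvd_of_common_multiple:
  fixes D :: nat
  assumes "1 \<le> m" "\<And>i. 1 \<le> i \<Longrightarrow> i \<le> m + r \<Longrightarrow> i dvd D"
  shows "m * ((m + r) choose m) dvd D"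
  using assms
proof (induction r arbitrary: m)
  case (Suc r)
  have d1: "m * ((m + r) choose m) dvd D" and d2: "Suc m * ((Suc m + r) choose Suc m) dvd D"
    using Suc.IH[of m] Suc.IH[of "Suc m"] Suc.prems by auto
  define a b c where "a = real (m * ((m + r) choose m))"
    and "b = real (Suc m * ((Suc m + r) choose Suc m))" and "c = real (m * ((m + Suc r) choose m))"
  have eq1: "Suc m * ((Suc m + r) choose Suc m) = Suc (m + r) * ((m + r) choose m)"
    using Suc_times_binomial_eq[of "m + r" m] by (simp add: mult.commute)
  have eq2: "Suc r * ((m + Suc r) choose m) = Suc (m + r) * ((m + r) choose m)"
  proof -
    have "Suc r * (Suc (m + r) choose Suc r) = Suc (m + r) * ((m + r) choose r)"
      using Suc_times_binomial_eq[of "m + r" r] by (simp add: mult.commute)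
    moreover have "(Suc (m + r) choose Suc r) = ((m + Suc r) choose m)"
      using binomial_symmetric[of "Suc r" "Suc (m + r)"] by simp
    moreover have "((m + r) choose r) = ((m + r) choose m)"
      using binomial_symmetric[of r "m + r"] by simp
    ultimately show ?thesis by simp
  qed
  have pos: "0 < a" "0 < b" "0 < c"
    using Suc.prems zero_less_binomial[of m "m + r"] zero_less_binomial[of "Suc m" "Suc m + r"]
      zero_less_binomial[of m "m + Suc r"]
    unfolding a_def b_def c_def of_nat_0_less_iff nat_0_less_mult_iff by simp_all
  define Ch where "Ch = real ((m + r) choose m)"
  have Ch: "Ch > 0" by (simp add: Ch_def)
  have A: "a = real m * Ch" by (simp add: a_def Ch_def)
  have B: "b = real (Suc (m + r)) * Ch" unfolding b_def eq1 by (simp add: Ch_def algebra_simps)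
  have C: "c * real (Suc r) = real m * (real (Suc (m + r)) * Ch)"
  proof -
    have "real (Suc r) * real ((m + Suc r) choose m) = real (Suc (m + r)) * Ch"
      using arg_cong[OF eq2, of real] unfolding of_nat_mult Ch_def .
    then show ?thesis unfolding c_def of_nat_mult by (metis mult.assoc mult.commute)
  qed
  have key: "1 / c = 1 / a - 1 / b"
  proof -
    have c': "c = real m * (real (Suc (m + r)) * Ch) / real (Suc r)"
      using C by (simp add: field_simps)
    have gen: "1 / (M * (S * Ch) / R) = 1 / (M * Ch) - 1 / (S * Ch)"
      if "0 < M" "0 < S" "0 < R" "S = M + R" for M S R :: real
      using that(1-3) Ch unfolding that(4) by (simp add: divide_simps)
    show ?thesis unfolding c' A B by (rule gen) (use Suc.prems(1) in simp_all)
  qed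
  obtain u v where u: "D = (m * ((m + r) choose m)) * u" and v: "D = (Suc m * ((Suc m + r) choose Suc m)) * v"
    using d1 d2 unfolding dvd_def by blast
  have "real D = a * real u" using arg_cong[OF u, of real] unfolding a_def by (simp only: of_nat_mult)
  then have ru: "real D / a = real u" using pos by simp
  have "real D = b * real v" using arg_cong[OF v, of real] unfolding b_def by (simp only: of_nat_mult)
  then have rv: "real D / b = real v" using pos by simp
  have "real D / c = real D * (1 / c)" by simp
  also have "\<dots> = real D / a - real D / b" unfolding key by (simp add: right_diff_distrib)
  also have "\<dots> = real u - real v" by (simp only: ru rv)
  finally have e: "real D = c * (real u - real v)" using pos by (simp add: field_simps)
  have "v \<le> u"
  proof -
    have "0 \<le> real u - real v" using e pos by (metis linorder_not_le mult_pos_neg of_nat_0_le_iff)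
    then show ?thesis by simp
  qed
  then have "real D = real (m * ((m + Suc r) choose m) * (u - v))"
    using e by (simp add: c_def of_nat_diff)
  then have "D = m * ((m + Suc r) choose m) * (u - v)" by (simp only: of_nat_eq_iff)
  then show ?case by (metis dvd_triv_left)
qed simp

lemma prime_power_dvd_Lcm_nat:
  fixes A :: "nat set"
  assumes "finite A" "0 \<notin> A" "prime p" "A \<noteq> {}"
  shows "\<exists>a\<in>A. multiplicity p (Lcm A) \<le> multiplicity p a"
  using assms(1,4,2)
proof (induction A rule: finite_ne_induct)
  case (insert x A)
  have "Lcm A \<noteq> 0" using insert by (simp add: Lcm_0_iff)
  then have "multiplicity p (lcm x (Lcm A)) = max (multiplicity p x) (multiplicity p (Lcm A))"
    using insert.prems assms(3) by (intro multiplicity_lcm) auto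
  moreover obtain a where "a \<in> A" "multiplicity p (Lcm A) \<le> multiplicity p a"
    using insert by auto
  ultimately show ?case by (auto simp: max_def)
qed simp

text \<open>A prime power in the lcm already divides one of the numbers 1, ..., n and so is at most
  \<open>n\<close>; at most \<open>X\<close> primes are available.\<close>

lemma Lcm_upto_le:
  assumes n: "1 \<le> n" and noprime: "\<And>p. prime p \<Longrightarrow> p \<le> n \<Longrightarrow> p \<le> X"
  shows "Lcm {1..n :: nat} \<le> n ^ X"
proof -
  define D where "D = Lcm {1..n}"
  have D0: "D \<noteq> 0" by (simp add: D_def Lcm_0_iff)
  have pf: "p \<le> n \<and> p ^ multiplicity p D \<le> n" if "p \<in> prime_factors D" for p
  proof -
    have p: "prime p" "p dvd D" using that by auto
    obtain a where a: "a \<in> {1..n}" "multiplicity p D \<le> multiplicity p a"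
      using prime_power_dvd_Lcm_nat[of "{1..n}" p] p n by (auto simp: D_def)
    have "p ^ multiplicity p D dvd a" using a(2) multiplicity_dvd' by blast
    then have le: "p ^ multiplicity p D \<le> n" using a(1) dvd_imp_le[of _ a] by fastforce
    moreover have "0 < multiplicity p D" using p D0 by (simp add: prime_multiplicity_gt_zero_iff)
    then have "p ^ 1 \<le> p ^ multiplicity p D" using p prime_ge_1_nat by (intro power_increasing) auto
    ultimately show ?thesis by simp
  qed
  have "D = (\<Prod>p\<in>prime_factors D. p ^ multiplicity p D)"
    using D0 prime_factorization_nat by blast
  also have "\<dots> \<le> (\<Prod>p\<in>prime_factors D. n)"
    by (rule prod_mono) (use pf in auto)
  also have "\<dots> = n ^ card (prime_factors D)" by simp
  also have "\<dots> \<le> n ^ X"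
  proof (rule power_increasing)
    have "prime_factors D \<subseteq> {1..X}"
      using pf noprime by (auto intro: prime_ge_1_nat[unfolded One_nat_def] simp: Suc_le_eq prime_gt_0_nat in_prime_factors_iff)
    then have "card (prime_factors D) \<le> card {1..X}" by (intro card_mono) auto
    then show "card (prime_factors D) \<le> X" by simp
  qed (use n in auto)
  finally show ?thesis by (simp add: D_def)
qed

lemma two_times_square_less_exp: "7 \<le> X \<Longrightarrow> 2 * X * X < 2 ^ (X :: nat)"
proof (induction X rule: nat_induct_at_least)
  case (Suc X)
  have "4 * X + 2 \<le> 2 * X * X"
  proof -
    have "7 * X \<le> X * X" using Suc.hyps by simp
    then show ?thesis using Suc.hyps by linarith
  qed
  then show ?case using Suc.IH by simp
qed simp

text \<open>The least common multiple of \<open>1, \<dots>, 2 * N\<close> is at least \<open>2 ^ N\<close>, but at most \<open>(2 * N) ^ X\<close> if there is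
  no prime between \<open>X\<close> and \<open>2 * N\<close>.\<close>

lemma exists_prime_between_square:
  assumes X: "7 \<le> X"
  shows "\<exists>p. prime p \<and> X < p \<and> p \<le> 2 * X * (X :: nat)"
proof (rule ccontr)
  assume none: "\<not> ?thesis"
  \<comment> \<open>This choice makes \<open>(2 * N) ^ X < (2 ^ X) ^ X = 2 ^ N\<close>, because
    \<open>2 * X * X < 2 ^ X\<close> from 7 on.\<close>
  define N where "N = X * X"
  define D where "D = Lcm {1..2 * N}"
  have N: "0 < N" using X by (simp add: N_def)
  have "D \<le> (2 * N) ^ X"
    unfolding D_def
  proof (rule Lcm_upto_le)
    show "p \<le> X" if "prime p" "p \<le> 2 * N" for p
      using none that by (auto simp: N_def mult.assoc not_less[symmetric])
  qed (use N in simp)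
  also have "\<dots> < (2 ^ X) ^ X"
    using two_times_square_less_exp[OF X] X by (intro power_strict_mono) (auto simp: N_def mult.assoc)
  finally have upper: "D < 2 ^ N" by (simp add: N_def power_mult)
  have "N * ((N + N) choose N) dvd D"
    using N by (intro mult_choose_dvd_of_common_multiple) (auto simp: D_def intro: dvd_Lcm)
  moreover have "D \<noteq> 0" by (simp add: D_def Lcm_0_iff)
  ultimately have "N * ((2 * N) choose N) \<le> D" by (simp add: mult_2 dvd_imp_le)
  then have "real N * real ((2 * N) choose N) \<le> real D" by (metis of_nat_le_iff of_nat_mult)
  moreover have "4 ^ N / (2 * real N) \<le> real ((2 * N) choose N)"
    using central_binomial_lower_bound[OF N] by simp
  then have "real N * (4 ^ N / (2 * real N)) \<le> real N * real ((2 * N) choose N)"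
    by (rule mult_left_mono) simp
  ultimately have "4 ^ N / 2 \<le> real D" using N by simp
  moreover have "(2::real) ^ N \<le> 4 ^ N / 2"
  proof -
    have "(2::real) * 2 ^ N \<le> 2 ^ N * 2 ^ N" using N self_le_power[of "2::real" N] by (intro mult_right_mono) auto
    also have "\<dots> = 4 ^ N" by (simp add: power_mult_distrib[symmetric])
    finally show ?thesis by simp
  qed
  ultimately have "2 ^ N \<le> real D" by linarith
  with upper show False by (metis linorder_not_le of_nat_le_iff of_nat_numeral of_nat_power)
qed

text \<open>Lagrange's theorem over the field of residues, kept in integer polynomials: being
  nonzero modulo \<open>p\<close> means that some coefficient is not divisible by \<open>p\<close>.
  Splitting off a root leaves a quotient that is again nonzero in this sense.\<close>

lemma card_roots_mod_prime:
  fixes P :: "int poly"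
  assumes p: "prime p" and "\<not> int p dvd coeff P i"
  shows "card {r. r < p \<and> int p dvd poly P (int r)} \<le> degree P"
  using assms(2)
proof (induction "degree P" arbitrary: P i)
  case 0
  then obtain c where c: "P = [:c:]" using degree_eq_zeroE by metis
  have "\<not> int p dvd c" using 0(2) by (auto simp: c coeff_pCons split: nat.splits)
  then show ?case by (simp add: c)
next
  case (Suc d)
  let ?R = "\<lambda>P. {r. r < p \<and> int p dvd poly P (int r)}"
  show ?case
  proof (cases "?R P = {}")
    case True
    then show ?thesis by (metis card.empty zero_le)
  next
    case False
    then obtain a where a: "a < p" "int p dvd poly P (int a)" by auto
    define Q where "Q = synthetic_div P (int a)"
    have P: "P = [:- int a, 1:] * Q + [:poly P (int a):]"
      using synthetic_div_correct'[of "int a" P] by (simp add: Q_def)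
    have dQ: "degree Q = d" using Suc.hyps(2) by (simp add: Q_def degree_synthetic_div)
    have "\<exists>j. \<not> int p dvd coeff Q j"
    proof (rule ccontr)
      assume "\<not> ?thesis"
      then have all: "\<And>j. int p dvd coeff Q j" by simp
      have "coeff P i = coeff ([:- int a, 1:] * Q) i + coeff [:poly P (int a):] i"
        by (subst P) simp
      moreover have "int p dvd coeff ([:- int a, 1:] * Q) i"
        using all by (simp add: coeff_pCons split: nat.splits)
      moreover have "int p dvd coeff [:poly P (int a):] i"
        using a by (simp add: coeff_pCons split: nat.splits)
      ultimately show False using Suc.prems by simp
    qed
    then have card_Q: "card (?R Q) \<le> d" using Suc.hyps(1)[of Q] dQ by auto
    have "?R P \<subseteq> insert a (?R Q)"
    proof
      fix r assume r: "r \<in> ?R P"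
      have "poly P (int r) = (int r - int a) * poly Q (int r) + poly P (int a)"
        by (subst P) (simp add: left_diff_distrib)
      then have "int p dvd (int r - int a) * poly Q (int r)"
        using r a by (metis (no_types, lifting) dvd_add_left_iff mem_Collect_eq)
      then have "int p dvd int r - int a \<or> int p dvd poly Q (int r)"
        using p by (simp add: prime_dvd_mult_iff)
      moreover have "r = a" if "int p dvd int r - int a"
        using that r a by (metis (no_types, lifting) cong_iff_dvd_diff cong_int_iff cong_less_modulus_unique_nat mem_Collect_eq)
      ultimately show "r \<in> insert a (?R Q)" using r by auto
    qed
    then have "card (?R P) \<le> card (insert a (?R Q))" by (intro card_mono) auto
    also have "\<dots> \<le> Suc (card (?R Q))" by (rule card_insert_le_m1) auto
    finally show ?thesis using card_Q Suc.hyps(2) by simp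
  qed
qed

text \<open>The product of \<open>X - y\<close> over the other nodes, scaled by an inverse modulo
  \<open>p\<close> of its value at \<open>x\<close>; the inverse exists because distinct nodes below
  \<open>a \<le> p\<close> are incongruent.\<close>

lemma exists_lagrange_poly_mod:
  assumes p: "prime p" and a: "a \<le> p" and x: "x < a"
  shows "\<exists>q :: int poly. degree q < a \<and> (\<forall>y<a. [poly q (int y) = of_bool (x = y)] (mod int p))"
proof -
  define \<pi> where "\<pi> = (\<Prod>y\<in>{..<a} - {x}. [:- int y, 1:])"
  have "coprime (int x - int y) (int p)" if "y \<in> {..<a} - {x}" for y
  proof -
    have "\<not> int p dvd int x - int y"
      using that x a by (metis DiffE cong_iff_dvd_diff cong_int_iff cong_less_modulus_unique_nat insertI1 lessThan_iff less_le_trans)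
    then show ?thesis using p by (metis coprime_commute prime_imp_coprime prime_nat_int_transfer)
  qed
  then have "coprime (poly \<pi> (int x)) (int p)"
    unfolding \<pi>_def poly_prod by (intro prod_coprime_left) simp
  then obtain c where c: "[poly \<pi> (int x) * c = 1] (mod int p)"
    using cong_solve_coprime_int by blast
  show ?thesis
  proof (intro exI conjI allI impI)
    have "degree (smult c \<pi>) \<le> degree \<pi>" by (rule degree_smult_le)
    also have "\<dots> \<le> (\<Sum>y\<in>{..<a} - {x}. degree [:- int y, 1:])" unfolding \<pi>_def using degree_prod_sum_le[of "{..<a} - {x}" "\<lambda>y. [:- int y, 1:]"] by (simp add: o_def)
    also have "\<dots> < a" using x by simp
    finally show "degree (smult c \<pi>) < a" .
    fix y assume y: "y < a"
    show "[poly (smult c \<pi>) (int y) = of_bool (x = y)] (mod int p)"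
    proof (cases "x = y")
      case True
      then show ?thesis using c by (simp add: mult.commute)
    next
      case False
      then have "poly \<pi> (int y) = 0" using y by (auto simp: \<pi>_def poly_prod prod_zero_iff)
      then show ?thesis using False by simp
    qed
  qed
qed

section \<open>Certifying listed frequencies\<close>

text \<open>\<open>w t c\<close> stands for A, B, C when c = 0, 1, 2 and for the count z when c = 3.
  The ring is left open since the term is applied to the values of buckets and also to polynomials
  that extend them.\<close>

definition sumcheck_term :: "nat \<Rightarrow> nat \<Rightarrow> nat \<Rightarrow> nat \<Rightarrow> (nat \<Rightarrow> nat \<Rightarrow> 'a) \<Rightarrow> 'a :: comm_ring_1" where
  "sumcheck_term k \<Omega> \<Lambda> T w = w 0 0 ^ k + of_nat \<Omega> * (w 0 0 * w 0 2 - (w 0 1)\<^sup>2) +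
     of_nat (\<Omega> * \<Lambda>) * (\<Sum>t\<in>{1..T}. w t 3 * ((w t 0)\<^sup>2 + (w t 1)\<^sup>2 + (w t 2)\<^sup>2) + w t 3 * (w t 3 - 1))"

text \<open>Lagrange's identity, the defect in the Cauchy-Schwarz inequality. For nonnegative
  \<open>g\<close> and injective \<open>x\<close> it can vanish only if at most one weight is
  nonzero.\<close>

lemma moment_gap_double_sum:
  fixes g x :: "'b \<Rightarrow> int"
  shows "2 * (sum g J * (\<Sum>i\<in>J. x i ^ 2 * g i) - (\<Sum>i\<in>J. x i * g i)\<^sup>2) =
    (\<Sum>i\<in>J. \<Sum>j\<in>J. g i * g j * (x i - x j)\<^sup>2)"
proof -
  have "(\<Sum>i\<in>J. \<Sum>j\<in>J. g i * g j * (x i - x j)\<^sup>2) =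
      (\<Sum>i\<in>J. \<Sum>j\<in>J. (x i ^ 2 * g i) * g j + g i * (x j ^ 2 * g j) - 2 * ((x i * g i) * (x j * g j)))"
    by (intro sum.cong refl) (simp add: power2_eq_square algebra_simps)
  also have "\<dots> = (\<Sum>i\<in>J. x i ^ 2 * g i) * sum g J + sum g J * (\<Sum>i\<in>J. x i ^ 2 * g i)
      - 2 * ((\<Sum>i\<in>J. x i * g i) * (\<Sum>j\<in>J. x j * g j))"
    by (simp only: sum.distrib sum_subtractf sum_distrib_left[symmetric] sum_product)
  finally show ?thesis by (simp add: power2_eq_square algebra_simps)
qed

lemma power_sum_at_most_one_nonzero:
  fixes g :: "'b \<Rightarrow> int"
  assumes "finite J" "1 \<le> k" "\<And>i j. i \<in> J \<Longrightarrow> j \<in> J \<Longrightarrow> i \<noteq> j \<Longrightarrow> g i = 0 \<or> g j = 0"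
  shows "sum g J ^ k = (\<Sum>i\<in>J. g i ^ k)"
proof (cases "\<exists>i\<in>J. g i \<noteq> 0")
  case True
  then obtain i where i: "i \<in> J" "g i \<noteq> 0" by blast
  then have "\<And>j. j \<in> J - {i} \<Longrightarrow> g j = 0" using assms(3) by blast
  then have "sum g J = g i" "(\<Sum>i\<in>J. g i ^ k) = g i ^ k"
    using assms(1,2) i by (simp_all add: sum.remove[of J i])
  then show ?thesis by simp
next
  case False
  then show ?thesis using assms(2) by simp
qed

text \<open>At most \<open>n\<close> items, moment weights at most \<open>n ^ 2\<close>, residual
  frequencies at most \<open>B\<close> in absolute value.\<close>

definition val_bound :: "nat \<Rightarrow> nat \<Rightarrow> nat" where
  "val_bound n B = n * (n\<^sup>2 * B)"

definition moment_bound :: "nat \<Rightarrow> nat \<Rightarrow> nat \<Rightarrow> nat \<Rightarrow> nat" where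
  "moment_bound n k B U = U * val_bound n B ^ k + 1"

text \<open>The summand 2 leaves a margin: \<open>S3 \<ge> 1\<close> gives \<open>V \<ge> \<Omega> *
  \<Lambda> - \<Omega> * (\<Lambda> - 2) - (\<Omega> - 1) > \<Omega>\<close> even for the most
  negative \<open>S1\<close> and \<open>S2\<close>.\<close>

definition gap_bound :: "nat \<Rightarrow> nat \<Rightarrow> nat \<Rightarrow> nat" where
  "gap_bound n B U = 2 * U * (val_bound n B)\<^sup>2 + 2"

text \<open>\<open>f\<close> is the true frequency vector; \<open>l\<close> and \<open>tag\<close>
  are the frequencies and levels that a possibly dishonest prover lists. \<open>tag i = 0\<close>
  encodes that \<open>i\<close> is not listed, so level 0 never serves as an isolating
  level.\<close>

locale hashed_frequencies =
  fixes n k B T U :: nat and h :: "nat \<Rightarrow> nat \<Rightarrow> nat" and f :: "nat \<Rightarrow> int" and l tag :: "nat \<Rightarrow> nat"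
  assumes n: "1 \<le> n" and k: "1 \<le> k" and B: "1 \<le> B" and h: "\<And>t i. h t i < U"
    and f: "\<And>i. i \<in> {1..n} \<Longrightarrow> 0 \<le> f i" "\<And>i. i \<in> {1..n} \<Longrightarrow> f i \<le> int B"
    and l: "\<And>i. l i \<le> B" and untagged: "\<And>i. tag i = 0 \<Longrightarrow> l i = 0" and tag: "\<And>i. tag i \<le> T"
begin

text \<open>Level 0 subtracts the whole list, level \<open>t > 0\<close> only the entries listed for
  \<open>t\<close>, so that all other residuals there are true frequencies and hence
  nonnegative.\<close>

definition residual :: "nat \<Rightarrow> nat \<Rightarrow> int" where
  "residual t i = f i - (if t = 0 \<or> tag i = t then int (l i) else 0)"

definition vec :: "nat \<Rightarrow> nat \<Rightarrow> nat \<Rightarrow> int" where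
  "vec t c i = (if c < 3 then int i ^ c * residual t i else of_bool (t \<noteq> 0 \<and> tag i = t))"

definition bucket :: "nat \<Rightarrow> nat \<Rightarrow> nat set" where
  "bucket t j = {i \<in> {1..n}. h t i = j}"

definition val :: "nat \<Rightarrow> nat \<Rightarrow> nat \<Rightarrow> int" where
  "val t c j = (\<Sum>i\<in>bucket t j. vec t c i)"

definition S1 :: int where "S1 = (\<Sum>j<U. val 0 0 j ^ k)"

definition S2 :: int where "S2 = (\<Sum>j<U. val 0 0 j * val 0 2 j - (val 0 1 j)\<^sup>2)"

definition S3 :: int where
  "S3 = (\<Sum>j<U. \<Sum>t\<in>{1..T}. val t 3 j * ((val t 0 j)\<^sup>2 + (val t 1 j)\<^sup>2 + (val t 2 j)\<^sup>2) +
     val t 3 j * (val t 3 j - 1))"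

abbreviation R :: nat where "R \<equiv> val_bound n B"

abbreviation \<Omega> :: nat where "\<Omega> \<equiv> moment_bound n k B U"

abbreviation \<Lambda> :: nat where "\<Lambda> \<equiv> gap_bound n B U"

definition V :: int where "V = (\<Sum>j<U. sumcheck_term k \<Omega> \<Lambda> T (\<lambda>t c. val t c j))"

lemma V_eq: "V = S1 + int \<Omega> * S2 + int (\<Omega> * \<Lambda>) * S3"
  by (simp only: V_def sumcheck_term_def S1_def S2_def S3_def sum.distrib sum_distrib_left distrib_left)

lemma finite_bucket [simp]: "finite (bucket t j)"
  by (simp add: bucket_def)

lemma bucket_subset: "bucket t j \<subseteq> {1..n}"
  by (auto simp: bucket_def)

lemma abs_residual: "i \<in> {1..n} \<Longrightarrow> \<bar>residual t i\<bar> \<le> int B"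
  using f[of i] l[of i] by (auto simp: residual_def)

lemma R_pos: "1 \<le> R"
  using n B by (simp add: val_bound_def Suc_le_eq)

lemma abs_val_le:
  assumes "c < 3"
  shows "\<bar>val t c j\<bar> \<le> int R"
proof -
  have "\<bar>val t c j\<bar> \<le> (\<Sum>i\<in>bucket t j. \<bar>vec t c i\<bar>)" unfolding val_def by (rule sum_abs)
  also have "\<dots> \<le> (\<Sum>i\<in>bucket t j. int (n\<^sup>2 * B))"
  proof (rule sum_mono)
    fix i assume "i \<in> bucket t j"
    then have i: "i \<in> {1..n}" using bucket_subset by blast
    have "int i ^ c \<le> int n ^ c" using i by (intro power_mono) auto
    also have "\<dots> \<le> int n ^ 2" using n assms by (intro power_increasing) auto
    finally have "\<bar>int i ^ c * residual t i\<bar> \<le> int n ^ 2 * int B"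
      unfolding abs_mult by (intro mult_mono abs_residual[OF i]) auto
    then show "\<bar>vec t c i\<bar> \<le> int (n\<^sup>2 * B)" using assms by (simp add: vec_def)
  qed
  also have "\<dots> = int (card (bucket t j)) * int (n\<^sup>2 * B)" by simp
  also have "\<dots> \<le> int n * int (n\<^sup>2 * B)"
    using card_mono[OF _ bucket_subset, of t j] by (intro mult_right_mono) auto
  finally show ?thesis by (simp add: val_bound_def)
qed

lemma val3_bounds: "0 \<le> val t 3 j" "val t 3 j \<le> int R"
proof -
  show "0 \<le> val t 3 j" unfolding val_def by (rule sum_nonneg) (simp add: vec_def)
  have "val t 3 j \<le> (\<Sum>i\<in>bucket t j. 1)" unfolding val_def by (rule sum_mono) (simp add: vec_def)
  also have "\<dots> \<le> int n" using card_mono[OF _ bucket_subset, of t j] by simp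
  also have "n * 1 \<le> R" unfolding val_bound_def using n B by (intro mult_left_mono) (auto simp: Suc_le_eq)
  then have "int n \<le> int R" by simp
  finally show "val t 3 j \<le> int R" .
qed

lemma abs_S1_less: "\<bar>S1\<bar> < int \<Omega>"
proof -
  have "\<bar>S1\<bar> \<le> (\<Sum>j<U. \<bar>val 0 0 j ^ k\<bar>)" unfolding S1_def by (rule sum_abs)
  also have "\<dots> \<le> (\<Sum>j<U. int R ^ k)"
    unfolding power_abs by (intro sum_mono power_mono abs_val_le) auto
  finally show ?thesis by (simp add: moment_bound_def)
qed

lemma abs_S2_le: "\<bar>S2\<bar> \<le> int \<Lambda> - 2"
proof -
  have "\<bar>val 0 0 j * val 0 2 j - (val 0 1 j)\<^sup>2\<bar> \<le> 2 * (int R)\<^sup>2" for j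
  proof -
    have "\<bar>val 0 0 j * val 0 2 j\<bar> \<le> int R * int R"
      unfolding abs_mult by (intro mult_mono abs_val_le) auto
    moreover have "\<bar>(val 0 1 j)\<^sup>2\<bar> \<le> int R * int R"
      unfolding power2_eq_square abs_mult by (intro mult_mono abs_val_le) auto
    ultimately show ?thesis
      using abs_triangle_ineq4[of "val 0 0 j * val 0 2 j" "(val 0 1 j)\<^sup>2"]
      by (simp only: power2_eq_square)
  qed
  then have "\<bar>S2\<bar> \<le> (\<Sum>j<U. 2 * (int R)\<^sup>2)"
    unfolding S2_def by (intro order_trans[OF sum_abs] sum_mono)
  then show ?thesis by (simp add: gap_bound_def)
qed

lemma S3_term_nonneg:
  "0 \<le> val t 3 j * ((val t 0 j)\<^sup>2 + (val t 1 j)\<^sup>2 + (val t 2 j)\<^sup>2)"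
  "0 \<le> val t 3 j * (val t 3 j - 1)"
proof -
  show "0 \<le> val t 3 j * ((val t 0 j)\<^sup>2 + (val t 1 j)\<^sup>2 + (val t 2 j)\<^sup>2)"
    using val3_bounds(1) by (intro mult_nonneg_nonneg) auto
  show "0 \<le> val t 3 j * (val t 3 j - 1)"
    using val3_bounds(1)[of t j] by (cases "val t 3 j = 0") (auto intro!: mult_nonneg_nonneg)
qed

lemma S3_nonneg: "0 \<le> S3"
  unfolding S3_def using S3_term_nonneg by (intro sum_nonneg add_nonneg_nonneg) auto

lemma S3_le: "S3 \<le> int (4 * U * T * R ^ 3)"
proof -
  have le: "val t 3 j * ((val t 0 j)\<^sup>2 + (val t 1 j)\<^sup>2 + (val t 2 j)\<^sup>2) + val t 3 j * (val t 3 j - 1) \<le>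
      4 * (int R) ^ 3" for t j
  proof -
    have sq: "(val t c j)\<^sup>2 \<le> (int R)\<^sup>2" if "c < 3" for c
      using abs_val_le[OF that, of t j] by (metis abs_ge_zero power2_abs power_mono)
    have "val t 3 j * ((val t 0 j)\<^sup>2 + (val t 1 j)\<^sup>2 + (val t 2 j)\<^sup>2) \<le> int R * ((int R)\<^sup>2 + (int R)\<^sup>2 + (int R)\<^sup>2)"
      using val3_bounds sq by (intro mult_mono add_mono) auto
    moreover have "val t 3 j * (val t 3 j - 1) \<le> int R * (int R)\<^sup>2"
    proof -
      have "val t 3 j * (val t 3 j - 1) \<le> val t 3 j * val t 3 j"
        using val3_bounds(1)[of t j] by (intro mult_left_mono) auto
      also have "\<dots> \<le> int R * int R" using val3_bounds by (intro mult_mono) auto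
      also have "\<dots> \<le> int R * (int R)\<^sup>2"
        using R_pos by (intro mult_left_mono) (auto simp: power2_eq_square)
      finally show ?thesis .
    qed
    ultimately show ?thesis by (simp add: power3_eq_cube power2_eq_square)
  qed
  have "S3 \<le> (\<Sum>j<U. \<Sum>t\<in>{1..T}. 4 * (int R) ^ 3)"
    unfolding S3_def by (intro sum_mono le)
  then show ?thesis by (simp add: mult_ac)
qed

lemma V_less: "V < int (\<Omega> * \<Lambda> * (1 + 4 * U * T * R ^ 3))"
proof -
  have "V \<le> (int \<Omega> - 1) + int \<Omega> * (int \<Lambda> - 2) + int (\<Omega> * \<Lambda>) * int (4 * U * T * R ^ 3)"
    unfolding V_eq using abs_S1_less abs_S2_le S3_le by (intro add_mono mult_left_mono) auto
  also have "\<dots> < int (\<Omega> * \<Lambda> * (1 + 4 * U * T * R ^ 3))"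
    by (simp add: algebra_simps)
  finally show ?thesis .
qed

text \<open>In the bucket of \<open>i\<close> on level \<open>tag i\<close>,
  \<open>z * (z - 1) = 0\<close> leaves \<open>i\<close> as the only item listed for that level, so
  all other residuals are true frequencies. The residual of \<open>i\<close> has unknown sign;
  centring the moments at \<open>i\<close> eliminates it, then the others vanish by nonnegativity,
  and \<open>A = 0\<close> finishes.\<close>

lemma S3_zero_imp_residual:
  assumes "S3 = 0" "i \<in> {1..n}" "tag i \<noteq> 0"
  shows "f i = int (l i)"
proof -
  define t j where "t = tag i" and "j = h t i"
  have t: "t \<in> {1..T}" using assms(3) tag[of i] by (simp add: t_def)
  have nn: "0 \<le> (\<Sum>t\<in>{1..T}. val t 3 j * ((val t 0 j)\<^sup>2 + (val t 1 j)\<^sup>2 + (val t 2 j)\<^sup>2) +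
     val t 3 j * (val t 3 j - 1))" for j
    using S3_term_nonneg by (intro sum_nonneg add_nonneg_nonneg) auto
  have "(\<Sum>t\<in>{1..T}. val t 3 j * ((val t 0 j)\<^sup>2 + (val t 1 j)\<^sup>2 + (val t 2 j)\<^sup>2) +
     val t 3 j * (val t 3 j - 1)) = 0"
    using assms(1) h[of t i] nn unfolding S3_def j_def by (subst (asm) sum_nonneg_eq_0_iff) auto
  then have "val t 3 j * ((val t 0 j)\<^sup>2 + (val t 1 j)\<^sup>2 + (val t 2 j)\<^sup>2) + val t 3 j * (val t 3 j - 1) = 0"
    using t S3_term_nonneg by (subst (asm) sum_nonneg_eq_0_iff) (auto intro: add_nonneg_nonneg)
  then have z1: "val t 3 j * ((val t 0 j)\<^sup>2 + (val t 1 j)\<^sup>2 + (val t 2 j)\<^sup>2) = 0"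
    and z2: "val t 3 j * (val t 3 j - 1) = 0"
    using S3_term_nonneg[of t j] by linarith+
  have ib: "i \<in> bucket t j" using assms(2) by (simp add: bucket_def j_def)
  have v3: "val t 3 j = 1 + (\<Sum>i'\<in>bucket t j - {i}. vec t 3 i')"
    unfolding val_def using ib t by (subst sum.remove[of _ i]) (auto simp: vec_def t_def)
  have vec3: "0 \<le> vec t 3 i'" for i' by (simp add: vec_def)
  then have "0 \<le> (\<Sum>i'\<in>bucket t j - {i}. vec t 3 i')" by (intro sum_nonneg)
  then have "val t 3 j = 1" using z2 v3 by auto
  then have "(\<Sum>i'\<in>bucket t j - {i}. vec t 3 i') = 0" using v3 by simp
  then have "\<forall>i'\<in>bucket t j - {i}. vec t 3 i' = 0" using vec3 by (subst (asm) sum_nonneg_eq_0_iff) auto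
  then have others: "residual t i' = f i'" if "i' \<in> bucket t j - {i}" for i'
    using that t by (auto simp: vec_def residual_def)
  have "(val t 0 j)\<^sup>2 + (val t 1 j)\<^sup>2 + (val t 2 j)\<^sup>2 = 0" using z1 \<open>val t 3 j = 1\<close> by simp
  then have "(val t 0 j)\<^sup>2 = 0" "(val t 1 j)\<^sup>2 = 0" "(val t 2 j)\<^sup>2 = 0"
    using zero_le_power2[of "val t 0 j"] zero_le_power2[of "val t 1 j"] zero_le_power2[of "val t 2 j"]
    by linarith+
  then have v: "val t 0 j = 0" "val t 1 j = 0" "val t 2 j = 0" by auto
  \<comment> \<open>The moments combine to one with the weights \<open>(i' - i)\<^sup>2\<close>, which only vanish at the listed item.\<close>
  have "(\<Sum>i'\<in>bucket t j. (int i' - int i)\<^sup>2 * residual t i') =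
      val t 2 j - 2 * int i * val t 1 j + (int i)\<^sup>2 * val t 0 j"
    unfolding val_def vec_def sum_distrib_left sum_subtractf[symmetric] sum.distrib[symmetric]
    by (intro sum.cong refl) (simp add: power2_eq_square algebra_simps)
  also have "\<dots> = 0" using v by simp
  also have "(\<Sum>i'\<in>bucket t j. (int i' - int i)\<^sup>2 * residual t i') =
      (\<Sum>i'\<in>bucket t j - {i}. (int i' - int i)\<^sup>2 * f i')"
    using ib others by (subst sum.remove[of _ i]) auto
  finally have "(\<Sum>i'\<in>bucket t j - {i}. (int i' - int i)\<^sup>2 * f i') = 0" .
  moreover have "0 \<le> (int i' - int i)\<^sup>2 * f i'" if "i' \<in> bucket t j - {i}" for i'
    using that f(1)[of i'] subsetD[OF bucket_subset, of i' t j] by (intro mult_nonneg_nonneg) auto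
  ultimately have "\<forall>i'\<in>bucket t j - {i}. (int i' - int i)\<^sup>2 * f i' = 0"
    by (subst (asm) sum_nonneg_eq_0_iff) auto
  then have "\<forall>i'\<in>bucket t j - {i}. vec t 0 i' = 0" using others by (auto simp: vec_def)
  then have "vec t 0 i = 0"
    using v(1) ib unfolding val_def by (subst (asm) sum.remove[of _ i]) auto
  then show ?thesis by (simp add: vec_def residual_def t_def)
qed

lemma gap_nonneg:
  assumes "\<And>i. i \<in> {1..n} \<Longrightarrow> 0 \<le> residual 0 i"
  shows "0 \<le> val 0 0 j * val 0 2 j - (val 0 1 j)\<^sup>2"
    and "val 0 0 j * val 0 2 j - (val 0 1 j)\<^sup>2 = 0 \<Longrightarrow> i \<in> bucket 0 j \<Longrightarrow> i' \<in> bucket 0 j \<Longrightarrow> i \<noteq> i' \<Longrightarrow>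
      residual 0 i = 0 \<or> residual 0 i' = 0"
proof -
  let ?s = "\<lambda>i i'. residual 0 i * residual 0 i' * (int i - int i')\<^sup>2"
  have eq: "2 * (val 0 0 j * val 0 2 j - (val 0 1 j)\<^sup>2) = (\<Sum>i\<in>bucket 0 j. \<Sum>i'\<in>bucket 0 j. ?s i i')"
    using moment_gap_double_sum[of "residual 0" "bucket 0 j" int] by (simp add: val_def vec_def)
  have nn: "0 \<le> ?s i i'" if "i \<in> bucket 0 j" "i' \<in> bucket 0 j" for i i'
    using assms subsetD[OF bucket_subset that(1)] subsetD[OF bucket_subset that(2)]
    by (intro mult_nonneg_nonneg) simp_all
  have "0 \<le> (\<Sum>i\<in>bucket 0 j. \<Sum>i'\<in>bucket 0 j. ?s i i')" using nn by (intro sum_nonneg)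
  then have "0 \<le> 2 * (val 0 0 j * val 0 2 j - (val 0 1 j)\<^sup>2)" by (simp only: eq)
  moreover have "0 \<le> x" if "0 \<le> 2 * x" for x :: int using that by simp
  ultimately show "0 \<le> val 0 0 j * val 0 2 j - (val 0 1 j)\<^sup>2" by blast
  assume "val 0 0 j * val 0 2 j - (val 0 1 j)\<^sup>2 = 0" and i: "i \<in> bucket 0 j" "i' \<in> bucket 0 j" "i \<noteq> i'"
  then have "(\<Sum>i\<in>bucket 0 j. \<Sum>i'\<in>bucket 0 j. ?s i i') = 0" using eq by simp
  then have "(\<Sum>i'\<in>bucket 0 j. ?s i i') = 0"
    using nn i by (subst (asm) sum_nonneg_eq_0_iff) (auto intro: sum_nonneg)
  then have "?s i i' = 0"
    using nn i by (subst (asm) sum_nonneg_eq_0_iff) auto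
  then show "residual 0 i = 0 \<or> residual 0 i' = 0" using i by auto
qed

lemma sum_buckets: "(\<Sum>j<U. \<Sum>i\<in>bucket t j. F i) = (\<Sum>i\<in>{1..n}. F i)"
  unfolding bucket_def by (rule sum.group) (use h in auto)

lemma S1_eq:
  assumes "\<And>j i i'. i \<in> bucket 0 j \<Longrightarrow> i' \<in> bucket 0 j \<Longrightarrow> i \<noteq> i' \<Longrightarrow> residual 0 i = 0 \<or> residual 0 i' = 0"
  shows "S1 = (\<Sum>i\<in>{1..n}. residual 0 i ^ k)"
proof -
  have "val 0 0 j ^ k = (\<Sum>i\<in>bucket 0 j. residual 0 i ^ k)" for j
    using power_sum_at_most_one_nonzero[OF finite_bucket k, of 0 j "residual 0"] assms
    by (simp add: val_def vec_def)
  then show ?thesis by (simp add: S1_def sum_buckets)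
qed

lemma moment_split:
  assumes "\<And>i. i \<in> {1..n} \<Longrightarrow> tag i \<noteq> 0 \<Longrightarrow> f i = int (l i)"
  shows "(\<Sum>i\<in>{1..n}. f i ^ k) = (\<Sum>i\<in>{1..n}. residual 0 i ^ k) + (\<Sum>i\<in>{1..n}. int (l i) ^ k)"
  unfolding sum.distrib[symmetric]
proof (rule sum.cong)
  fix i assume "i \<in> {1..n}"
  then show "f i ^ k = residual 0 i ^ k + int (l i) ^ k"
    using assms[of i] untagged[of i] k by (cases "tag i = 0") (simp_all add: residual_def)
qed simp

text \<open>\<open>V\<close> is read in mixed radix with digits \<open>S1\<close>,
  \<open>S2\<close>, \<open>S3\<close>. A priori \<open>S2\<close> may be negative, so
  \<open>S3 = 0\<close> comes first; it makes the list right and thereby the residuals on level 0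
  nonnegative, and only then is \<open>S2\<close> a genuine digit that must vanish.\<close>

lemma accepted_value_correct:
  assumes p: "\<Omega> * \<Lambda> * (1 + 4 * U * T * R ^ 3) \<le> p"
    and S: "0 \<le> S" "S < int \<Omega>" "V mod int p = S mod int p"
  shows "S + (\<Sum>i\<in>{1..n}. int (l i) ^ k) = (\<Sum>i\<in>{1..n}. f i ^ k)"
proof -
  have \<Omega>p: "\<Omega> \<le> p"
  proof -
    have "\<Omega> * 1 \<le> \<Omega> * \<Lambda> * (1 + 4 * U * T * R ^ 3)"
      unfolding mult.assoc by (rule mult_le_mono2) (simp add: gap_bound_def)
    then show ?thesis using p by linarith
  qed
  \<comment> \<open>A negative \<open>V\<close> is not excluded yet, so the congruence yields
    equality only under this premise.\<close>
  have eq: "V = S" if "0 \<le> V"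
    using that V_less p S \<Omega>p by (metis mod_pos_pos_trivial of_nat_le_iff order_less_le_trans)
  have S3: "S3 = 0"
  proof (rule ccontr)
    assume "S3 \<noteq> 0"
    then have "1 \<le> S3" using S3_nonneg by simp
    then have "int (\<Omega> * \<Lambda>) * 1 \<le> int (\<Omega> * \<Lambda>) * S3" by (intro mult_left_mono) auto
    moreover have "int \<Omega> * (2 - int \<Lambda>) \<le> int \<Omega> * S2" using abs_S2_le by (intro mult_left_mono) auto
    ultimately have "int \<Omega> < V" using abs_S1_less unfolding V_eq by (simp add: algebra_simps)
    then show False using eq S by simp
  qed
  have list: "f i = int (l i)" if "i \<in> {1..n}" "tag i \<noteq> 0" for i
    using S3_zero_imp_residual[OF S3 that] .
  have res: "0 \<le> residual 0 i" if "i \<in> {1..n}" for i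
    using list[OF that] f(1)[OF that] untagged[of i] by (cases "tag i = 0") (auto simp: residual_def)
  have S2nn: "0 \<le> S2" unfolding S2_def by (intro sum_nonneg gap_nonneg(1) res)
  have "0 \<le> S1" unfolding S1_def val_def vec_def
    using res bucket_subset by (intro sum_nonneg zero_le_power) fastforce
  have S2: "S2 = 0"
  proof (rule ccontr)
    assume "S2 \<noteq> 0"
    then have "int \<Omega> * 1 \<le> int \<Omega> * S2" using S2nn by (intro mult_left_mono) auto
    then have "int \<Omega> \<le> V" using \<open>0 \<le> S1\<close> S3 unfolding V_eq by simp
    then show False using eq S by simp
  qed
  have "V = S1" using S2 S3 by (simp add: V_eq)
  then have "S = S1" using eq \<open>0 \<le> S1\<close> by simp
  moreover have "S1 = (\<Sum>i\<in>{1..n}. residual 0 i ^ k)"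
  proof (rule S1_eq)
    fix j i i' assume i: "i \<in> bucket 0 j" "i' \<in> bucket 0 j" "i \<noteq> i'"
    then have "j < U" using h by (auto simp: bucket_def)
    then have "val 0 0 j * val 0 2 j - (val 0 1 j)\<^sup>2 = 0"
      using S2 gap_nonneg(1)[OF res] unfolding S2_def by (subst (asm) sum_nonneg_eq_0_iff) auto
    then show "residual 0 i = 0 \<or> residual 0 i' = 0" using gap_nonneg(2)[OF res] i by blast
  qed
  ultimately show ?thesis using moment_split[OF list] by simp
qed

text \<open>When every collision on level 0 is listed, at most one nonzero residual per bucket
  remains, whence \<open>S2 = 0\<close>. As listed items have nonzero frequency, an isolated one
  shares its bucket on its level with no other listed item, so that \<open>z = 1\<close> there and
  \<open>S3 = 0\<close>.\<close>

lemma honest_value: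
  assumes list: "\<And>i. i \<in> {1..n} \<Longrightarrow> tag i \<noteq> 0 \<Longrightarrow> f i = int (l i) \<and> f i \<noteq> 0"
    and collide: "\<And>i i'. i \<in> {1..n} \<Longrightarrow> i' \<in> {1..n} \<Longrightarrow> i \<noteq> i' \<Longrightarrow> h 0 i = h 0 i' \<Longrightarrow>
        f i \<noteq> 0 \<Longrightarrow> f i' \<noteq> 0 \<Longrightarrow> tag i \<noteq> 0"
    and isolated: "\<And>i i'. i \<in> {1..n} \<Longrightarrow> i' \<in> {1..n} \<Longrightarrow> i \<noteq> i' \<Longrightarrow> tag i \<noteq> 0 \<Longrightarrow>
        h (tag i) i = h (tag i) i' \<Longrightarrow> f i' = 0"
  shows "V + (\<Sum>i\<in>{1..n}. int (l i) ^ k) = (\<Sum>i\<in>{1..n}. f i ^ k)" and "0 \<le> V" and "V < int \<Omega>"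
proof -
  have res: "residual 0 i = (if tag i = 0 then f i else 0)" if "i \<in> {1..n}" for i
    using list[OF that] untagged[of i] by (auto simp: residual_def)
  have one: "residual 0 i = 0 \<or> residual 0 i' = 0"
    if "i \<in> bucket 0 j" "i' \<in> bucket 0 j" "i \<noteq> i'" for j i i'
    using that collide[of i i'] by (cases "f i = 0"; cases "f i' = 0") (auto simp: bucket_def res)
  have S1: "S1 = (\<Sum>i\<in>{1..n}. residual 0 i ^ k)" by (rule S1_eq) (rule one)
  have "val 0 0 j * val 0 2 j - (val 0 1 j)\<^sup>2 = 0" for j
  proof -
    have "residual 0 i * residual 0 i' * (int i - int i')\<^sup>2 = 0" if "i \<in> bucket 0 j" "i' \<in> bucket 0 j" for i i'
      using one[OF that] by (cases "i = i'") auto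
    then have "(\<Sum>i\<in>bucket 0 j. \<Sum>i'\<in>bucket 0 j. residual 0 i * residual 0 i' * (int i - int i')\<^sup>2) = 0"
      by (intro sum.neutral ballI) 
    then show ?thesis
      using moment_gap_double_sum[of "residual 0" "bucket 0 j" int] by (simp add: val_def vec_def)
  qed
  then have S2: "S2 = 0" by (simp add: S2_def)
  have "val t 3 j * ((val t 0 j)\<^sup>2 + (val t 1 j)\<^sup>2 + (val t 2 j)\<^sup>2) + val t 3 j * (val t 3 j - 1) = 0"
    if t: "t \<in> {1..T}" for t j
  proof (cases "\<exists>i\<in>bucket t j. tag i = t")
    case False
    then have "val t 3 j = 0" unfolding val_def by (intro sum.neutral) (auto simp: vec_def)
    then show ?thesis by simp
  next
    case True
    then obtain i where i: "i \<in> bucket t j" "tag i = t" by blast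
    have i1: "i \<in> {1..n}" using i bucket_subset by blast
    have other: "f i' = 0 \<and> tag i' = 0" if "i' \<in> bucket t j" "i' \<noteq> i" for i'
    proof -
      have i'1: "i' \<in> {1..n}" using that bucket_subset by blast
      have "f i' = 0" using isolated[OF i1 i'1] that i t by (auto simp: bucket_def)
      then show ?thesis using list[OF i'1] by auto
    qed
    have "residual t i' = 0" if "i' \<in> bucket t j" for i'
      using list[OF i1] i t other[OF that] by (cases "i' = i") (auto simp: residual_def)
    then have v: "val t c j = 0" if "c < 3" for c
      unfolding val_def using that by (intro sum.neutral) (auto simp: vec_def)
    have "val t 3 j = 1 + (\<Sum>i'\<in>bucket t j - {i}. vec t 3 i')"
      unfolding val_def using i t by (subst sum.remove[of _ i]) (auto simp: vec_def)
    also have "(\<Sum>i'\<in>bucket t j - {i}. vec t 3 i') = 0"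
      using other t by (intro sum.neutral) (auto simp: vec_def)
    finally show ?thesis using v by simp
  qed
  then have S3: "S3 = 0" unfolding S3_def by (intro sum.neutral ballI)
  have V: "V = S1" using S2 S3 by (simp add: V_eq)
  show "V + (\<Sum>i\<in>{1..n}. int (l i) ^ k) = (\<Sum>i\<in>{1..n}. f i ^ k)"
    using V S1 moment_split list by simp
  have "0 \<le> residual 0 i" if "i \<in> {1..n}" for i
    using res[OF that] f(1)[OF that] by simp
  then show "0 \<le> V" unfolding V S1 by (intro sum_nonneg zero_le_power)
  show "V < int \<Omega>" using V abs_S1_less by linarith
qed

end

section \<open>Power sums of sparse vectors\<close>

text \<open>Syndrome decoding as for Reed-Solomon codes: \<open>f - g\<close> has at most
  \<open>2 * m\<close> nonzero entries, so a polynomial \<open>q\<close> of degree below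
  \<open>2 * m\<close> can vanish on all of them but \<open>i0\<close>. Pairing it with the power
  sums isolates \<open>(f i0 - g i0) * poly q i0\<close>, whose factors are nonzero and below
  \<open>p\<close> in absolute value.\<close>

lemma syndrome_determines:
  fixes f g :: "nat \<Rightarrow> int"
  assumes p: "prime p" "n < p" "B < p"
    and f: "\<And>i. i \<in> {1..n} \<Longrightarrow> 0 \<le> f i \<and> f i \<le> int B" "card {i\<in>{1..n}. f i \<noteq> 0} \<le> m"
    and g: "\<And>i. i \<in> {1..n} \<Longrightarrow> 0 \<le> g i \<and> g i \<le> int B" "card {i\<in>{1..n}. g i \<noteq> 0} \<le> m"
    and eq: "\<And>j. j < 2 * m \<Longrightarrow> [(\<Sum>i\<in>{1..n}. f i * int i ^ j) = (\<Sum>i\<in>{1..n}. g i * int i ^ j)] (mod int p)"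
    and i0: "i0 \<in> {1..n}"
  shows "f i0 = g i0"
proof (rule ccontr)
  assume neq: "f i0 \<noteq> g i0"
  define h where "h i = f i - g i" for i
  define D where "D = {i\<in>{1..n}. h i \<noteq> 0}"
  have i0D: "i0 \<in> D" using i0 neq by (simp add: D_def h_def)
  have finD: "finite D" by (simp add: D_def)
  have "D \<subseteq> {i\<in>{1..n}. f i \<noteq> 0} \<union> {i\<in>{1..n}. g i \<noteq> 0}" by (auto simp: D_def h_def)
  then have "card D \<le> card ({i\<in>{1..n}. f i \<noteq> 0} \<union> {i\<in>{1..n}. g i \<noteq> 0})" by (intro card_mono) auto
  also have "\<dots> \<le> card {i\<in>{1..n}. f i \<noteq> 0} + card {i\<in>{1..n}. g i \<noteq> 0}" by (rule card_Un_le)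
  finally have cardD: "card D \<le> 2 * m" using f g by simp
  define q where "q = (\<Prod>i\<in>D - {i0}. [:- int i, 1:])"
  have "degree q \<le> (\<Sum>i\<in>D - {i0}. degree [:- int i, 1:])"
    unfolding q_def using degree_prod_sum_le[of "D - {i0}" "\<lambda>i. [:- int i, 1:]"] finD by (simp add: o_def)
  also have "\<dots> = card D - 1" using finD i0D by simp
  finally have degq: "degree q < 2 * m"
    using cardD i0D finD card_gt_0_iff[of D] by (metis diff_less empty_iff less_le_trans order_le_less_trans zero_less_one)
  have "int p dvd (\<Sum>i\<in>{1..n}. h i * int i ^ j)" if "j < 2 * m" for j
    using eq[OF that] unfolding cong_iff_dvd_diff sum_subtractf[symmetric] h_def by (simp add: left_diff_distrib)
  then have "int p dvd (\<Sum>j\<le>degree q. coeff q j * (\<Sum>i\<in>{1..n}. h i * int i ^ j))"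
    using degq by (intro dvd_sum, intro dvd_mult) auto
  also have "(\<Sum>j\<le>degree q. coeff q j * (\<Sum>i\<in>{1..n}. h i * int i ^ j)) = (\<Sum>i\<in>{1..n}. h i * poly q (int i))"
    unfolding poly_altdef sum_distrib_left by (subst sum.swap) (simp add: mult_ac)
  also have "\<dots> = h i0 * poly q (int i0)"
  proof -
    have "h i * poly q (int i) = 0" if "i \<in> {1..n} - {i0}" for i
      using that finD by (cases "i \<in> D") (auto simp: q_def poly_prod prod_zero_iff D_def)
    then have "(\<Sum>i\<in>{1..n} - {i0}. h i * poly q (int i)) = 0" by (intro sum.neutral ballI)
    then show ?thesis using i0 by (simp add: sum.remove[of _ i0])
  qed
  finally have "int p dvd h i0 \<or> int p dvd poly q (int i0)" using p by (simp add: prime_dvd_mult_iff)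
  then show False
  proof
    assume "int p dvd h i0"
    moreover have "\<bar>h i0\<bar> < int p" proof -
      have "int B < int p" using p(3) by simp
      then show ?thesis using f(1)[OF i0] g(1)[OF i0] unfolding h_def by linarith
    qed
    ultimately have "h i0 = 0" by (metis abs_of_nat dvd_imp_le_int linorder_not_less)
    then show False using neq by (simp add: h_def)
  next
    assume "int p dvd poly q (int i0)"
    then obtain i where i: "i \<in> D" "i \<noteq> i0" "int p dvd int i0 - int i"
      using p finD by (auto simp: q_def poly_prod prime_dvd_prod_iff)
    then have "\<bar>int i0 - int i\<bar> < int p" using i0 p(2) by (auto simp: D_def)
    then have "int i0 - int i = 0" using i(3) by (metis abs_of_nat dvd_imp_le_int linorder_not_less)
    then show False using i(2) by simp
  qed
qed

lemma freq_weighted_sum: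
  assumes "\<And>u. u \<in> set x \<Longrightarrow> fst u \<in> {1..n}"
  shows "(\<Sum>(i, d)\<leftarrow>x. d * w i) = (\<Sum>i\<in>{1..n}. freq x i * w i)"
  using assms
proof (induction x)
  case (Cons u x)
  have "(\<Sum>j\<in>{1..n}. (if fst u = j then snd u else 0) * w j) = snd u * w (fst u)"
    using Cons.prems[of u] by (simp add: if_distrib[of "\<lambda>z. z * _"] cong: if_cong)
  then show ?case using Cons by (simp add: distrib_right sum.distrib case_prod_beta)
qed simp

definition silent_prover :: prover where
  "silent_prover = \<lparr>prover_coins = return_pmf [], annot = (\<lambda>_ _ _. [])\<rparr>"

text \<open>The verifier is deterministic and keeps \<open>2 * m\<close> residues of
  \<open>E\<close> bits; the prover is silent. The output function may search for an input stream
  with the stored syndromes, since computing time is not charged.\<close>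

lemma syndrome_scheme:
  assumes p: "prime p" "n < p" "B < p" "p \<le> 2 ^ E"
  shows "\<exists>P V. online_scheme (sparse_streams n m B N) (freq_moment k n) 0 (real (2 * m * E)) P V \<and>
    coins_in_memory V"
proof -
  let ?X = "sparse_streams n m B N"
  define syn where "syn x = restrict (\<lambda>j. (\<Sum>(i, d)\<leftarrow>x. d * int i ^ j) mod int p) {..<2*m}" for x :: stream
  define \<phi> where "\<phi> r ts = syn (token_updates ts)" for r :: nat and ts
  define out where "out q = Some (freq_moment k n (SOME x. x \<in> ?X \<and> syn x = q))" for q
  have p0: "0 < p" using p by simp
  have syn_snoc: "syn (x @ [u]) = restrict (\<lambda>j. (syn x j + snd u * int (fst u) ^ j) mod int p) {..<2*m}" for x u
    by (auto simp: syn_def restrict_def mod_simps split: prod.splits)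
  obtain V where V: "memory_bits V (2 * m * E)" "coins_in_memory V"
    "verifier_coins V = map_pmf (\<lambda>i. replicate i True) (return_pmf 0)"
    "\<And>ts i. result V ts (replicate i True) = out (\<phi> i ts)"
  proof (rule verifier_of_summary[where \<phi> = \<phi> and Q = "{..<2*m} \<rightarrow>\<^sub>E {0..<int p}"
        and out = out and M = "return_pmf 0"])
    show "finite ({..<2*m} \<rightarrow>\<^sub>E {0..<int p})" by (intro finite_PiE) auto
    have "card ({..<2*m} \<rightarrow>\<^sub>E {0..<int p}) = p ^ (2 * m)" by (simp add: card_PiE)
    also have "\<dots> \<le> (2 ^ E) ^ (2 * m)" using p by (intro power_mono) auto
    finally show "card ({..<2*m} \<rightarrow>\<^sub>E {0..<int p}) \<le> 2 ^ (2 * m * E)"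
      by (simp add: power_mult[symmetric] mult.commute)
    show "\<phi> r ts \<in> {..<2*m} \<rightarrow>\<^sub>E {0..<int p}" for r ts
      using p0 by (auto simp: \<phi>_def syn_def)
    show "\<phi> r (ts @ [t]) = \<phi> r' (ts' @ [t])" if "\<phi> r ts = \<phi> r' ts'" for r r' ts ts' t
      using that by (cases t) (simp_all add: \<phi>_def token_updates_def syn_snoc)
  qed (rule that)
  have correct: "result V (interleave x a) (replicate i True) = Some (freq_moment k n x)"
    if x: "x \<in> ?X" and a: "length a = length x" for x a i
  proof -
    define y where "y = (SOME y. y \<in> ?X \<and> syn y = syn x)"
    have y: "y \<in> ?X" "syn y = syn x"
      using someI[of "\<lambda>y. y \<in> ?X \<and> syn y = syn x" x] x by (auto simp: y_def)
    have bounds: "0 \<le> freq z i \<and> freq z i \<le> int B" "card {i\<in>{1..n}. freq z i \<noteq> 0} \<le> m"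
      "\<And>u. u \<in> set z \<Longrightarrow> fst u \<in> {1..n}" if "z \<in> ?X" "i \<in> {1..n}" for z i
      using that by (auto simp: sparse_streams_def strict_turnstile_def sparsity_def dest!: spec[of _ "length z"])
    have "freq x i = freq y i" if i: "i \<in> {1..n}" for i
    proof (rule syndrome_determines[OF p(1,2,3), of "freq x" m "freq y"])
      fix j assume j: "j < 2 * m"
      have "(\<Sum>(i, d)\<leftarrow>x. d * int i ^ j) mod int p = (\<Sum>(i, d)\<leftarrow>y. d * int i ^ j) mod int p"
        using fun_cong[OF y(2), of j] j by (simp add: syn_def)
      then show "[(\<Sum>i\<in>{1..n}. freq x i * int i ^ j) = (\<Sum>i\<in>{1..n}. freq y i * int i ^ j)] (mod int p)"
        using freq_weighted_sum[of x n "\<lambda>i. int i ^ j"] freq_weighted_sum[of y n "\<lambda>i. int i ^ j"]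
          bounds(3)[OF x i] bounds(3)[OF y(1) i] by (simp add: cong_def)
    qed (use bounds[OF x] bounds[OF y(1)] i in auto)
    then have "freq_moment k n x = freq_moment k n y" by (simp add: freq_moment_def)
    then show ?thesis using a by (simp add: V(4) \<phi>_def token_updates_interleave out_def y_def)
  qed
  have "online_scheme ?X (freq_moment k n) 0 (real (2 * m * E)) silent_prover V"
    unfolding online_scheme_def
  proof (intro conjI)
    show "online silent_prover" by (simp add: online_def silent_prover_def)
    show "\<forall>x\<in>?X. \<forall>r\<in>set_pmf (prover_coins silent_prover).
        real (sum_list (map length (annotations silent_prover x r))) \<le> 0"
      by (auto simp: annotations_def silent_prover_def o_def)
    show "\<exists>w. real w \<le> real (2 * m * E) \<and> memory_bits V w" using V(1) by blast
    have len: "length (annotations silent_prover x r) = length x" for x r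
      by (simp add: annotations_def del: upt_Suc)
    have V0: "verifier_coins V = return_pmf []" by (simp add: V(3))
    have V1: "result V ts [] = out (\<phi> 0 ts)" for ts using V(4)[of ts 0] by simp
    have c: "result V (interleave x a) [] = Some (freq_moment k n x)" if "x \<in> ?X" "length a = length x" for x a
      using correct[OF that, of 0] by simp
    show "completeness_error ?X (freq_moment k n) silent_prover V (1/3)"
      unfolding completeness_error_def
      by (auto simp: V0 silent_prover_def c[OF _ len, unfolded silent_prover_def])
    show "soundness_error ?X (freq_moment k n) V (1/3)"
      unfolding soundness_error_def by (auto simp: V0 c)
  qed
  then show ?thesis using V(2) by blast
qed

section \<open>Hash families\<close>

lemma pmf_markov:
  fixes f :: "'a \<Rightarrow> real"
  assumes "integrable (measure_pmf M) f" "\<And>x. 0 \<le> f x"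
  shows "c * measure_pmf.prob M {x. c \<le> f x} \<le> measure_pmf.expectation M f"
proof -
  have "c * measure_pmf.prob M {x. c \<le> f x} = measure_pmf.expectation M (\<lambda>x. c * indicator {x. c \<le> f x} x)"
    by simp
  also have "\<dots> \<le> measure_pmf.expectation M f"
  proof (rule integral_mono)
    show "integrable (measure_pmf M) (\<lambda>x. c * indicator {x. c \<le> f x} x)"
      by (rule measure_pmf.integrable_const_bound[where B = "\<bar>c\<bar>"]) (auto simp: indicator_def)
  qed (use assms in \<open>auto simp: indicator_def\<close>)
  finally show ?thesis .
qed

definition collisions :: "(nat \<Rightarrow> nat) \<Rightarrow> nat set \<Rightarrow> nat set" where
  "collisions h S = {i\<in>S. \<exists>j\<in>S. j \<noteq> i \<and> h j = h i}"

text \<open>Isolation is demanded for all of \<open>S\<close>, which a union bound can afford and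
  which avoids conditioning on the collisions of level 0. The factor 16 is the slack for Markov's
  inequality.\<close>

definition good_hash :: "nat \<Rightarrow> nat \<Rightarrow> nat \<Rightarrow> (nat \<Rightarrow> nat \<Rightarrow> nat) \<Rightarrow> nat set \<Rightarrow> bool" where
  "good_hash m s T h S \<longleftrightarrow> s * card (collisions (h 0) S) \<le> 16 * m \<and>
     (\<forall>i\<in>S. \<exists>t\<in>{1..T}. i \<notin> collisions (h t) S)"

definition random_function :: "nat \<Rightarrow> nat \<Rightarrow> (nat \<Rightarrow> nat) pmf" where
  "random_function n U = Pi_pmf {1..n} 0 (\<lambda>_. pmf_of_set {..<U})"

lemma random_function_less:
  assumes "0 < U" "h \<in> set_pmf (random_function n U)"
  shows "h i < U"
proof -
  have "h \<in> PiE_dflt {1..n} 0 (set_pmf \<circ> (\<lambda>_. pmf_of_set {..<U}))"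
    using assms(2) by (simp add: random_function_def set_Pi_pmf)
  moreover have "set_pmf (pmf_of_set {..<U}) = {..<U}" using assms(1) by (intro set_pmf_of_set) auto
  ultimately show ?thesis using assms(1) by (cases "i \<in> {1..n}") (auto simp: PiE_dflt_def)
qed

lemma random_function_collide:
  assumes U: "0 < U" and ij: "i \<in> {1..n}" "j \<in> {1..n}" "i \<noteq> j"
  shows "measure_pmf.prob (random_function n U) {h. h j = h i} \<le> 1 / real U"
proof -
  let ?P = "random_function n U"
  let ?E = "\<lambda>c. Pi {1..n} (\<lambda>x. if x = i \<or> x = j then {c} else UNIV)"
  have set: "set_pmf (pmf_of_set {..<U}) = {..<U}" using U by (intro set_pmf_of_set) auto
  have one: "measure_pmf.prob (pmf_of_set {..<U}) {c} = 1 / real U" if "c < U" for c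
    using that by (subst measure_pmf_of_set) auto
  have E: "measure_pmf.prob ?P (?E c) = (1 / real U)\<^sup>2" if "c < U" for c
  proof -
    have "measure_pmf.prob ?P (?E c) =
        (\<Prod>x\<in>{1..n}. measure_pmf.prob (pmf_of_set {..<U}) (if x = i \<or> x = j then {c} else UNIV))"
      unfolding random_function_def by (rule measure_Pi_pmf_Pi) simp
    also have "\<dots> = (\<Prod>x\<in>{1..n}. if x \<in> {i, j} then 1 / real U else 1)"
      using one[OF that] by (intro prod.cong) auto
    also have "\<dots> = (\<Prod>x\<in>{1..n} \<inter> {i, j}. 1 / real U)" by (rule prod.inter_restrict[symmetric]) simp
    also have "{1..n} \<inter> {i, j} = {i, j}" using ij by auto
    finally show ?thesis using ij by (simp add: power2_eq_square)
  qed
  have "measure_pmf.prob ?P {h. h j = h i} \<le> measure_pmf.prob ?P (\<Union>c\<in>{..<U}. ?E c)"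
  proof (rule measure_pmf.finite_measure_mono_AE)
    show "AE h in measure_pmf ?P. h \<in> {h. h j = h i} \<longrightarrow> h \<in> (\<Union>c\<in>{..<U}. ?E c)"
      using random_function_less[OF U] by (auto simp: AE_measure_pmf_iff intro!: bexI[of _ "_ i"])
  qed simp
  also have "\<dots> \<le> (\<Sum>c<U. measure_pmf.prob ?P (?E c))"
    by (rule measure_pmf.finite_measure_subadditive_finite) auto
  also have "\<dots> = (\<Sum>c<U. (1 / real U)\<^sup>2)" using E by (intro sum.cong) auto
  also have "\<dots> = 1 / real U" using U by (simp add: power2_eq_square)
  finally show ?thesis .
qed

lemma random_function_collision:
  assumes U: "0 < U" "m * s \<le> U" and s: "1 \<le> s" and S: "S \<subseteq> {1..n}" "card S \<le> m" and i: "i \<in> S"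
  shows "measure_pmf.prob (random_function n U) {h. i \<in> collisions h S} \<le> 1 / real s"
proof -
  let ?P = "random_function n U"
  have fin: "finite S" using S finite_subset by blast
  have m: "0 < m" using i S fin by (metis card_gt_0_iff empty_iff less_le_trans)
  have "{h. i \<in> collisions h S} \<subseteq> (\<Union>j\<in>S - {i}. {h. h j = h i})" by (auto simp: collisions_def)
  then have "measure_pmf.prob ?P {h. i \<in> collisions h S} \<le> measure_pmf.prob ?P (\<Union>j\<in>S - {i}. {h. h j = h i})"
    by (rule measure_pmf.finite_measure_mono) simp
  also have "\<dots> \<le> (\<Sum>j\<in>S - {i}. measure_pmf.prob ?P {h. h j = h i})"
    using fin by (intro measure_pmf.finite_measure_subadditive_finite) auto
  also have "\<dots> \<le> (\<Sum>j\<in>S - {i}. 1 / real U)"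
    using S i by (intro sum_mono random_function_collide[OF U(1)]) auto
  also have "\<dots> \<le> real m * (1 / real U)"
    using S fin card_mono[of S "S - {i}"] by (simp add: divide_right_mono)
  also have "\<dots> \<le> 1 / real s"
  proof -
    have "real m * real s \<le> real U" using U by (metis of_nat_le_iff of_nat_mult)
    then show ?thesis using U s by (simp add: field_simps)
  qed
  finally show ?thesis .
qed

text \<open>The expected number of collisions on level 0 is at most \<open>m / s\<close>, so 16
  times as many occur with probability at most 1/16. An item collides on all of \<open>T\<close>
  independent levels with probability at most \<open>1 / s ^ T \<le> 1 / (16 * m)\<close>, which
  adds up to at most 1/16 over \<open>S\<close>.\<close>

lemma random_functions_good:
  assumes U: "0 < U" "m * s \<le> U" and s: "1 \<le> s" and m: "1 \<le> m" and T: "16 * m \<le> s ^ T"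
    and S: "S \<subseteq> {1..n}" "card S \<le> m"
  shows "measure_pmf.prob (Pi_pmf {0..T} (\<lambda>_. 0) (\<lambda>_. random_function n U)) {h. \<not> good_hash m s T h S} \<le> 1/8"
proof -
  let ?H = "random_function n U"
  define P where "P = Pi_pmf {0..T} (\<lambda>_. 0) (\<lambda>_. ?H)"
  have fin: "finite S" using S finite_subset by blast
  note coll = random_function_collision[OF U s S]
  define E1 where "E1 = {h :: nat \<Rightarrow> nat \<Rightarrow> nat. 16 * real m / real s \<le> real (card (collisions (h 0) S))}"
  define E2 where "E2 i = Pi {0..T} (\<lambda>t. if t = 0 then UNIV else {h. i \<in> collisions h S})" for i
  have "16 * real m / real s * measure_pmf.prob P E1 \<le> measure_pmf.expectation P (\<lambda>h. real (card (collisions (h 0) S)))"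
    unfolding E1_def
  proof (rule pmf_markov)
    have "card (collisions (h 0) S) \<le> card S" for h :: "nat \<Rightarrow> nat \<Rightarrow> nat"
      using fin by (intro card_mono) (auto simp: collisions_def)
    then show "integrable (measure_pmf P) (\<lambda>h. real (card (collisions (h 0) S)))"
      by (intro measure_pmf.integrable_const_bound[where B = "real (card S)"]) auto
  qed simp
  also have "\<dots> = measure_pmf.expectation (map_pmf (\<lambda>f. f 0) P) (\<lambda>h. real (card (collisions h S)))"
    by simp
  also have "map_pmf (\<lambda>f. f 0) P = ?H" by (simp add: P_def Pi_pmf_component)
  also have "measure_pmf.expectation ?H (\<lambda>h. real (card (collisions h S))) =
      measure_pmf.expectation ?H (\<lambda>h. \<Sum>i\<in>S. indicator {h. i \<in> collisions h S} h)"
  proof -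
    have "real (card (collisions h S)) = (\<Sum>i\<in>S. indicator {h. i \<in> collisions h S} h)" for h
    proof -
      have "S \<inter> {i. i \<in> collisions h S} = collisions h S" by (auto simp: collisions_def)
      then show ?thesis using fin by (simp add: indicator_def sum.If_cases)
    qed
    then show ?thesis by simp
  qed
  also have "\<dots> = (\<Sum>i\<in>S. measure_pmf.prob ?H {h. i \<in> collisions h S})"
    by (subst Bochner_Integration.integral_sum)
      (auto intro!: measure_pmf.integrable_const_bound[where B = 1])
  also have "\<dots> \<le> (\<Sum>i\<in>S. 1 / real s)" by (rule sum_mono) (rule coll)
  also have "\<dots> \<le> real m / real s" using S by (simp add: divide_right_mono)
  finally have p1: "measure_pmf.prob P E1 \<le> 1/16" using s m by (simp add: field_simps)
  have p2: "measure_pmf.prob P (E2 i) \<le> (1 / real s) ^ T" if "i \<in> S" for i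
  proof -
    have "measure_pmf.prob P (E2 i) = (\<Prod>t\<in>{0..T}. measure_pmf.prob ?H (if t = 0 then UNIV else {h. i \<in> collisions h S}))"
      unfolding P_def E2_def by (rule measure_Pi_pmf_Pi) simp
    also have "{0..T} = insert 0 {1..T}" by auto
    also have "(\<Prod>t\<in>insert 0 {1..T}. measure_pmf.prob ?H (if t = 0 then UNIV else {h. i \<in> collisions h S}))
        = (\<Prod>t\<in>{1..T}. measure_pmf.prob ?H {h. i \<in> collisions h S})" by simp
    also have "\<dots> \<le> (\<Prod>t\<in>{1..T}. 1 / real s)" by (rule prod_mono) (use coll[OF that] in auto)
    finally show ?thesis by simp
  qed
  have "{h. \<not> good_hash m s T h S} \<subseteq> E1 \<union> (\<Union>i\<in>S. E2 i)"
  proof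
    fix h assume h: "h \<in> {h. \<not> good_hash m s T h S}"
    show "h \<in> E1 \<union> (\<Union>i\<in>S. E2 i)"
    proof (cases "s * card (collisions (h 0) S) \<le> 16 * m")
      case True
      then obtain i where "i \<in> S" "\<forall>t\<in>{1..T}. i \<in> collisions (h t) S" using h by (auto simp: good_hash_def)
      then have "h \<in> E2 i" by (auto simp: E2_def Pi_def)
      then show ?thesis using \<open>i \<in> S\<close> by blast
    next
      case False
      then have "real (16 * m) \<le> real (s * card (collisions (h 0) S))" by linarith
      then show ?thesis using s by (simp add: E1_def field_simps)
    qed
  qed
  then have "measure_pmf.prob P {h. \<not> good_hash m s T h S} \<le> measure_pmf.prob P (E1 \<union> (\<Union>i\<in>S. E2 i))"
    by (rule measure_pmf.finite_measure_mono) simp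
  also have "\<dots> \<le> measure_pmf.prob P E1 + measure_pmf.prob P (\<Union>i\<in>S. E2 i)" by (rule measure_Un_le) auto
  also have "measure_pmf.prob P (\<Union>i\<in>S. E2 i) \<le> (\<Sum>i\<in>S. measure_pmf.prob P (E2 i))"
    using fin by (intro measure_pmf.finite_measure_subadditive_finite) auto
  also have "\<dots> \<le> (\<Sum>i\<in>S. (1 / real s) ^ T)" by (rule sum_mono) (rule p2)
  also have "\<dots> \<le> real m * (1 / real s) ^ T" using S by (simp add: mult_right_mono)
  also have "\<dots> \<le> 1/16"
  proof -
    have "real (16 * m) \<le> real (s ^ T)" using T by (simp only: of_nat_le_iff)
    then show ?thesis using s by (simp add: power_divide field_simps)
  qed
  finally show ?thesis using p1 by (simp add: P_def)
qed

text \<open>Probabilistic method: \<open>48 * n\<close> independent keys, each bad for a given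
  support with probability at most 1/8, and a union bound over at most \<open>2 ^ n\<close>
  supports. One third of bad keys is exactly what the completeness error admits, and with so few
  members a key costs only O(log n) bits.\<close>

lemma exists_hash_family:
  assumes U: "0 < U" "m * s \<le> U" and s: "1 \<le> s" and m: "1 \<le> m" and T: "16 * m \<le> s ^ T" and n: "1 \<le> n"
  shows "\<exists>hf. (\<forall>key t i. hf key t i < U) \<and> (\<forall>S\<subseteq>{1..n}. card S \<le> m \<longrightarrow>
    card {key. key < 48 * n \<and> \<not> good_hash m s T (hf key) S} \<le> 16 * n)"
proof -
  define H where "H = Pi_pmf {0..T} (\<lambda>_. 0) (\<lambda>_. random_function n U)"
  define P where "P = Pi_pmf {..<48*n} (\<lambda>_ _. 0) (\<lambda>_. H)"
  define E where "E S = {\<omega>. 16 * n \<le> card {key. key < 48 * n \<and> \<omega> key \<in> {h. \<not> good_hash m s T h S}}}" for S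
  define \<S> where "\<S> = {S. S \<subseteq> {1..n} \<and> card S \<le> m}"
  have fin\<S>: "finite \<S>" by (simp add: \<S>_def)
  have card\<S>: "card \<S> \<le> 2 ^ n"
    using card_mono[of "Pow {1..n}" \<S>] by (auto simp: \<S>_def card_Pow)
  have pE: "measure_pmf.prob P (E S) \<le> (1/8) ^ n" if "S \<in> \<S>" for S
  proof -
    \<comment> \<open>Base 8 gives \<open>((15/8) ^ 48 / 8 ^ 16) ^ n\<close>, which is below
      \<open>(1/8) ^ n\<close> and so beats the \<open>2 ^ n\<close> sets.\<close>
    have "measure_pmf.prob P (E S) \<le> (1 + (8 - 1) * (1/8)) ^ (48 * n) / 8 ^ (16 * n)"
      unfolding P_def E_def
      by (rule Pi_pmf_count_tail) (use random_functions_good[OF U s m T] that in \<open>auto simp: H_def \<S>_def\<close>)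
    also have "(1 + (8 - 1) * (1/8)) = (15/8 :: real)" by simp
    also have "(15/8) ^ (48 * n) / 8 ^ (16 * n) = ((15/8 :: real) ^ 48 / 8 ^ 16) ^ n"
      by (simp only: power_mult power_divide[symmetric])
    also have "\<dots> \<le> (1/8) ^ n" by (intro power_mono) (simp_all add: power_divide)
    finally show ?thesis .
  qed
  have "measure_pmf.prob P (\<Union>S\<in>\<S>. E S) \<le> (\<Sum>S\<in>\<S>. measure_pmf.prob P (E S))"
    using fin\<S> by (intro measure_pmf.finite_measure_subadditive_finite) auto
  also have "\<dots> \<le> (\<Sum>S\<in>\<S>. (1/8) ^ n)" by (rule sum_mono) (rule pE)
  also have "\<dots> \<le> 2 ^ n * (1/8) ^ n"
  proof -
    have "real (card \<S>) \<le> 2 ^ n" using card\<S> by (metis of_nat_le_iff of_nat_numeral of_nat_power)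
    then show ?thesis by (simp add: mult_right_mono)
  qed
  also have "\<dots> = (1/4) ^ n" by (simp add: power_mult_distrib[symmetric])
  also have "\<dots> < 1" using n by (intro power_less_one_iff[THEN iffD2]) auto
  finally have lt: "measure_pmf.prob P (\<Union>S\<in>\<S>. E S) < 1" .
  have "\<exists>\<omega>\<in>set_pmf P. \<omega> \<notin> (\<Union>S\<in>\<S>. E S)"
  proof (rule ccontr)
    assume "\<not> ?thesis"
    then have "AE \<omega> in measure_pmf P. \<omega> \<in> (\<Union>S\<in>\<S>. E S)" by (auto simp: AE_measure_pmf_iff)
    then have "measure_pmf.prob P (\<Union>S\<in>\<S>. E S) = 1" by (subst measure_pmf.prob_eq_1) auto
    with lt show False by simp
  qed
  then obtain \<omega> where \<omega>: "\<omega> \<in> set_pmf P" "\<And>S. S \<in> \<S> \<Longrightarrow> \<omega> \<notin> E S" by blast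
  show ?thesis
  proof (intro exI conjI allI impI)
    show "\<omega> key t i < U" for key t i
    proof (cases "key < 48 * n")
      case True
      then have "\<omega> key \<in> set_pmf H"
        using \<omega>(1) by (auto simp: P_def set_Pi_pmf PiE_dflt_def)
      then have mem: "\<omega> key \<in> PiE_dflt {0..T} (\<lambda>_. 0) (\<lambda>_. set_pmf (random_function n U))"
        by (simp add: H_def set_Pi_pmf o_def)
      show ?thesis
      proof (cases "t \<in> {0..T}")
        case True
        then have "\<omega> key t \<in> set_pmf (random_function n U)" using mem by (auto simp: PiE_dflt_def)
        then show ?thesis by (rule random_function_less[OF U(1)])
      next
        case False
        then have "\<omega> key t = (\<lambda>_. 0)" using mem by (auto simp: PiE_dflt_def)
        then show ?thesis using U by simp
      qed
    next
      case False
      then have "\<omega> key = (\<lambda>_ _. 0)" using \<omega>(1) by (auto simp: P_def set_Pi_pmf PiE_dflt_def)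
      then show ?thesis using U by simp
    qed
    fix S assume "S \<subseteq> {1..n}" "card S \<le> m"
    then show "card {key. key < 48 * n \<and> \<not> good_hash m s T (\<omega> key) S} \<le> 16 * n"
      using \<omega>(2)[of S] by (simp add: \<S>_def E_def)
  qed
qed

section \<open>The memory of the verifier\<close>

text \<open>The grid has \<open>a\<close> columns and \<open>b\<close> rows, and
  \<open>lag x\<close> is the Lagrange basis polynomial of column \<open>x\<close>. The bounds in
  \<open>p_large\<close> serve, in order: mode flags up to 3 as residues; soundness error
  \<open>d / p < 1/3\<close>; the listed moment without wrap-around; a key as one block; a list
  entry as one block; \<open>V\<close> without wrap-around.\<close>

locale moment_protocol =
  fixes n k B T a b E p :: nat and hf :: "nat \<Rightarrow> nat \<Rightarrow> nat \<Rightarrow> nat" and lag :: "nat \<Rightarrow> int poly"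
  assumes n: "1 \<le> n" and k: "1 \<le> k" and B: "1 \<le> B" and a: "1 \<le> a" and b: "1 \<le> b" and E: "1 \<le> E"
    and hf: "\<And>key t i. hf key t i < a * b"
    and p: "prime p" "p \<le> 2 ^ E"
    and lag: "\<And>x. x < a \<Longrightarrow> degree (lag x) < a"
      "\<And>x y. x < a \<Longrightarrow> y < a \<Longrightarrow> [poly (lag x) (int y) = of_bool (x = y)] (mod int p)"
    and p_large: "3 < p" "3 * ((k + 2) * a) < p" "n * B ^ k < p" "48 * n < p"
      "(n + 1) * (B + 1) * (T + 1) \<le> p"
      "moment_bound n k B (a * b) * gap_bound n B (a * b) * (1 + 4 * (a * b) * T * val_bound n B ^ 3) \<le> p"
begin

definition d :: nat where "d = (k + 2) * a"

definition U :: nat where "U = a * b"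

abbreviation \<Omega> :: nat where "\<Omega> \<equiv> moment_bound n k B U"

abbreviation \<Lambda> :: nat where "\<Lambda> \<equiv> gap_bound n B U"

text \<open>A list entry is one number in mixed radix: level, frequency and item from the least
  significant digit on. The radices bound level and frequency by \<open>T\<close> and
  \<open>B\<close> without any check.\<close>

definition entry_level :: "nat \<Rightarrow> nat" where "entry_level v = v mod (T + 1)"

definition entry_freq :: "nat \<Rightarrow> nat" where "entry_freq v = v div (T + 1) mod (B + 1)"

definition entry_item :: "nat \<Rightarrow> nat" where "entry_item v = v div (T + 1) div (B + 1)"

definition cell :: "nat \<Rightarrow> int \<Rightarrow> nat \<Rightarrow> nat \<Rightarrow> nat \<Rightarrow> int" where
  "cell key r t y i = (if hf key t i mod b = y then poly (lag (hf key t i div b)) r else 0)"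

text \<open>Bucket \<open>j\<close> stands in column \<open>j div b\<close> and row \<open>j mod b\<close> of a grid.  Register \<open>(t, c, y)\<close> holds the value,
  at the secret point, of the low degree extension of row \<open>y\<close> for the \<open>c\<close>-th moments of the buckets
  of level \<open>t\<close>; for \<open>c = 3\<close> the moments are replaced by the numbers of listed items.\<close>

definition update_part :: "nat \<Rightarrow> int \<Rightarrow> nat \<times> nat \<times> nat \<Rightarrow> update \<Rightarrow> int" where
  "update_part key r = (\<lambda>(t, c, y) (i, \<delta>). if c < 3 then \<delta> * (int i ^ c * cell key r t y i) else 0)"

definition entry_part :: "nat \<Rightarrow> int \<Rightarrow> nat \<times> nat \<times> nat \<Rightarrow> nat \<Rightarrow> int" where
  "entry_part key r = (\<lambda>(t, c, y) v. cell key r t y (entry_item v) *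
     (if c < 3 then if t = 0 \<or> entry_level v = t then - int (entry_freq v) * int (entry_item v) ^ c else 0
      else of_bool (t \<noteq> 0 \<and> entry_level v = t)))"

definition sketch :: "nat \<Rightarrow> int \<Rightarrow> stream \<Rightarrow> nat list \<Rightarrow> nat \<times> nat \<times> nat \<Rightarrow> int" where
  "sketch key r us es x = (\<Sum>u\<leftarrow>us. update_part key r x u) + (\<Sum>v\<leftarrow>es. entry_part key r x v)"

text \<open>Order of the blocks: the key, then \<open>d\<close> coefficients with the constant term
  first, then list entries.\<close>

definition coefs :: "nat list \<Rightarrow> int poly" where
  "coefs cs = Poly (map int (take d (drop 1 cs)))"

definition entries :: "nat list \<Rightarrow> nat list" where
  "entries cs = drop (Suc d) cs"

text \<open>Strictly increasing items rule out double listing, and the verifier can check this by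
  remembering the last item alone.\<close>

definition entries_ok :: "nat list \<Rightarrow> bool" where
  "entries_ok es \<longleftrightarrow> sorted_wrt (\<lambda>v w. entry_item v < entry_item w) es \<and>
     (\<forall>v\<in>set es. entry_item v \<in> {1..n} \<and> 1 \<le> entry_level v)"

definition wf :: "stream \<Rightarrow> nat list \<Rightarrow> bool" where
  "wf us cs \<longleftrightarrow> (\<forall>u\<in>set us. fst u \<in> {1..n}) \<and> (\<forall>v\<in>set cs. v < p) \<and> (if cs = [] then length us \<le> 1 else us \<noteq> []) \<and>
     entries_ok (entries cs)"

definition registers :: "(nat \<times> nat \<times> nat) set" where
  "registers = {..T} \<times> {..<4} \<times> {..<b}"

type_synonym memory = "int list \<times> (nat \<times> nat \<times> nat \<Rightarrow> int)"

definition store :: "(nat \<times> nat \<times> nat \<Rightarrow> int) \<Rightarrow> nat \<times> nat \<times> nat \<Rightarrow> int" where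
  "store K = restrict (\<lambda>x. K x mod int p) registers"

definition rejecting :: memory where
  "rejecting = ([0, 0, 0, 0, 0, 0, 0, 0], store (\<lambda>_. 0))"

definition starting :: "int \<Rightarrow> memory" where
  "starting r = ([1, r, 0, 0, 0, 0, 0, 0], store (\<lambda>_. 0))"

definition waiting :: "int \<Rightarrow> update \<Rightarrow> memory" where
  "waiting r u = ([2, r, int (fst u), snd u mod int p, 0, 0, 0, 0], store (\<lambda>_. 0))"

definition last_item :: "nat list \<Rightarrow> nat" where
  "last_item es = (if es = [] then 0 else entry_item (last es))"

text \<open>Eight words: mode, secret point, key, number of blocks capped at \<open>Suc d\<close>,
  last listed item, claimed polynomial at the secret point, its sum over the columns, listed moment.
  In \<open>waiting\<close> the third and fourth words hold the first update instead, which cannot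
  be hashed before the key is known.\<close>

definition running :: "int \<Rightarrow> stream \<Rightarrow> nat list \<Rightarrow> memory" where
  "running r us cs = ([3, r, int (hd cs), int (min (length cs) (Suc d)), int (last_item (entries cs)),
     poly (coefs cs) r mod int p, (\<Sum>x<a. poly (coefs cs) (int x)) mod int p,
     (\<Sum>v\<leftarrow>entries cs. int (entry_freq v) ^ k) mod int p], store (sketch (hd cs) r us (entries cs)))"

definition summary :: "int \<Rightarrow> parser_state \<Rightarrow> memory" where
  "summary r = (\<lambda>(us, cs, ok). if \<not> (ok \<and> wf us cs) then rejecting
     else if cs = [] then (if us = [] then starting r else waiting r (hd us)) else running r us cs)"

definition verdict :: "memory \<Rightarrow> int option" where
  "verdict = (\<lambda>(xs, K). if xs ! 0 = 1 then Some 0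
     else if xs ! 0 = 3 \<and> xs ! 3 = int (Suc d) \<and>
       xs ! 5 = (\<Sum>y<b. sumcheck_term k \<Omega> \<Lambda> T (\<lambda>t c. K (t, c, y))) mod int p \<and> xs ! 6 < int \<Omega>
     then Some (xs ! 6 + xs ! 7) else None)"

lemma d_pos: "1 \<le> d"
  using a by (simp add: d_def)

lemma p_pos: "0 < int p"
  using p_large(1) by simp

lemma entries_snoc: "entries (cs @ [v]) = (if length cs \<le> d then [] else entries cs @ [v])"
  by (auto simp: entries_def)

lemma coefs_snoc:
  "cs \<noteq> [] \<Longrightarrow> coefs (cs @ [v]) =
     (if length cs \<le> d then coefs cs + monom (int v) (length cs - 1) else coefs cs)"
proof -
  assume "cs \<noteq> []"
  then have drop: "drop 1 (cs @ [v]) = drop 1 cs @ [v]" and len: "length (drop 1 cs) = length cs - 1" "1 \<le> length cs"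
    by (cases cs; simp)+
  have monom: "monom 1 l * Poly [int v] = monom (int v) l" for l
    by (simp add: smult_monom mult.commute[of "monom 1 l"])
  show ?thesis
  proof (cases "length cs \<le> d")
    case True
    then have "take d (drop 1 (cs @ [v])) = take d (drop 1 cs) @ [v]" "length (take d (drop 1 cs)) = length cs - 1"
      unfolding drop using len by simp_all
    then show ?thesis using True unfolding coefs_def by (simp only: map_append Poly_append list.map monom length_map if_True)
  next
    case False
    then have "take d (drop 1 (cs @ [v])) = take d (drop 1 cs)" unfolding drop using len by simp
    then show ?thesis using False by (simp only: coefs_def if_False)
  qed
qed

lemma entries_ok_snoc:
  "entries_ok (es @ [v]) \<longleftrightarrow>
     entries_ok es \<and> entry_item v \<in> {1..n} \<and> 1 \<le> entry_level v \<and> last_item es < entry_item v"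
proof (cases es rule: rev_cases)
  case Nil
  then show ?thesis by (auto simp: entries_ok_def last_item_def)
next
  case (snoc es' w)
  have "sorted_wrt (\<lambda>v w. entry_item v < entry_item w) (es @ [v]) \<longleftrightarrow>
      sorted_wrt (\<lambda>v w. entry_item v < entry_item w) es \<and> entry_item w < entry_item v"
    by (auto simp: snoc sorted_wrt_append)
  then show ?thesis by (auto simp: entries_ok_def last_item_def snoc)
qed

lemma store_add: "store (\<lambda>x. store K x + L x) = store (\<lambda>x. K x + L x)"
  by (auto simp: store_def restrict_def mod_simps)

text \<open>A transition on the memory alone, as is \<open>next_block\<close>. That
  \<open>summary\<close> commutes with both makes it right-congruent, the secret point being part of
  the memory.\<close>

definition next_update :: "update \<Rightarrow> memory \<Rightarrow> memory" where
  "next_update u = (\<lambda>(xs, K).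
     if fst u \<notin> {1..n} then rejecting
     else if xs ! 0 = 1 then waiting (xs ! 1) u
     else if xs ! 0 = 3 \<and> xs ! 3 = 1 then (xs, store (\<lambda>x. K x + update_part (nat (xs ! 2)) (xs ! 1) x u))
     else rejecting)"

definition next_block :: "nat \<Rightarrow> memory \<Rightarrow> memory" where
  "next_block v = (\<lambda>(xs, K).
     if p \<le> v then rejecting
     else if xs ! 0 = 2 then
       ([3, xs ! 1, int v, 1, 0, 0, 0, 0], store (\<lambda>x. update_part v (xs ! 1) x (nat (xs ! 2), xs ! 3)))
     else if xs ! 0 = 3 \<and> xs ! 3 \<le> int d then
       ([3, xs ! 1, xs ! 2, xs ! 3 + 1, 0, (xs ! 5 + int v * (xs ! 1) ^ (nat (xs ! 3) - 1)) mod int p,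
         (xs ! 6 + (\<Sum>x<a. int v * int x ^ (nat (xs ! 3) - 1))) mod int p, 0], K)
     else if xs ! 0 = 3 \<and> entry_item v \<in> {1..n} \<and> 1 \<le> entry_level v \<and> xs ! 4 < int (entry_item v) then
       ([3, xs ! 1, xs ! 2, xs ! 3, int (entry_item v), xs ! 5, xs ! 6, (xs ! 7 + int (entry_freq v) ^ k) mod int p],
         store (\<lambda>x. K x + entry_part (nat (xs ! 2)) (xs ! 1) x v))
     else rejecting)"

lemma summary_update: "summary r (read_update u s) = next_update u (summary r s)"
proof -
  obtain us cs ok where s: "s = (us, cs, ok)" by (metis prod_cases3)
  let ?ok' = "ok \<and> (us = [] \<and> cs = [] \<or> us \<noteq> [] \<and> length cs = 1)"
  have s': "read_update u s = (us @ [u], cs, ?ok')" by (simp add: s read_update_def)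
  have S: "summary r s = (if \<not> (ok \<and> wf us cs) then rejecting
     else if cs = [] then (if us = [] then starting r else waiting r (hd us)) else running r us cs)"
    by (simp add: s summary_def)
  have S': "summary r (read_update u s) = (if \<not> (?ok' \<and> wf (us @ [u]) cs) then rejecting
     else if cs = [] then waiting r (hd (us @ [u])) else running r (us @ [u]) cs)"
    by (simp add: s' summary_def)
  show ?thesis
  proof (cases "fst u \<in> {1..n} \<and> ok \<and> wf us cs")
    case False
    then have "\<not> (?ok' \<and> wf (us @ [u]) cs)" by (auto simp: wf_def)
    then have "summary r (read_update u s) = rejecting" unfolding S' by (rule if_P)
    moreover have "next_update u (summary r s) = rejecting"
      using False by (auto simp: S next_update_def rejecting_def)
    ultimately show ?thesis by simp
  next
    case True
    show ?thesis
    proof (cases "cs = []")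
      case cs: True
      then show ?thesis
        using True by (cases "us = []")
          (auto simp: S S' next_update_def starting_def waiting_def wf_def)
    next
      case cs: False
      have prev: "summary r s = running r us cs" using True cs by (simp add: S)
      \<comment> \<open>The cap \<open>Suc d\<close> is at least 2, so the capped count still tells
        whether exactly one block has been read.\<close>
      have one: "min (length cs) (Suc d) = 1 \<longleftrightarrow> length cs = 1" using d_pos by auto
      show ?thesis
      proof (cases "length cs = 1")
        case l1: True
        have wf': "wf (us @ [u]) cs" using True cs by (auto simp: wf_def)
        have "sketch (hd cs) r (us @ [u]) (entries cs) = (\<lambda>x. sketch (hd cs) r us (entries cs) x + update_part (hd cs) r x u)"
          by (auto simp: sketch_def)
        then have "running r (us @ [u]) cs = next_update u (running r us cs)"
          using True l1 d_pos by (simp add: running_def next_update_def store_add)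
        moreover have "us \<noteq> []" using True cs by (simp add: wf_def)
        ultimately show ?thesis using True cs l1 wf' by (simp add: prev S')
      next
        case l1: False
        then have "next_update u (running r us cs) = rejecting"
          using one d_pos by (auto simp: running_def next_update_def)
        moreover have "summary r (read_update u s) = rejecting" using l1 cs by (simp add: S')
        ultimately show ?thesis by (simp add: prev)
      qed
    qed
  qed
qed

lemma update_part_mod: "update_part key r x (i, \<delta> mod int p) mod int p = update_part key r x (i, \<delta>) mod int p"
  by (cases x) (simp add: update_part_def mod_simps)

lemma summary_block: "summary r (read_block v s) = next_block v (summary r s)"
proof -
  obtain us cs ok where s: "s = (us, cs, ok)" by (metis prod_cases3)
  let ?ok' = "ok \<and> us \<noteq> [] \<and> (cs = [] \<longrightarrow> length us = 1)"
  have s': "read_block v s = (us, cs @ [v], ?ok')" by (simp add: s read_block_def)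
  have S: "summary r s = (if \<not> (ok \<and> wf us cs) then rejecting
     else if cs = [] then (if us = [] then starting r else waiting r (hd us)) else running r us cs)"
    by (simp add: s summary_def)
  have S': "summary r (read_block v s) = (if \<not> (?ok' \<and> wf us (cs @ [v])) then rejecting
     else running r us (cs @ [v]))"
    by (simp only: s' summary_def prod.case append_is_Nil_conv list.distinct simp_thms if_False)
  \<comment> \<open>Well-formedness is inherited by prefixes of the blocks, so a rejecting state is
    never left.\<close>
  have mono: "wf us cs \<and> v < p" if "wf us (cs @ [v])" "?ok'"
    using that by (auto simp: wf_def entries_snoc entries_ok_snoc split: if_splits)
      (simp_all add: entries_def entries_ok_def)
  show ?thesis
  proof (cases "ok \<and> wf us cs \<and> v < p")
    case False
    then have "\<not> (?ok' \<and> wf us (cs @ [v]))" using mono by blast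
    then have "summary r (read_block v s) = rejecting" unfolding S' by (rule if_P)
    moreover have "next_block v (summary r s) = rejecting"
      using False by (auto simp: S next_block_def rejecting_def)
    ultimately show ?thesis by simp
  next
    case True
    show ?thesis
    proof (cases "cs = []")
      case cs: True
      show ?thesis
      proof (cases us)
        case Nil
        then show ?thesis using True cs
          by (simp add: S S' next_block_def starting_def)
      next
        case (Cons u us')
        then have us: "us = [u]" using True cs by (simp add: wf_def)
        have e: "entries [v] = []" using d_pos by (simp add: entries_def)
        have wf': "wf us [v]" using True cs us e by (auto simp: wf_def entries_ok_def)
        have c: "coefs [v] = 0" by (simp add: coefs_def)
        have "store (sketch v r us []) = store (\<lambda>x. update_part v r x (fst u, snd u mod int p))"
          by (simp add: us sketch_def store_def update_part_mod cong: restrict_cong)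
        then have "running r us [v] = next_block v (waiting r u)"
          using True d_pos by (simp add: running_def next_block_def waiting_def e c last_item_def)
        then show ?thesis using True cs us wf' by (simp add: S S')
      qed
    next
      case cs: False
      then have len: "1 \<le> length cs" by (cases cs) auto
      have prev: "summary r s = running r us cs" using True cs by (simp add: S)
      have hd: "hd (cs @ [v]) = hd cs" using cs by simp
      show ?thesis
      proof (cases "us = []")
        case us: True
        then show ?thesis using True cs by (simp add: wf_def)
      next
        case us: False
        show ?thesis
        proof (cases "length cs \<le> d")
          case short: True
          have e: "entries cs = []" using short by (simp add: entries_def)
          have wf': "wf us (cs @ [v])" using True cs us short by (auto simp: wf_def entries_snoc entries_ok_def)
          have "running r us (cs @ [v]) = next_block v (running r us cs)"
            using True short cs len
            by (simp add: running_def next_block_def e entries_snoc coefs_snoc last_item_def poly_monom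
                sum.distrib mod_simps)
          then show ?thesis using True cs us wf' by (simp add: prev S')
        next
          case long: False
          then have cnt: "min (length cs) (Suc d) = Suc d" by simp
          show ?thesis
          proof (cases "entry_item v \<in> {1..n} \<and> 1 \<le> entry_level v \<and> last_item (entries cs) < entry_item v")
            case ok: True
            have wf': "wf us (cs @ [v])" using True cs us long ok
              by (auto simp: wf_def entries_snoc entries_ok_snoc)
            have "sketch (hd cs) r us (entries cs @ [v]) = (\<lambda>x. sketch (hd cs) r us (entries cs) x + entry_part (hd cs) r x v)"
              by (auto simp: sketch_def)
            then have "running r us (cs @ [v]) = next_block v (running r us cs)"
              using True long cs ok cnt
              by (simp add: running_def next_block_def entries_snoc coefs_snoc store_add mod_simps)
                (simp add: last_item_def)
            then show ?thesis using True cs us wf' by (simp add: prev S')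
          next
            case bad: False
            then have "\<not> wf us (cs @ [v])" using long by (auto simp: wf_def entries_snoc entries_ok_snoc)
            moreover have "next_block v (running r us cs) = rejecting"
              using bad cnt by (auto simp: running_def next_block_def)
            ultimately show ?thesis by (simp add: prev S')
          qed
        qed
      qed
    qed
  qed
qed

end

section \<open>Soundness\<close>

lemma sumcheck_term_cong:
  fixes w w' :: "nat \<Rightarrow> nat \<Rightarrow> int"
  assumes "\<And>t c. t \<le> T \<Longrightarrow> c < 4 \<Longrightarrow> [w t c = w' t c] (mod q)"
  shows "[sumcheck_term k \<Omega> \<Lambda> T w = sumcheck_term k \<Omega> \<Lambda> T w'] (mod q)"
  unfolding sumcheck_term_def
  by (intro cong_add cong_mult cong_diff cong_pow cong_sum cong_refl assms) auto

lemma poly_sumcheck_term: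
  "poly (sumcheck_term k \<Omega> \<Lambda> T w) x = sumcheck_term k \<Omega> \<Lambda> T (\<lambda>t c. poly (w t c) x)"
  by (simp add: sumcheck_term_def poly_sum)

text \<open>The summands have degree \<open>k\<close>, 2 and at most 3 in the values, and
  \<open>k + 2\<close> dominates all of these since \<open>k \<ge> 1\<close>.\<close>

lemma degree_sumcheck_term_le:
  fixes w :: "nat \<Rightarrow> nat \<Rightarrow> int poly"
  assumes w: "\<And>t c. degree (w t c) \<le> e" and k: "1 \<le> k"
  shows "degree (sumcheck_term k \<Omega> \<Lambda> T w) \<le> (k + 2) * e"
proof -
  have sq: "degree ((w t c)\<^sup>2) \<le> 2 * e" for t c
    using order_trans[OF degree_power_le[of "w t c" 2]] w[of t c] by (simp add: mult.commute)
  have le: "2 * e \<le> (k + 2) * e" "3 * e \<le> (k + 2) * e" "e * k \<le> (k + 2) * e"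
    using k by (auto simp: algebra_simps intro: mult_le_mono1)
  have m: "degree (x * y) \<le> i + j" if "degree x \<le> i" "degree y \<le> j" for x y :: "int poly" and i j
    using degree_mult_le[of x y] that by linarith
  have c: "degree (of_nat l * x) \<le> j" if "degree x \<le> j" for l and x :: "int poly" and j
    using m[of "of_nat l" 0 x j] that by simp
  have 1: "degree (w 0 0 ^ k) \<le> (k + 2) * e"
    using order_trans[OF degree_power_le[of "w 0 0" k]] w[of 0 0] le(3) by (meson mult_le_mono1 order_trans)
  have 2: "degree (of_nat \<Omega> * (w 0 0 * w 0 2 - (w 0 1)\<^sup>2)) \<le> (k + 2) * e"
    using m[OF w w, of 0 0 0 2] sq[of 0 1] le(1)
    by (intro c degree_diff_le) (auto simp: mult_2)
  have 3: "degree (of_nat (\<Omega> * \<Lambda>) * (\<Sum>t\<in>{1..T}. w t 3 * ((w t 0)\<^sup>2 + (w t 1)\<^sup>2 + (w t 2)\<^sup>2) +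
      w t 3 * (w t 3 - 1))) \<le> (k + 2) * e"
  proof (intro c degree_sum_le degree_add_le)
    fix t
    have "degree (w t 3 * ((w t 0)\<^sup>2 + (w t 1)\<^sup>2 + (w t 2)\<^sup>2)) \<le> e + 2 * e"
      by (intro m w degree_add_le sq)
    then show "degree (w t 3 * ((w t 0)\<^sup>2 + (w t 1)\<^sup>2 + (w t 2)\<^sup>2)) \<le> (k + 2) * e" using le(2) by linarith
    have "degree (w t 3 * (w t 3 - 1)) \<le> e + e"
      by (intro m w degree_diff_le) simp
    then show "degree (w t 3 * (w t 3 - 1)) \<le> (k + 2) * e" using le(1) by linarith
  qed simp
  show ?thesis unfolding sumcheck_term_def by (intro degree_add_le 1 2 3)
qed

lemma interleave_silent:
  "length A = length x \<Longrightarrow> \<forall>s\<in>set A. s = [] \<Longrightarrow> interleave x A = map Update x"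
proof (induction x arbitrary: A)
  case (Cons u x)
  then show ?case by (cases A) (auto simp: interleave_def)
qed (simp add: interleave_def)

lemma interleave_first_last:
  assumes "x = u # us"
  shows "interleave x (map (\<lambda>j. (if j = 1 then \<alpha> else []) @ (if j = length x then \<beta> else [])) [1..<Suc (length x)])
    = Update u # map Bit \<alpha> @ map Update us @ map Bit \<beta>"
proof (cases us rule: rev_cases)
  case Nil
  then show ?thesis using assms by (simp add: interleave_def)
next
  case (snoc us' z)
  let ?ann = "\<lambda>j. (if j = 1 then \<alpha> else []) @ (if j = length x then \<beta> else [])"
  define l where "l = length us'"
  have lx: "length x = Suc (Suc l)" using assms snoc by (simp add: l_def)
  have "[1..<Suc (Suc l)] = 1 # [2..<Suc (Suc l)]"
    by (simp add: upt_conv_Cons numeral_2_eq_2 del: upt_Suc)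
  then have "[1..<Suc (length x)] = [1] @ [2..<Suc (Suc l)] @ [Suc (Suc l)]"
    using upt_Suc_append[of 1 "Suc (Suc l)"] unfolding lx by (simp del: upt_Suc)
  moreover have "map ?ann [2..<Suc (Suc l)] = map (\<lambda>_. []) [2..<Suc (Suc l)]"
    unfolding lx by (intro map_cong) auto
  ultimately have A: "map ?ann [1..<Suc (length x)] = [\<alpha>] @ map (\<lambda>_. []) [2..<Suc (Suc l)] @ [\<beta>]"
    unfolding lx by (simp del: upt_Suc)
  have x: "x = [u] @ us' @ [z]" using assms snoc by simp
  have mid: "interleave us' (map (\<lambda>_. []) [2..<Suc (Suc l)]) = map Update us'"
    by (rule interleave_silent) (auto simp: l_def simp del: upt_Suc)
  have "interleave x (map ?ann [1..<Suc (length x)]) =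
      interleave ([u] @ us' @ [z]) ([\<alpha>] @ map (\<lambda>_. []) [2..<Suc (Suc l)] @ [\<beta>])"
    by (simp only: A x[symmetric])
  also have "\<dots> = interleave [u] [\<alpha>] @ interleave us' (map (\<lambda>_. []) [2..<Suc (Suc l)]) @ interleave [z] [\<beta>]"
    by (subst interleave_append, simp, subst interleave_append) (simp_all add: l_def del: upt_Suc)
  finally show ?thesis unfolding mid snoc by (simp add: interleave_def)
qed

context moment_protocol
begin

lemma Suc_d_less: "Suc d < p"
  using p_large(1,2) unfolding d_def by linarith

lemma \<Omega>_le_p: "\<Omega> \<le> p"
proof -
  have "\<Omega> * 1 \<le> \<Omega> * \<Lambda> * (1 + 4 * U * T * val_bound n B ^ 3)"
    unfolding mult.assoc by (rule mult_le_mono2) (simp add: gap_bound_def)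
  then show ?thesis using p_large(6) unfolding U_def by linarith
qed

lemma store_in: "store K \<in> registers \<rightarrow>\<^sub>E {0..<int p}"
  using p_pos by (auto simp: store_def)

lemma finite_registers: "finite registers" and card_registers: "card registers = (T + 1) * (4 * b)"
  by (auto simp: registers_def card_cartesian_product)

lemma last_item_le: "entries_ok es \<Longrightarrow> last_item es \<le> n"
  by (auto simp: entries_ok_def last_item_def)

definition memories :: "memory set" where
  "memories = {xs. set xs \<subseteq> {0..<int p} \<and> length xs = 8} \<times> (registers \<rightarrow>\<^sub>E {0..<int p})"

lemma summary_in:
  assumes r: "0 \<le> r" "r < int p"
  shows "summary r s \<in> memories"
proof -
  obtain us cs ok where s: "s = (us, cs, ok)" by (metis prod_cases3)
  have np: "n < p" using p_large(4) by linarith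
  have "waiting r (hd us) \<in> memories"
    if "wf us cs" "us \<noteq> []"
  proof -
    have "fst (hd us) \<le> n" using that by (auto simp: wf_def)
    then show ?thesis using r p_large(1) np store_in by (simp add: waiting_def memories_def)
  qed
  moreover have "running r us cs \<in> memories"
    if "wf us cs" "cs \<noteq> []"
  proof -
    have "hd cs < p" "last_item (entries cs) \<le> n"
      using that last_item_le by (auto simp: wf_def)
    moreover have "min (length cs) (Suc d) < p" using Suc_d_less by linarith
    ultimately show ?thesis
      using r p_large(1) np store_in by (simp add: running_def memories_def)
  qed
  moreover have "rejecting \<in> memories"
    using p_large(1) store_in by (simp add: rejecting_def memories_def)
  moreover have "starting r \<in> memories"
    using r p_large(1) store_in by (simp add: starting_def memories_def)
  ultimately show ?thesis by (simp add: s summary_def)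
qed

text \<open>Eight words, \<open>4 * (T + 1) * b\<close> registers and one word for the unfinished
  block. The secret point is reduced modulo \<open>p\<close> so that every number, drawn or not,
  gives a summary in \<open>memories\<close>.\<close>

lemma protocol_verifier:
  obtains V where "memory_bits V (E * (9 + 4 * (T + 1) * b))" "coins_in_memory V"
    "verifier_coins V = map_pmf (\<lambda>i. replicate i True) (pmf_of_set {..<p})"
    "\<And>ts i. result V ts (replicate i True) =
       (if snd (parse E ts) = [] then verdict (summary (int i mod int p) (fst (parse E ts))) else None)"
proof (rule block_verifier[OF E, where Q = memories
      and w = "E * (8 + 4 * (T + 1) * b)" and \<psi> = "\<lambda>i s. summary (int i mod int p) s" and out = verdict
      and M = "pmf_of_set {..<p}"])
  let ?L = "{xs. set xs \<subseteq> {0..<int p} \<and> length xs = 8}"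
  have finL: "finite ?L" by (rule finite_lists_length_eq) simp
  have finK: "finite (registers \<rightarrow>\<^sub>E {0..<int p})" by (intro finite_PiE finite_registers) simp
  show "finite memories" using finL finK by (simp add: memories_def)
  have "card memories = p ^ 8 * p ^ card registers"
    by (simp add: memories_def card_cartesian_product card_lists_length_eq card_PiE finite_registers)
  also have "\<dots> = p ^ (8 + 4 * (T + 1) * b)" by (simp add: card_registers power_add mult_ac)
  also have "\<dots> \<le> (2 ^ E) ^ (8 + 4 * (T + 1) * b)" using p(2) by (intro power_mono) auto
  finally show "card memories \<le> 2 ^ (E * (8 + 4 * (T + 1) * b))"
    by (simp only: power_mult)
  show "summary (int r mod int p) s \<in> memories" for r s
    using p_pos by (intro summary_in) auto
  show "summary (int r mod int p) ([], [], False) = summary (int r' mod int p) ([], [], False)" for r r'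
    by (simp add: summary_def)
  fix V
  assume "memory_bits V (E * (8 + 4 * (T + 1) * b) + E)" "coins_in_memory V"
    "verifier_coins V = map_pmf (\<lambda>i. replicate i True) (pmf_of_set {..<p})"
    "\<And>ts i. result V ts (replicate i True) =
       (if snd (parse E ts) = [] then verdict (summary (int i mod int p) (fst (parse E ts))) else None)"
  moreover have "E * (8 + 4 * (T + 1) * b) + E = E * (9 + 4 * (T + 1) * b)" by (simp add: algebra_simps)
  ultimately show thesis using that by simp
qed (simp_all only: summary_update summary_block)

section \<open>The list as a function on items, and low degree extensions\<close>

definition item_freq :: "nat list \<Rightarrow> nat \<Rightarrow> nat" where
  "item_freq es i = (case map_of (map (\<lambda>v. (entry_item v, entry_freq v)) es) i of None \<Rightarrow> 0 | Some x \<Rightarrow> x)"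

definition item_level :: "nat list \<Rightarrow> nat \<Rightarrow> nat" where
  "item_level es i = (case map_of (map (\<lambda>v. (entry_item v, entry_level v)) es) i of None \<Rightarrow> 0 | Some x \<Rightarrow> x)"

text \<open>Since no item is listed twice, the list is a partial function, and
  \<open>F i 0 0 = 0\<close> lets the unlisted items contribute nothing.\<close>

lemma sum_entries:
  fixes F :: "nat \<Rightarrow> nat \<Rightarrow> nat \<Rightarrow> int"
  assumes "entries_ok es" "\<And>i. F i 0 0 = 0"
  shows "(\<Sum>v\<leftarrow>es. F (entry_item v) (entry_freq v) (entry_level v)) =
    (\<Sum>i\<in>{1..n}. F i (item_freq es i) (item_level es i))"
  using assms(1)
proof (induction es)
  case Nil
  then show ?case by (simp add: item_freq_def item_level_def assms(2))
next
  case (Cons v es)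
  then have ok: "entries_ok es" and v: "entry_item v \<in> {1..n}" and
    fresh: "\<And>w. w \<in> set es \<Longrightarrow> entry_item w \<noteq> entry_item v" by (auto simp: entries_ok_def)
  have "map_of (map (\<lambda>w. (entry_item w, g w)) es) (entry_item v) = None" for g :: "nat \<Rightarrow> nat"
  proof -
    have "entry_item v \<notin> entry_item ` set es" using fresh by fastforce
    then show ?thesis by (simp add: map_of_eq_None_iff image_image)
  qed
  then have old: "item_freq es (entry_item v) = 0" "item_level es (entry_item v) = 0"
    by (simp_all add: item_freq_def item_level_def)
  have new: "item_freq (v # es) = (item_freq es)(entry_item v := entry_freq v)"
    "item_level (v # es) = (item_level es)(entry_item v := entry_level v)"
    by (auto simp: item_freq_def item_level_def)
  show ?case
    using Cons.IH[OF ok] v by (simp add: new sum.remove[of _ "entry_item v"] old assms(2))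
qed

lemma item_freq_le: "item_freq es i \<le> B"
proof (cases "map_of (map (\<lambda>v. (entry_item v, entry_freq v)) es) i")
  case (Some x)
  then obtain v where "x = entry_freq v" by (auto dest!: map_of_SomeD)
  moreover have "entry_freq v \<le> B"
    unfolding entry_freq_def using mod_less_divisor[of "B + 1" "v div (T + 1)"] by linarith
  ultimately show ?thesis by (simp add: item_freq_def Some)
qed (simp add: item_freq_def)

lemma item_level_le: "item_level es i \<le> T"
proof (cases "map_of (map (\<lambda>v. (entry_item v, entry_level v)) es) i")
  case (Some x)
  then obtain v where "x = entry_level v" by (auto dest!: map_of_SomeD)
  moreover have "entry_level v \<le> T"
    unfolding entry_level_def using mod_less_divisor[of "T + 1" v] by linarith
  ultimately show ?thesis by (simp add: item_level_def Some)
qed (simp add: item_level_def)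

lemma item_level_0:
  assumes "entries_ok es" "item_level es i = 0"
  shows "item_freq es i = 0"
proof (cases "i \<in> entry_item ` set es")
  case True
  have "map_of (map (\<lambda>v. (entry_item v, entry_level v)) es) i \<noteq> None"
    using True by (simp add: map_of_eq_None_iff image_image)
  then obtain x where x: "map_of (map (\<lambda>v. (entry_item v, entry_level v)) es) i = Some x" by auto
  then obtain v where "v \<in> set es" "x = entry_level v" by (auto dest!: map_of_SomeD)
  then show ?thesis using assms x by (auto simp: item_level_def entries_ok_def)
next
  case False
  then have "map_of (map (\<lambda>v. (entry_item v, entry_freq v)) es) i = None" by (auto simp: map_of_eq_None_iff)
  then show ?thesis by (simp add: item_freq_def)
qed

text \<open>Any well-formed list qualifies, honest or not, and so does any key; this is what makes
  the certificate sound against all provers.\<close>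

lemma hashed:
  assumes "x \<in> sparse_streams n m B N" "entries_ok es"
  shows "hashed_frequencies n k B T U (hf key) (freq x) (item_freq es) (item_level es)"
proof
  show "0 \<le> freq x i" if "i \<in> {1..n}" for i
    using assms(1) that by (auto simp: sparse_streams_def strict_turnstile_def dest!: spec[of _ "length x"])
  show "freq x i \<le> int B" if "i \<in> {1..n}" for i
    using assms(1) that by (auto simp: sparse_streams_def)
qed (use n k B hf item_freq_le item_level_le item_level_0 assms(2) in \<open>auto simp: U_def\<close>)

abbreviation "bucket_val key x es \<equiv> hashed_frequencies.val n (hf key) (freq x) (item_freq es) (item_level es)"

definition extension :: "nat \<Rightarrow> stream \<Rightarrow> nat list \<Rightarrow> nat \<Rightarrow> nat \<Rightarrow> nat \<Rightarrow> int poly" where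
  "extension key x es t c y = (\<Sum>z<a. smult (bucket_val key x es t c (z * b + y)) (lag z))"

text \<open>The polynomial whose coefficients modulo \<open>p\<close> an honest prover sends: its
  variable is the column, and the rows are already summed up. Its values at the columns add up to
  \<open>V\<close> modulo \<open>p\<close>.\<close>

definition sum_poly :: "nat \<Rightarrow> stream \<Rightarrow> nat list \<Rightarrow> int poly" where
  "sum_poly key x es = (\<Sum>y<b. sumcheck_term k \<Omega> \<Lambda> T (\<lambda>t c. extension key x es t c y))"

end

context moment_protocol
begin

text \<open>Registers are linear in updates and entries, so each can be regrouped by item and then
  by bucket. The identity holds over the integers; reduction modulo \<open>p\<close> enters only
  with \<open>store\<close>.\<close>

lemma sketch_eq_extension:
  assumes x: "x \<in> sparse_streams n m B N" and es: "entries_ok es" and y: "y < b"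
  shows "sketch key r x es (t, c, y) = poly (extension key x es t c y) r"
proof -
  interpret HF: hashed_frequencies n k B T U "hf key" "freq x" "item_freq es" "item_level es"
    by (rule hashed[OF x es])
  let ?cell = "cell key r t y"
  have fst: "fst u \<in> {1..n}" if "u \<in> set x" for u
    using x that by (auto simp: sparse_streams_def strict_turnstile_def)
  have "sketch key r x es (t, c, y) = (\<Sum>i\<in>{1..n}. HF.vec t c i * ?cell i)"
  proof (cases "c < 3")
    case True
    have "(\<Sum>u\<leftarrow>x. update_part key r (t, c, y) u) = (\<Sum>(i, \<delta>)\<leftarrow>x. \<delta> * (int i ^ c * ?cell i))"
      using True by (simp add: update_part_def case_prod_unfold)
    also have "\<dots> = (\<Sum>i\<in>{1..n}. freq x i * (int i ^ c * ?cell i))"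
      by (rule freq_weighted_sum) (rule fst)
    finally have 1: "(\<Sum>u\<leftarrow>x. update_part key r (t, c, y) u) = (\<Sum>i\<in>{1..n}. freq x i * (int i ^ c * ?cell i))" .
    have 2: "(\<Sum>v\<leftarrow>es. entry_part key r (t, c, y) v) =
        (\<Sum>i\<in>{1..n}. ?cell i * (if t = 0 \<or> item_level es i = t then - int (item_freq es i) * int i ^ c else 0))"
      using True sum_entries[OF es, of "\<lambda>i l g. ?cell i * (if t = 0 \<or> g = t then - int l * int i ^ c else 0)"]
      by (simp add: entry_part_def)
    show ?thesis
      unfolding sketch_def 1 2 sum.distrib[symmetric]
      by (intro sum.cong refl) (use True in \<open>auto simp: HF.vec_def HF.residual_def algebra_simps\<close>)
  next
    case False
    have 1: "(\<Sum>u\<leftarrow>x. update_part key r (t, c, y) u) = 0"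
      using False by (simp add: update_part_def case_prod_beta)
    have 2: "(\<Sum>v\<leftarrow>es. entry_part key r (t, c, y) v) =
        (\<Sum>i\<in>{1..n}. ?cell i * of_bool (t \<noteq> 0 \<and> item_level es i = t))"
      using False sum_entries[OF es, of "\<lambda>i l g. ?cell i * of_bool (t \<noteq> 0 \<and> g = t)"]
      by (auto simp: entry_part_def)
    show ?thesis
      unfolding sketch_def 1 2
      by (simp only: add_0) (intro sum.cong refl, use False in \<open>simp add: HF.vec_def\<close>)
  qed
  also have "\<dots> = (\<Sum>i\<in>{1..n}. \<Sum>z<a. if hf key t i = z * b + y then HF.vec t c i * poly (lag z) r else 0)"
  proof (rule sum.cong)
    fix i
    have iff: "hf key t i = z * b + y \<longleftrightarrow> z = hf key t i div b \<and> hf key t i mod b = y" for z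
      using y by (auto simp: div_mult_mod_eq)
    have less: "hf key t i div b < a" using hf[of key t i] b by (simp add: less_mult_imp_div_less)
    show "HF.vec t c i * ?cell i = (\<Sum>z<a. if hf key t i = z * b + y then HF.vec t c i * poly (lag z) r else 0)"
      unfolding iff using less by (simp add: cell_def if_distrib[of "\<lambda>z. _ * z"] cong: if_cong)
  qed simp
  also have "\<dots> = (\<Sum>z<a. \<Sum>i\<in>{1..n}. if hf key t i = z * b + y then HF.vec t c i * poly (lag z) r else 0)"
    by (rule sum.swap)
  also have "\<dots> = (\<Sum>z<a. HF.val t c (z * b + y) * poly (lag z) r)"
  proof (rule sum.cong)
    fix z
    show "(\<Sum>i\<in>{1..n}. if hf key t i = z * b + y then HF.vec t c i * poly (lag z) r else 0) =
        HF.val t c (z * b + y) * poly (lag z) r"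
      unfolding HF.val_def HF.bucket_def sum_distrib_right by (rule sum.inter_filter[symmetric]) simp
  qed simp
  also have "\<dots> = poly (extension key x es t c y) r" by (simp add: extension_def poly_sum)
  finally show ?thesis .
qed

lemma degree_sum_poly: "degree (sum_poly key x es) < d"
proof -
  have "degree (extension key x es t c y) \<le> a - 1" for t c y
    unfolding extension_def
    by (intro degree_sum_le order_trans[OF degree_smult_le]) (use lag(1) in \<open>force simp: less_eq_Suc_le\<close>)+
  then have "degree (sum_poly key x es) \<le> (k + 2) * (a - 1)"
    unfolding sum_poly_def by (intro degree_sum_le degree_sumcheck_term_le k) auto
  also have "\<dots> < d" unfolding d_def using a by (intro mult_strict_left_mono) auto
  finally show ?thesis .
qed

lemma sum_sum_poly:
  assumes x: "x \<in> sparse_streams n m B N" and es: "entries_ok es"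
  shows "[(\<Sum>z<a. poly (sum_poly key x es) (int z)) =
    hashed_frequencies.V n k B T U (hf key) (freq x) (item_freq es) (item_level es)] (mod int p)"
proof -
  interpret HF: hashed_frequencies n k B T U "hf key" "freq x" "item_freq es" "item_level es"
    by (rule hashed[OF x es])
  have ext: "[poly (extension key x es t c y) (int z) = HF.val t c (z * b + y)] (mod int p)" if "z < a" for t c y z
  proof -
    have "[(\<Sum>z'<a. HF.val t c (z' * b + y) * poly (lag z') (int z)) =
        (\<Sum>z'<a. HF.val t c (z' * b + y) * of_bool (z' = z))] (mod int p)"
      by (intro cong_sum cong_mult cong_refl lag(2)) (use that in auto)
    also have "(\<Sum>z'<a. HF.val t c (z' * b + y) * of_bool (z' = z)) = HF.val t c (z * b + y)"
      using that by (simp add: of_bool_def if_distrib[of "\<lambda>z. _ * z"] cong: if_cong)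
    finally show ?thesis by (simp add: extension_def poly_sum)
  qed
  have "[(\<Sum>z<a. poly (sum_poly key x es) (int z)) =
      (\<Sum>z<a. \<Sum>y<b. sumcheck_term k \<Omega> \<Lambda> T (\<lambda>t c. HF.val t c (z * b + y)))] (mod int p)"
    unfolding sum_poly_def poly_sum poly_sumcheck_term
    by (intro cong_sum sumcheck_term_cong ext) auto
  also have "(\<Sum>z<a. \<Sum>y<b. sumcheck_term k \<Omega> \<Lambda> T (\<lambda>t c. HF.val t c (z * b + y))) =
      (\<Sum>z<a. \<Sum>j\<in>{z * b..<z * b + b}. sumcheck_term k \<Omega> \<Lambda> T (\<lambda>t c. HF.val t c j))"
  proof (rule sum.cong)
    fix z
    show "(\<Sum>y<b. sumcheck_term k \<Omega> \<Lambda> T (\<lambda>t c. HF.val t c (z * b + y))) =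
        (\<Sum>j\<in>{z * b..<z * b + b}. sumcheck_term k \<Omega> \<Lambda> T (\<lambda>t c. HF.val t c j))"
      using sum.shift_bounds_nat_ivl[of "\<lambda>j. sumcheck_term k \<Omega> \<Lambda> T (\<lambda>t c. HF.val t c j)" 0 "z * b" b]
      by (simp add: add.commute atLeast0LessThan)
  qed simp
  also have "\<dots> = (\<Sum>j<a * b. sumcheck_term k \<Omega> \<Lambda> T (\<lambda>t c. HF.val t c j))"
    by (rule sum.nat_group)
  also have "\<dots> = HF.V" by (simp only: HF.V_def U_def[symmetric])
  finally show ?thesis .
qed

lemma sum_register_eq:
  assumes x: "x \<in> sparse_streams n m B N" and es: "entries_ok es"
  shows "(\<Sum>y<b. sumcheck_term k \<Omega> \<Lambda> T (\<lambda>t c. store (sketch key r x es) (t, c, y))) mod int p =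
    poly (sum_poly key x es) r mod int p"
proof -
  have "[(\<Sum>y<b. sumcheck_term k \<Omega> \<Lambda> T (\<lambda>t c. store (sketch key r x es) (t, c, y))) =
      (\<Sum>y<b. sumcheck_term k \<Omega> \<Lambda> T (\<lambda>t c. poly (extension key x es t c y) r))] (mod int p)"
  proof (intro cong_sum sumcheck_term_cong)
    fix y t c :: nat
    assume "y \<in> {..<b}" "t \<le> T" "c < 4"
    then show "[store (sketch key r x es) (t, c, y) = poly (extension key x es t c y) r] (mod int p)"
      using sketch_eq_extension[OF x es, of y key r t c] by (simp add: store_def registers_def cong_def)
  qed
  then show ?thesis by (simp add: cong_def sum_poly_def poly_sum poly_sumcheck_term)
qed

lemma listed_moment:
  assumes "entries_ok es"
  shows "(\<Sum>v\<leftarrow>es. int (entry_freq v) ^ k) mod int p = (\<Sum>i\<in>{1..n}. int (item_freq es i) ^ k)"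
proof -
  have eq: "(\<Sum>v\<leftarrow>es. int (entry_freq v) ^ k) = (\<Sum>i\<in>{1..n}. int (item_freq es i) ^ k)"
    using sum_entries[OF assms, of "\<lambda>i l g. int l ^ k"] k by simp
  have "(\<Sum>i\<in>{1..n}. int (item_freq es i) ^ k) \<le> (\<Sum>i\<in>{1..n}. int B ^ k)"
    by (intro sum_mono power_mono) (simp_all add: item_freq_le)
  also have "\<dots> = int (n * B ^ k)" by simp
  also have "\<dots> < int p" using p_large(3) by (simp only: of_nat_less_iff)
  finally show ?thesis
    unfolding eq by (intro mod_pos_pos_trivial sum_nonneg) auto
qed

lemma verdict_running:
  assumes x: "x \<in> sparse_streams n m B N" and es: "entries_ok (entries cs)"
  shows "verdict (running r x cs) = (let S = (\<Sum>z<a. poly (coefs cs) (int z)) mod int p in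
    if Suc d \<le> length cs \<and> poly (coefs cs) r mod int p = poly (sum_poly (hd cs) x (entries cs)) r mod int p \<and>
      S < int \<Omega> then Some (S + (\<Sum>i\<in>{1..n}. int (item_freq (entries cs) i) ^ k)) else None)"
  using sum_register_eq[OF x es] listed_moment[OF es]
  by (auto simp: verdict_def running_def Let_def min_def)

text \<open>The annotation is fixed independently of the secret point. If the claimed polynomial
  differs from \<open>sum_poly\<close> modulo \<open>p\<close>, the two agree at no more than
  \<open>d\<close> points; otherwise the claimed sum is congruent to \<open>V\<close>, and an
  accepted value is correct for every point.\<close>

lemma protocol_sound:
  assumes x: "x \<in> sparse_streams n m B N" and A: "length A = length x"
  shows "card {i. i < p \<and> (if snd (parse E (interleave x A)) = []
      then verdict (summary (int i) (fst (parse E (interleave x A)))) else None) \<notin>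
        {Some (freq_moment k n x), None}} \<le> d"
proof -
  obtain us cs ok buf where pa: "parse E (interleave x A) = ((us, cs, ok), buf)" by (metis surj_pair)
  let ?bad = "{i. i < p \<and> (if snd (parse E (interleave x A)) = []
      then verdict (summary (int i) (fst (parse E (interleave x A)))) else None) \<notin>
        {Some (freq_moment k n x), None}}"
  have rej: "verdict rejecting = None" "verdict (waiting r u) = None" "verdict (starting r) = Some 0" for r u
    by (simp_all add: verdict_def rejecting_def waiting_def starting_def)
  show ?thesis
  proof (cases "buf = [] \<and> ok \<and> wf us cs \<and> cs \<noteq> []")
    case False
    \<comment> \<open>Only \<open>starting\<close> can produce a value here, and it is the final
      state only for the empty stream, whose moment is 0.\<close>
    have "?bad = {}"
    proof (cases "ok \<and> us = []")
      case True
      then have "x = []" using parse_updates[of E "interleave x A" us cs] pa token_updates_interleave[OF A] by simp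
      then have "freq_moment k n x = 0" using k by (simp add: freq_moment_def)
      then show ?thesis using False by (auto simp: pa summary_def rej)
    qed (use False in \<open>auto simp: pa summary_def rej\<close>)
    then show ?thesis by (metis card.empty zero_le)
  next
    case True
    then have us: "us = x"
      using parse_updates[of E "interleave x A" us cs] pa token_updates_interleave[OF A] by simp
    define es where "es = entries cs"
    have es: "entries_ok es" using True by (simp add: wf_def es_def)
    interpret HF: hashed_frequencies n k B T U "hf (hd cs)" "freq x" "item_freq es" "item_level es"
      by (rule hashed[OF x es])
    define G where "G = sum_poly (hd cs) x es"
    define D where "D = coefs cs - G"
    define S where "S = (\<Sum>z<a. poly (coefs cs) (int z)) mod int p"
    have verdict: "verdict (summary (int i) (us, cs, True)) = (if Suc d \<le> length cs \<and>
        poly (coefs cs) (int i) mod int p = poly G (int i) mod int p \<and> S < int \<Omega>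
        then Some (S + (\<Sum>i\<in>{1..n}. int (item_freq es i) ^ k)) else None)" for i
      using True verdict_running[OF x, of cs "int i"] es
      by (simp add: summary_def us es_def G_def S_def Let_def)
    show ?thesis
    proof (cases "\<exists>j. \<not> int p dvd coeff D j")
      case ex: True
      then obtain j where j: "\<not> int p dvd coeff D j" by blast
      have "?bad \<subseteq> {i. i < p \<and> int p dvd poly D (int i)}"
        using True by (auto simp: pa verdict D_def mod_eq_dvd_iff split: if_splits)
      then have "card ?bad \<le> card {i. i < p \<and> int p dvd poly D (int i)}"
        by (intro card_mono) auto
      also have "\<dots> \<le> degree D" by (rule card_roots_mod_prime[OF p(1) j])
      also have "\<dots> \<le> d"
      proof -
        have "degree (coefs cs) \<le> d"
          unfolding coefs_def by (rule order_trans[OF degree_Poly]) simp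
        then show ?thesis
          unfolding D_def using degree_sum_poly[of "hd cs" x es] by (intro degree_diff_le) (auto simp: G_def)
      qed
      finally show ?thesis .
    next
      case all: False
      have "[poly (coefs cs) z = poly G z] (mod int p)" for z
      proof -
        have "int p dvd poly D z" unfolding poly_altdef using all by (intro dvd_sum dvd_mult2) auto
        then show ?thesis by (simp add: D_def cong_iff_dvd_diff)
      qed
      then have "[(\<Sum>z<a. poly (coefs cs) (int z)) = (\<Sum>z<a. poly G (int z))] (mod int p)"
        by (intro cong_sum)
      also have "[(\<Sum>z<a. poly G (int z)) = HF.V] (mod int p)"
        unfolding G_def by (rule sum_sum_poly[OF x es])
      finally have SV: "HF.V mod int p = S mod int p" by (simp add: S_def cong_def)
      have "S + (\<Sum>i\<in>{1..n}. int (item_freq es i) ^ k) = freq_moment k n x" if "S < int \<Omega>"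
        unfolding freq_moment_def
        by (rule HF.accepted_value_correct[OF _ _ that SV]) (use p_large(6) p_pos in \<open>auto simp: U_def S_def\<close>)
      then have "?bad = {}" using True by (auto simp: pa verdict)
      then show ?thesis by (metis card.empty zero_le)
    qed
  qed
qed

end

section \<open>Completeness\<close>

lemma fold_read_updates:
  "fold (read_token E) (map Update us) ((xs, [key], ok), []) = ((xs @ us, [key], ok \<and> (us = [] \<or> xs \<noteq> [])), [])"
proof (induction us arbitrary: xs ok)
  case (Cons u us)
  have "read_token E (Update u) ((xs, [key], ok), []) = ((xs @ [u], [key], ok \<and> xs \<noteq> []), [])"
    by (simp add: read_token_def read_update_def)
  then show ?case using Cons[of "xs @ [u]"] by simp
qed simp

lemma fold_read_blocks:
  "xs \<noteq> [] \<Longrightarrow> cs \<noteq> [] \<Longrightarrow> fold read_block vs (xs, cs, ok) = (xs, cs @ vs, ok)"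
  by (induction vs arbitrary: cs) (simp_all add: read_block_def)

lemma parse_first_last:
  assumes "1 \<le> E" "x = u # us" "key < 2 ^ E" "\<forall>v\<in>set vs. v < 2 ^ E"
  shows "parse E (Update u # map Bit (word E key) @ map Update us @ map Bit (concat (map (word E) vs))) =
    ((x, key # vs, True), [])"
proof -
  have 1: "read_token E (Update u) (([], [], True), []) = (([u], [], True), [])"
    by (simp add: read_token_def read_update_def)
  have 2: "fold (read_token E) (map Bit (word E key)) (([u], [], True), []) = (([u], [key], True), [])"
    using read_words[OF assms(1), of "[key]" "([u], [], True)"] assms(3) by (simp add: read_block_def)
  have 3: "fold (read_token E) (map Update us) (([u], [key], True), []) = ((x, [key], True), [])"
    by (simp add: fold_read_updates assms(2))
  have 4: "fold (read_token E) (map Bit (concat (map (word E) vs))) ((x, [key], True), []) = ((x, key # vs, True), [])"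
    using read_words[OF assms(1,4)] fold_read_blocks[of x "[key]" vs True] assms(2) by simp
  show ?thesis by (simp add: parse_def 1 2 3 4)
qed

context moment_protocol
begin

section \<open>What the honest prover sends\<close>

definition support :: "stream \<Rightarrow> nat set" where
  "support x = {i\<in>{1..n}. freq x i \<noteq> 0}"

definition isolating_level :: "nat \<Rightarrow> nat set \<Rightarrow> nat \<Rightarrow> nat" where
  "isolating_level key S i = (SOME t. t \<in> {1..T} \<and> i \<notin> collisions (hf key t) S)"

definition entry_code :: "nat \<Rightarrow> nat \<Rightarrow> nat \<Rightarrow> nat" where
  "entry_code i l t = (i * (B + 1) + l) * (T + 1) + t"

definition honest_entries :: "stream \<Rightarrow> nat \<Rightarrow> nat list" where
  "honest_entries x key = map (\<lambda>i. entry_code i (nat (freq x i)) (isolating_level key (support x) i))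
     (sorted_list_of_set (collisions (hf key 0) (support x)))"

definition honest_blocks :: "stream \<Rightarrow> nat \<Rightarrow> nat list" where
  "honest_blocks x key =
     map (\<lambda>j. nat (coeff (sum_poly key x (honest_entries x key)) j mod int p)) [0..<d] @ honest_entries x key"

lemma decode:
  assumes "l \<le> B" "t \<le> T"
  shows "entry_level (entry_code i l t) = t" "entry_freq (entry_code i l t) = l"
    "entry_item (entry_code i l t) = i"
proof -
  have t: "t < T + 1" and l: "l < B + 1" using assms by auto
  have 1: "entry_code i l t div (T + 1) = i * (B + 1) + l"
    unfolding entry_code_def using t by (subst div_mult_self3) auto
  show "entry_level (entry_code i l t) = t"
    unfolding entry_level_def entry_code_def using t by (simp only: mod_mult_self3) simp
  show "entry_freq (entry_code i l t) = l"
    unfolding entry_freq_def 1 using l by (simp only: mod_mult_self3) simp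
  show "entry_item (entry_code i l t) = i"
    unfolding entry_item_def 1 using l by (subst div_mult_self3) auto
qed

lemma entry_code_less:
  assumes "i \<le> n" "l \<le> B" "t \<le> T"
  shows "entry_code i l t < p"
proof -
  have "i * (B + 1) + l < (i + 1) * (B + 1)" using assms by simp
  also have "\<dots> \<le> (n + 1) * (B + 1)" using assms by (intro mult_le_mono1) simp
  finally have "i * (B + 1) + l + 1 \<le> (n + 1) * (B + 1)" by simp
  then have "(i * (B + 1) + l + 1) * (T + 1) \<le> (n + 1) * (B + 1) * (T + 1)" by (rule mult_le_mono1)
  moreover have "entry_code i l t < (i * (B + 1) + l + 1) * (T + 1)"
    using assms unfolding entry_code_def by (simp add: algebra_simps)
  ultimately show ?thesis using p_large(5) by linarith
qed

context
  fixes x m N key s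
  assumes x: "x \<in> sparse_streams n m B N" and good: "good_hash m s T (hf key) (support x)"
begin

lemma freq_bounds:
  assumes "i \<in> {1..n}"
  shows "0 \<le> freq x i" "nat (freq x i) \<le> B"
proof -
  show "0 \<le> freq x i"
    using x assms by (auto simp: sparse_streams_def strict_turnstile_def dest!: spec[of _ "length x"])
  show "nat (freq x i) \<le> B" using x assms by (auto simp: sparse_streams_def nat_le_iff)
qed

lemma isolating:
  assumes "i \<in> support x"
  shows "isolating_level key (support x) i \<in> {1..T} \<and>
    i \<notin> collisions (hf key (isolating_level key (support x) i)) (support x)"
  unfolding isolating_level_def
  by (rule someI_ex) (use good assms in \<open>unfold good_hash_def, blast\<close>)

lemma collisions_subset: "collisions (hf key t) (support x) \<subseteq> support x"
  by (auto simp: collisions_def)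

lemma finite_collisions: "finite (collisions (hf key t) (support x))"
  using collisions_subset finite_subset[of _ "support x"] by (simp add: support_def)

lemma honest_decode:
  assumes "i \<in> collisions (hf key 0) (support x)"
  defines "v \<equiv> entry_code i (nat (freq x i)) (isolating_level key (support x) i)"
  shows "entry_item v = i" "entry_freq v = nat (freq x i)" "entry_level v = isolating_level key (support x) i"
    "v < p" "i \<in> {1..n}" "1 \<le> isolating_level key (support x) i"
proof -
  have i: "i \<in> support x" using assms collisions_subset by blast
  then show i1: "i \<in> {1..n}" by (simp add: support_def)
  have T: "isolating_level key (support x) i \<le> T" and "1 \<le> isolating_level key (support x) i"
    using isolating[OF i] by auto
  then show "1 \<le> isolating_level key (support x) i" by simp
  show "entry_item v = i" "entry_freq v = nat (freq x i)" "entry_level v = isolating_level key (support x) i"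
    unfolding v_def using decode[OF freq_bounds(2)[OF i1] T] by auto
  show "v < p" unfolding v_def using entry_code_less freq_bounds(2)[OF i1] T i1 by auto
qed

lemma honest_entries_ok: "entries_ok (honest_entries x key)"
proof -
  let ?Z = "collisions (hf key 0) (support x)"
  let ?code = "\<lambda>i. entry_code i (nat (freq x i)) (isolating_level key (support x) i)"
  have "sorted_wrt (\<lambda>i j. entry_item (?code i) < entry_item (?code j)) (sorted_list_of_set ?Z)"
    by (rule sorted_wrt_mono_rel[OF _ strict_sorted_list_of_set[of ?Z]])
      (use honest_decode(1) finite_collisions in auto)
  then show ?thesis
    using honest_decode finite_collisions by (auto simp: entries_ok_def honest_entries_def sorted_wrt_map)
qed

lemma honest_lookup:
  "item_freq (honest_entries x key) i =
     (if i \<in> collisions (hf key 0) (support x) then nat (freq x i) else 0)" (is ?f)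
  "item_level (honest_entries x key) i =
     (if i \<in> collisions (hf key 0) (support x) then isolating_level key (support x) i else 0)" (is ?l)
proof -
  let ?Z = "collisions (hf key 0) (support x)"
  have "map (\<lambda>v. (entry_item v, entry_freq v)) (honest_entries x key) =
      map (\<lambda>i. (i, nat (freq x i))) (sorted_list_of_set ?Z)"
    "map (\<lambda>v. (entry_item v, entry_level v)) (honest_entries x key) =
      map (\<lambda>i. (i, isolating_level key (support x) i)) (sorted_list_of_set ?Z)"
    unfolding honest_entries_def map_map o_def
    by (intro map_cong refl; use honest_decode finite_collisions in auto)+
  then show ?f ?l
    using finite_collisions[of 0] by (simp_all add: item_freq_def item_level_def map_of_map_restrict restrict_map_def)
qed

text \<open>Listing the items that collide on level 0, each with an isolating level, meets the
  hypotheses of \<open>honest_value\<close>. As \<open>V\<close> then lies between 0 and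
  \<open>\<Omega> \<le> p\<close>, the claimed sum modulo \<open>p\<close> is \<open>V\<close>
  itself and passes the comparison with \<open>\<Omega>\<close>.\<close>

lemma honest_verdict:
  assumes key: "key < p" and ne: "x \<noteq> []"
  shows "verdict (summary r (x, key # honest_blocks x key, True)) = Some (freq_moment k n x)"
proof -
  define es where "es = honest_entries x key"
  define cs where "cs = key # honest_blocks x key"
  define G where "G = sum_poly key x es"
  have es: "entries_ok es" unfolding es_def by (rule honest_entries_ok)
  interpret HF: hashed_frequencies n k B T U "hf key" "freq x" "item_freq es" "item_level es"
    by (rule hashed[OF x es])
  have ent: "entries cs = es"
    by (simp add: cs_def entries_def honest_blocks_def es_def)
  have take: "take d (drop 1 cs) = map (\<lambda>j. nat (coeff G j mod int p)) [0..<d]"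
    by (simp add: cs_def honest_blocks_def G_def es_def)
  have coeff: "[coeff (coefs cs) j = coeff G j] (mod int p)" for j
  proof (cases "j < d")
    case True
    then show ?thesis using p_pos by (simp add: coefs_def take[unfolded One_nat_def] coeff_Poly_eq nth_default_nth cong_def o_def)
  next
    case False
    then have "coeff G j = 0" using degree_sum_poly[of key x es] by (simp add: G_def coeff_eq_0)
    then show ?thesis using False by (simp add: coefs_def take[unfolded One_nat_def] coeff_Poly_eq nth_default_beyond)
  qed
  have poly: "[poly (coefs cs) z = poly G z] (mod int p)" for z
  proof -
    have "int p dvd poly (coefs cs - G) z"
      unfolding poly_altdef using coeff by (intro dvd_sum dvd_mult2) (simp add: cong_iff_dvd_diff)
    then show ?thesis by (simp add: cong_iff_dvd_diff)
  qed
  have "[(\<Sum>z<a. poly (coefs cs) (int z)) = (\<Sum>z<a. poly G (int z))] (mod int p)"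
    by (intro cong_sum poly)
  also have "[(\<Sum>z<a. poly G (int z)) = HF.V] (mod int p)"
    unfolding G_def by (rule sum_sum_poly[OF x es])
  finally have SV: "(\<Sum>z<a. poly (coefs cs) (int z)) mod int p = HF.V mod int p" by (simp add: cong_def)
  note lookup = honest_lookup[folded es_def]
  have list: "freq x i = int (item_freq es i) \<and> freq x i \<noteq> 0" if "i \<in> {1..n}" "item_level es i \<noteq> 0" for i
  proof -
    have i: "i \<in> collisions (hf key 0) (support x)" using that by (auto simp: lookup split: if_splits)
    then have "freq x i \<noteq> 0" using collisions_subset by (auto simp: support_def)
    then show ?thesis using i freq_bounds(1)[OF that(1)] by (simp add: lookup)
  qed
  have collide: "item_level es i \<noteq> 0"
    if "i \<in> {1..n}" "i' \<in> {1..n}" "i \<noteq> i'" "hf key 0 i = hf key 0 i'" "freq x i \<noteq> 0" "freq x i' \<noteq> 0" for i i'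
  proof -
    have i: "i \<in> collisions (hf key 0) (support x)" using that by (auto simp: collisions_def support_def)
    then show ?thesis using honest_decode(6)[OF i] by (simp add: lookup)
  qed
  have isolated: "freq x i' = 0"
    if "i \<in> {1..n}" "i' \<in> {1..n}" "i \<noteq> i'" "item_level es i \<noteq> 0"
      "hf key (item_level es i) i = hf key (item_level es i) i'" for i i'
  proof -
    have i: "i \<in> collisions (hf key 0) (support x)" using that(4) by (auto simp: lookup split: if_splits)
    then have "i \<in> support x" using collisions_subset by blast
    then show ?thesis using isolating[of i] that i by (auto simp: lookup collisions_def support_def)
  qed
  have V: "HF.V + (\<Sum>i\<in>{1..n}. int (item_freq es i) ^ k) = (\<Sum>i\<in>{1..n}. freq x i ^ k)"
      "0 \<le> HF.V" "HF.V < int \<Omega>"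
    by (rule HF.honest_value; use list collide isolated in blast)+
  have S: "(\<Sum>z<a. poly (coefs cs) (int z)) mod int p = HF.V"
    unfolding SV using V(2,3) \<Omega>_le_p by (intro mod_pos_pos_trivial) auto
  have wf: "wf x cs"
  proof -
    have "\<forall>u\<in>set x. fst u \<in> {1..n}" using x by (auto simp: sparse_streams_def strict_turnstile_def)
    moreover have "v < p" if "v \<in> set cs" for v
      using that key p_pos honest_decode(4) finite_collisions
      by (auto simp: cs_def honest_blocks_def honest_entries_def nat_less_iff)
    ultimately show ?thesis using ne es by (simp add: wf_def ent) (simp add: cs_def)
  qed
  have "verdict (running r x cs) = Some (HF.V + (\<Sum>i\<in>{1..n}. int (item_freq es i) ^ k))"
    using verdict_running[OF x, of cs r] es poly[of r] V(3)
    by (simp add: ent Let_def S) (simp add: cs_def honest_blocks_def G_def cong_def)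
  then show ?thesis
    using wf V(1) by (simp add: summary_def cs_def[symmetric] freq_moment_def) (simp add: cs_def)
qed

lemma length_honest_blocks:
  assumes "1 \<le> s"
  shows "length (honest_blocks x key) \<le> d + 16 * m div s"
proof -
  have "s * card (collisions (hf key 0) (support x)) \<le> 16 * m" using good by (simp add: good_hash_def)
  then have "card (collisions (hf key 0) (support x)) \<le> 16 * m div s"
    using assms by (simp add: less_eq_div_iff_mult_less_eq mult.commute)
  then show ?thesis by (simp add: honest_blocks_def honest_entries_def)
qed

lemma honest_blocks_less: "v \<in> set (honest_blocks x key) \<Longrightarrow> v < p"
  using p_pos honest_decode(4) finite_collisions
  by (auto simp: honest_blocks_def honest_entries_def nat_less_iff)

end

end

context moment_protocol
begin

text \<open>Reading only \<open>take j x\<close> makes it online, and \<open>N\<close> tells it when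
  the proof is due. On a bad key it sends no proof, which gives up the answer but keeps the
  annotation within the bound for all coins.\<close>

definition honest_prover :: "nat \<Rightarrow> nat \<Rightarrow> nat \<Rightarrow> prover" where
  "honest_prover m s N = \<lparr>prover_coins = map_pmf (\<lambda>key. replicate key True) (pmf_of_set {..<48 * n}),
     annot = (\<lambda>j x r. (if j = 1 then word E (length r) else []) @
       (if j = N then if good_hash m s T (hf (length r)) (support (take j x))
          then concat (map (word E) (honest_blocks (take j x) (length r))) else [] else []))\<rparr>"

lemma length_concat_words: "length (concat (map (word E) vs)) = E * length vs"
  by (induction vs) auto

text \<open>Completeness can fail only on at most \<open>16 * n\<close> bad keys among
  \<open>48 * n\<close>, soundness only on at most \<open>d < p / 3\<close> secret points.\<close>

lemma protocol_scheme:
  assumes family: "\<And>S. S \<subseteq> {1..n} \<Longrightarrow> card S \<le> m \<Longrightarrow>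
      card {key. key < 48 * n \<and> \<not> good_hash m s T (hf key) S} \<le> 16 * n"
    and s: "1 \<le> s"
  shows "\<exists>P V. online_scheme (sparse_streams n m B N) (freq_moment k n)
      (real (E * (1 + d + 16 * m div s))) (real (E * (9 + 4 * (T + 1) * b))) P V \<and> coins_in_memory V"
proof -
  let ?X = "sparse_streams n m B N" and ?F = "freq_moment k n"
  obtain V where V: "memory_bits V (E * (9 + 4 * (T + 1) * b))" "coins_in_memory V"
    "verifier_coins V = map_pmf (\<lambda>i. replicate i True) (pmf_of_set {..<p})"
    and res: "\<And>ts i. result V ts (replicate i True) =
       (if snd (parse E ts) = [] then verdict (summary (int i mod int p) (fst (parse E ts))) else None)"
    using protocol_verifier by blast
  define P where "P = honest_prover m s N"
  define proof_bits where "proof_bits x key = (if good_hash m s T (hf key) (support x)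
      then concat (map (word E) (honest_blocks x key)) else [])" for x key
  have len: "length x = N" if "x \<in> ?X" for x using that by (simp add: sparse_streams_def)
  have ann: "annotations P x r = map (\<lambda>j. (if j = 1 then word E (length r) else []) @
      (if j = length x then proof_bits x (length r) else [])) [1..<Suc (length x)]" if "x \<in> ?X" for x r
    unfolding annotations_def P_def honest_prover_def proof_bits_def using len[OF that]
    by (intro map_cong refl) auto
  have p0: "0 < p" using p_large(1) by simp
  have supp: "support x \<subseteq> {1..n}" "card (support x) \<le> m" if "x \<in> ?X" for x
    using that by (auto simp: support_def sparse_streams_def sparsity_def)
  have on: "online P"
    unfolding online_def P_def honest_prover_def by auto
  have cost: "real (sum_list (map length (annotations P x r))) \<le> real (E * (1 + d + 16 * m div s))"
    if x: "x \<in> ?X" for x r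
  proof (cases x)
    case Nil
    then show ?thesis by (simp add: annotations_def)
  next
    case (Cons u us)
    have pb: "length (proof_bits x key) \<le> E * (d + 16 * m div s)" for key
      using length_honest_blocks[OF x _ s] by (auto simp: proof_bits_def length_concat_words)
    have "sum_list (map length (annotations P x r)) =
        (\<Sum>j\<in>{1..<Suc (length x)}. (if j = 1 then E else 0) + (if j = length x then length (proof_bits x (length r)) else 0))"
    proof -
      have "length ((if j = 1 then word E (length r) else []) @ (if j = length x then proof_bits x (length r) else []))
        = (if j = 1 then E else 0) + (if j = length x then length (proof_bits x (length r)) else 0)" for j
        by simp
      then show ?thesis
        unfolding ann[OF x] map_map o_def by (simp only: sum_list_distinct_conv_sum_set distinct_upt set_upt)
    qed
    also have "\<dots> = E + length (proof_bits x (length r))"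
    proof -
      have "1 \<le> length x" "x \<noteq> []" using Cons by simp_all
      then show ?thesis unfolding sum.distrib by (simp add: sum.delta)
    qed
    also have "\<dots> \<le> E * (1 + d + 16 * m div s)" using pb[of "length r"] by (simp add: algebra_simps)
    finally show ?thesis by (simp only: of_nat_le_iff)
  qed
  have complete: "result V (interleave x (annotations P x (replicate key True))) (replicate i True) = Some (?F x)"
    if x: "x \<in> ?X" and key: "key < 48 * n" and good: "good_hash m s T (hf key) (support x)" for x key i
  proof (cases x)
    case Nil
    then show ?thesis using k
      by (simp add: res interleave_def parse_def summary_def wf_def entries_ok_def entries_def
          verdict_def starting_def freq_moment_def)
  next
    case (Cons u us)
    have keyp: "key < p" using key p_large(4) by linarith
    have "parse E (interleave x (annotations P x (replicate key True))) = ((x, key # honest_blocks x key, True), [])"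
      unfolding ann[OF x] interleave_first_last[OF Cons] length_replicate
      using good parse_first_last[OF E Cons, of key "honest_blocks x key"] honest_blocks_less[OF x good] keyp p(2)
      by (auto simp: proof_bits_def dest: order_less_le_trans)
    then show ?thesis using honest_verdict[OF x good keyp] Cons by (simp add: res)
  qed
  have set_coins: "set_pmf (pmf_of_set {..<48 * n}) = {..<48 * n}"
    using n by (intro set_pmf_of_set) (auto simp: lessThan_empty_iff)
  have ce: "completeness_error ?X ?F P V (1/3)"
    unfolding completeness_error_def
  proof
    fix x assume x: "x \<in> ?X"
    let ?fail = "\<lambda>rP. measure_pmf.prob (verifier_coins V) {rV. result V (interleave x (annotations P x rP)) rV \<noteq> Some (?F x)}"
    let ?bad = "{key. \<not> good_hash m s T (hf key) (support x)}"
    have zero: "?fail (replicate key True) \<le> indicator ?bad key" if "key < 48 * n" for key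
    proof (cases "key \<in> ?bad")
      case False
      then have "?fail (replicate key True) = 0"
        unfolding V(3) measure_map_pmf using complete[OF x that] by (simp add: vimage_def)
      then show ?thesis by simp
    qed simp
    have "measure_pmf.prob (pair_pmf (prover_coins P) (verifier_coins V))
        {(rP, rV). result V (interleave x (annotations P x rP)) rV \<noteq> Some (?F x)} =
        measure_pmf.expectation (pmf_of_set {..<48 * n}) (\<lambda>key. ?fail (replicate key True))"
      unfolding prob_pair_pmf_eq_expectation by (simp add: P_def honest_prover_def)
    also have "\<dots> \<le> measure_pmf.expectation (pmf_of_set {..<48 * n}) (indicator ?bad)"
      using zero set_coins
      by (intro integral_mono_AE measure_pmf.integrable_const_bound[where B = 1]) (auto simp: AE_measure_pmf_iff)
    also have "\<dots> = measure_pmf.prob (pmf_of_set {..<48 * n}) ?bad" by simp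
    also have "\<dots> = real (card ({..<48 * n} \<inter> ?bad)) / real (48 * n)"
      using n by (subst measure_pmf_of_set) (auto simp: lessThan_empty_iff)
    also have "{..<48 * n} \<inter> ?bad = {key. key < 48 * n \<and> \<not> good_hash m s T (hf key) (support x)}" by auto
    also have "real (card \<dots>) / real (48 * n) \<le> real (16 * n) / real (48 * n)"
      using family[OF supp[OF x]] by (intro divide_right_mono) (simp_all only: of_nat_le_iff of_nat_0_le_iff)
    also have "\<dots> = 1/3" using n by simp
    finally show "measure_pmf.prob (pair_pmf (prover_coins P) (verifier_coins V))
        {(rP, rV). result V (interleave x (annotations P x rP)) rV \<noteq> Some (?F x)} \<le> 1/3" .
  qed
  have se: "soundness_error ?X ?F V (1/3)"
    unfolding soundness_error_def
  proof (intro ballI allI impI)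
    fix x and A :: "bool list list" assume x: "x \<in> ?X" and A: "length A = length x"
    let ?bad = "{i. result V (interleave x A) (replicate i True) \<notin> {Some (?F x), None}}"
    have "measure_pmf.prob (verifier_coins V) {rV. result V (interleave x A) rV \<notin> {Some (?F x), None}} =
        measure_pmf.prob (pmf_of_set {..<p}) ?bad"
      unfolding V(3) measure_map_pmf by (simp add: vimage_def)
    also have "\<dots> = real (card ({..<p} \<inter> ?bad)) / real p"
      using p0 by (subst measure_pmf_of_set) (auto simp: lessThan_empty_iff)
    also have "{..<p} \<inter> ?bad = {i. i < p \<and> (if snd (parse E (interleave x A)) = []
      then verdict (summary (int i) (fst (parse E (interleave x A)))) else None) \<notin> {Some (?F x), None}}"
      by (auto simp: res)
    also have "real (card \<dots>) / real p \<le> real d / real p"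
      using protocol_sound[OF x A] by (intro divide_right_mono) (simp_all only: of_nat_le_iff of_nat_0_le_iff)
    also have "\<dots> \<le> 1/3"
    proof -
      have "3 * d < p" using p_large(2) by (simp only: d_def)
      then have "3 * real d < real p" by (metis of_nat_less_iff of_nat_mult of_nat_numeral)
      then show ?thesis using p0 by (simp add: field_simps)
    qed
    finally show "measure_pmf.prob (verifier_coins V)
        {rV. result V (interleave x A) rV \<notin> {Some (?F x), None}} \<le> 1/3" .
  qed
  have "online_scheme ?X ?F (real (E * (1 + d + 16 * m div s))) (real (E * (9 + 4 * (T + 1) * b))) P V"
    unfolding online_scheme_def using on cost V(1) ce se by blast
  then show ?thesis using V(2) by blast
qed

end

section \<open>Parameters\<close>

lemma online_scheme_mono:
  "online_scheme X F ca cv P V \<Longrightarrow> ca \<le> ca' \<Longrightarrow> cv \<le> cv' \<Longrightarrow> online_scheme X F ca' cv' P V"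
  unfolding online_scheme_def by (meson order_trans)

lemma exists_bit_length:
  assumes "2 \<le> p"
  shows "\<exists>E. 1 \<le> E \<and> p \<le> 2 ^ E \<and> real E \<le> log 2 (real p) + 1"
proof (intro exI conjI)
  let ?E = "nat \<lceil>log 2 (real p)\<rceil>"
  have pos: "1 \<le> log 2 (real p)"
    using assms log_le_cancel_iff[of 2 2 "real p"] by simp
  then show "1 \<le> ?E" by linarith
  have "real p = 2 powr log 2 (real p)" using assms by simp
  also have "\<dots> \<le> 2 powr real ?E" by (intro powr_mono) (auto simp: real_nat_ceiling_ge)
  also have "\<dots> = real (2 ^ ?E)" by (simp add: powr_realpow)
  finally show "p \<le> 2 ^ ?E" by (simp only: of_nat_le_iff)
  show "real ?E \<le> log 2 (real p) + 1" using pos by linarith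
qed

text \<open>The prime is at most \<open>2 * n ^ (2 * e) \<le> n ^ (2 * e + 1)\<close>; one further
  \<open>log 2 n\<close> pays for rounding up to whole bits.\<close>

lemma exists_prime_word:
  assumes n: "2 \<le> n" and e: "3 \<le> e"
  shows "\<exists>p E. prime p \<and> n ^ e < p \<and> 1 \<le> E \<and> p \<le> 2 ^ E \<and> real E \<le> real (2 * e + 2) * log 2 (real n)"
proof -
  have "(2::nat) ^ 3 \<le> n ^ e"
    using n e by (meson order_trans power_increasing power_mono le0 one_le_numeral)
  then have X: "7 \<le> n ^ e" by simp
  obtain p where p: "prime p" "n ^ e < p" "p \<le> 2 * n ^ e * n ^ e"
    using exists_prime_between_square[OF X] by blast
  obtain E where E: "1 \<le> E" "p \<le> 2 ^ E" "real E \<le> log 2 (real p) + 1"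
    using exists_bit_length[OF prime_ge_2_nat[OF p(1)]] by blast
  have L: "1 \<le> log 2 (real n)" using n log_le_cancel_iff[of 2 2 "real n"] by simp
  have "p \<le> n * n ^ e * n ^ e" using p(3) n by (meson mult_le_mono1 order_trans)
  also have "\<dots> = n ^ (2 * e + 1)" by (simp add: power_add mult_2)
  finally have "real p \<le> real n ^ (2 * e + 1)" by (metis of_nat_le_iff of_nat_power)
  then have "log 2 (real p) \<le> log 2 (real n ^ (2 * e + 1))"
    using prime_gt_0_nat[OF p(1)] n by (subst log_le_cancel_iff) auto
  also have "\<dots> = real (2 * e + 1) * log 2 (real n)" using n by (subst log_nat_power) auto
  finally have "real E \<le> real (2 * e + 1) * log 2 (real n) + log 2 (real n)" using E(3) L by linarith
  also have "\<dots> = real (2 * e + 2) * log 2 (real n)" by (simp add: algebra_simps)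
  finally show ?thesis using p E by blast
qed

text \<open>For \<open>cv \<ge> m\<close> the factor \<open>log cv m\<close> is at most 1 and could
  make the claimed space too small for \<open>m\<close> words. It does not, because
  \<open>x / ln x\<close> is increasing up to a constant factor from 2 on; the constant 3 uses
  \<open>ln m \<ge> 1/2\<close>.\<close>

lemma log_ratio_ge:
  fixes cv :: real
  assumes "2 \<le> m" "real m \<le> cv"
  shows "real m \<le> 3 * (cv * log cv (real m))"
proof -
  define t where "t = cv / real m"
  have t: "1 \<le> t" "cv = real m * t" using assms by (auto simp: t_def)
  have lnm: "1/2 \<le> ln (real m)"
  proof -
    have "1/2 \<le> ln (2::real)" using ln2_ge_two_thirds by linarith
    also have "\<dots> \<le> ln (real m)" using assms by simp
    finally show ?thesis .
  qed
  have lncv: "0 < ln cv" using assms by simp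
  have "ln cv = ln (real m) + ln t" using t assms by (simp add: ln_mult)
  also have "ln t \<le> t - 1" using t by (intro ln_le_minus_one) simp
  also have "ln (real m) + (t - 1) \<le> 3 * (t * ln (real m))"
  proof -
    have "1 * ln (real m) \<le> t * ln (real m)" "t * (1/2) \<le> t * ln (real m)"
      using t lnm by (auto intro!: mult_right_mono mult_left_mono)
    then show ?thesis by linarith
  qed
  finally have "real m * ln cv \<le> real m * (3 * (t * ln (real m)))" by (intro mult_left_mono) auto
  then show ?thesis using lncv t by (simp add: log_def field_simps)
qed

lemma large_space_scheme:
  fixes C :: nat and cv :: real
  assumes k: "1 \<le> k" and m: "2 \<le> m" "m \<le> n" and cv: "real m \<le> cv"
  shows "\<exists>P V. online_scheme (sparse_streams n m (n ^ C) N) (freq_moment k n) 0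
    (real (12 * C + 48) * (real k * cv * log 2 (real n) * log cv (real m))) P V \<and> coins_in_memory V"
proof -
  have n2: "2 \<le> n" using m by simp
  have L: "1 \<le> log 2 (real n)" using n2 log_le_cancel_iff[of 2 2 "real n"] by simp
  obtain p E where p: "prime p" "n ^ (C + 3) < p" "p \<le> 2 ^ E"
    and E: "real E \<le> real (2 * (C + 3) + 2) * log 2 (real n)"
    using exists_prime_word[OF n2, of "C + 3"] by auto
  have "n ^ 1 \<le> n ^ (C + 3)" "n ^ C \<le> n ^ (C + 3)" using n2 by (intro power_increasing; simp)+
  then have "n < p" "n ^ C < p" using p(2) by simp_all
  then obtain P V where PV: "online_scheme (sparse_streams n m (n ^ C) N) (freq_moment k n) 0 (real (2 * m * E)) P V"
    "coins_in_memory V"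
    using syndrome_scheme[OF p(1) _ _ p(3), of n "n ^ C" m N k] by blast
  have lp: "0 \<le> cv * log cv (real m)" using log_ratio_ge[OF m(1) cv] by linarith
  have "real (2 * m * E) = 2 * real m * real E" by simp
  also have "\<dots> \<le> 2 * (3 * (cv * log cv (real m))) * (real (2 * (C + 3) + 2) * log 2 (real n))"
    using log_ratio_ge[OF m(1) cv] E L lp by (intro mult_mono) auto
  also have "\<dots> = real (12 * C + 48) * (1 * (cv * log cv (real m)) * log 2 (real n))" by (simp add: algebra_simps)
  also have "\<dots> \<le> real (12 * C + 48) * (real k * (cv * log cv (real m)) * log 2 (real n))"
    using k L lp by (intro mult_left_mono mult_right_mono) auto
  finally have "real (2 * m * E) \<le> real (12 * C + 48) * (real k * cv * log 2 (real n) * log cv (real m))"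
    by (simp add: mult_ac)
  then show ?thesis using online_scheme_mono[OF PV(1) order_refl] PV(2) by blast
qed

text \<open>Constants are absorbed into powers of \<open>n \<ge> 2\<close>. The exponent is linear
  in \<open>k\<close> because of the k-th powers in the moments, which makes a word O(k log n) bits
  long for fixed \<open>C\<close>.\<close>

lemma protocol_parameters_le:
  fixes C :: nat
  assumes n: "2 \<le> n" and k: "1 \<le> k" and a: "1 \<le> a" "a \<le> n" and b: "1 \<le> b" "b \<le> 16 * n" and T: "T \<le> 16 * n"
  defines "X \<equiv> n ^ ((50 + 8 * C) * k)"
  shows "3 * ((k + 2) * a) \<le> X" "n * (n ^ C) ^ k \<le> X" "48 * n \<le> X"
    "(n + 1) * (n ^ C + 1) * (T + 1) \<le> X"
    "moment_bound n k (n ^ C) (a * b) * gap_bound n (n ^ C) (a * b) *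
       (1 + 4 * (a * b) * T * val_bound n (n ^ C) ^ 3) \<le> X"
proof -
  have two: "2 ^ j \<le> n ^ j" for j using n by (rule power_mono) simp
  have up: "n ^ i \<le> n ^ j" if "i \<le> j" for i j using n that by (intro power_increasing) auto
  have const: "c * n ^ i \<le> n ^ (j + i)" if "c \<le> 2 ^ j" for c i j
    unfolding power_add using that two[of j] by (intro mult_le_mono1) (rule order_trans)
  have n1: "1 \<le> n ^ j" for j using n by simp
  have plus1: "y + 1 \<le> n ^ (j + 1)" if "y \<le> n ^ j" for y j
  proof -
    have "y + 1 \<le> 2 * n ^ j" using that n1[of j] by linarith
    also have "\<dots> \<le> n ^ (j + 1)" using n by simp
    finally show ?thesis .
  qed
  have ek: "50 + 8 * C \<le> (50 + 8 * C) * k" using k by simp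
  have Ck: "C * k + 50 + 7 * C \<le> (50 + 8 * C) * k" 
    using k by (cases k) (auto simp: algebra_simps)
  show "3 * ((k + 2) * a) \<le> X"
  proof -
    have "k + 2 \<le> 3 * 2 ^ k" using less_exp[of k] by linarith
    then have "k + 2 \<le> 3 * n ^ k" using two[of k] by linarith
    then have "3 * ((k + 2) * a) \<le> 3 * ((3 * n ^ k) * n)" using a by (intro mult_le_mono) auto
    also have "\<dots> = 9 * n ^ (k + 1)" by simp
    also have "\<dots> \<le> n ^ (4 + (k + 1))" by (rule const) simp
    also have "\<dots> \<le> X" unfolding X_def by (rule up) (use k in \<open>auto simp: algebra_simps\<close>)
    finally show ?thesis .
  qed
  show "n * (n ^ C) ^ k \<le> X"
  proof -
    have "n * (n ^ C) ^ k = n ^ (1 + C * k)" by (simp add: power_mult)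
    also have "\<dots> \<le> X" unfolding X_def by (rule up) (use Ck in linarith)
    finally show ?thesis .
  qed
  show "48 * n \<le> X"
    using const[of 48 6 1] up[of "6 + 1" "(50 + 8 * C) * k"] ek unfolding X_def by simp
  have T': "T \<le> n ^ 5" using T const[of 16 4 1] by simp
  show "(n + 1) * (n ^ C + 1) * (T + 1) \<le> X"
  proof -
    have "(n + 1) * (n ^ C + 1) * (T + 1) \<le> n ^ (1 + 1) * n ^ (C + 1) * n ^ (5 + 1)"
      using plus1[of n 1] plus1[of "n ^ C" C] plus1[OF T'] by (intro mult_le_mono) auto
    also have "\<dots> = n ^ (C + 9)" by (simp only: power_add[symmetric]) (simp add: add.commute)
    also have "\<dots> \<le> X" unfolding X_def by (rule up) (use ek in linarith)
    finally show ?thesis .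
  qed
  show "moment_bound n k (n ^ C) (a * b) * gap_bound n (n ^ C) (a * b) *
       (1 + 4 * (a * b) * T * val_bound n (n ^ C) ^ 3) \<le> X"
  proof -
    have R: "val_bound n (n ^ C) = n ^ (C + 3)"
      unfolding val_bound_def by (simp add: power_add power2_eq_square power3_eq_cube)
    have "a * b \<le> n * (16 * n)" using a b by (intro mult_le_mono)
    also have "\<dots> = 16 * n ^ 2" by (simp add: power2_eq_square)
    also have "\<dots> \<le> n ^ 6" using const[of 16 4 2] by simp
    finally have U: "a * b \<le> n ^ 6" .
    have "a * b * (n ^ (C + 3)) ^ k \<le> n ^ 6 * n ^ ((C + 3) * k)"
      unfolding power_mult by (rule mult_le_mono1[OF U])
    also have "\<dots> = n ^ (6 + (C + 3) * k)" by (simp only: power_add)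
    finally have 1: "moment_bound n k (n ^ C) (a * b) \<le> n ^ (6 + (C + 3) * k + 1)"
      unfolding moment_bound_def R by (rule plus1)
    have "a * b * (n ^ (C + 3))\<^sup>2 + 1 \<le> n ^ (6 + (C + 3) * 2 + 1)"
    proof (rule plus1)
      show "a * b * (n ^ (C + 3))\<^sup>2 \<le> n ^ (6 + (C + 3) * 2)"
        unfolding power_add[of n 6] power_mult by (rule mult_le_mono1[OF U])
    qed
    then have "2 * (a * b * (n ^ (C + 3))\<^sup>2 + 1) \<le> 2 * n ^ (6 + (C + 3) * 2 + 1)" by simp
    also have "\<dots> \<le> n ^ (1 + (6 + (C + 3) * 2 + 1))" by (rule const) simp
    finally have 2: "gap_bound n (n ^ C) (a * b) \<le> n ^ (1 + (6 + (C + 3) * 2 + 1))"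
      unfolding gap_bound_def R by simp
    have "4 * (a * b) * T * (n ^ (C + 3)) ^ 3 \<le> 4 * n ^ 6 * n ^ 5 * n ^ ((C + 3) * 3)"
      unfolding power_mult using U T' by (intro mult_le_mono) auto
    also have "\<dots> = 4 * n ^ (6 + 5 + (C + 3) * 3)" by (simp only: power_add mult.assoc)
    also have "\<dots> \<le> n ^ (2 + (6 + 5 + (C + 3) * 3))" by (rule const) simp
    finally have 3: "1 + 4 * (a * b) * T * val_bound n (n ^ C) ^ 3 \<le> n ^ (2 + (6 + 5 + (C + 3) * 3) + 1)"
      unfolding R add.commute[of 1] by (rule plus1)
    have "moment_bound n k (n ^ C) (a * b) * gap_bound n (n ^ C) (a * b) *
       (1 + 4 * (a * b) * T * val_bound n (n ^ C) ^ 3) \<le>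
      n ^ (6 + (C + 3) * k + 1) * n ^ (1 + (6 + (C + 3) * 2 + 1)) * n ^ (2 + (6 + 5 + (C + 3) * 3) + 1)"
      by (intro mult_le_mono 1 2 3)
    also have "\<dots> = n ^ ((6 + (C + 3) * k + 1) + (1 + (6 + (C + 3) * 2 + 1)) + (2 + (6 + 5 + (C + 3) * 3) + 1))"
      by (simp only: power_add)
    also have "\<dots> \<le> X" unfolding X_def
    proof (rule up)
      have "47 + 5 * C \<le> (47 + 5 * C) * k" using k by simp
      then show "(6 + (C + 3) * k + 1) + (1 + (6 + (C + 3) * 2 + 1)) + (2 + (6 + 5 + (C + 3) * 3) + 1)
          \<le> (50 + 8 * C) * k"
        by (simp add: algebra_simps)
    qed
    finally show ?thesis .
  qed
qed

lemma small_space_scheme: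
  fixes C :: nat and cv :: real
  assumes k: "1 \<le> k" and m: "2 \<le> m" "m \<le> n" and cv: "1 < cv" "cv < real m"
  defines "K \<equiv> 1417 * real (102 + 16 * C)"
  shows "\<exists>P V. online_scheme (sparse_streams n m (n ^ C) N) (freq_moment k n)
    (K * (real k ^ 2 * real m * cv powr (- 1 / 2) * log 2 (real n) * log cv (real m)))
    (K * (real k * cv * log 2 (real n) * log cv (real m))) P V \<and> coins_in_memory V"
proof -
  have n2: "2 \<le> n" using m by simp
  have L: "1 \<le> log 2 (real n)" using n2 log_le_cancel_iff[of 2 2 "real n"] by simp
  have l1: "1 \<le> log cv (real m)"
    using cv log_le_cancel_iff[of cv cv "real m"] by simp
  define q where "q = nat \<lfloor>sqrt cv\<rfloor>"
  have q: "real q \<le> sqrt cv" "sqrt cv < real q + 1" using cv by (auto simp: q_def)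
  \<comment> \<open>The floor of 4 keeps the decay \<open>1 / s ^ t\<close> of collisions over
    \<open>t\<close> levels genuine when \<open>cv\<close> is near 1; \<open>b = s * s\<close> is
    still at most \<open>16 * cv\<close> because \<open>cv > 1\<close>.\<close>
  define s where "s = max 4 q"
  have s4: "4 \<le> s" by (simp add: s_def)
  have scv: "sqrt cv \<le> real s + 1" using q by (simp add: s_def)
  have sm: "s \<le> 2 * m"
  proof -
    have "sqrt cv \<le> cv" using cv by (intro real_le_lsqrt) (auto simp: power2_eq_square)
    then have "q \<le> m" using q cv by linarith
    then show ?thesis using m by (simp add: s_def)
  qed
  define b where "b = s * s"
  define a where "a = (m + s - 1) div s"
  have bcv: "real b \<le> 16 * cv"
  proof (cases "q \<le> 4")
    case True
    then show ?thesis using cv by (simp add: b_def s_def)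
  next
    case False
    have "real q * real q \<le> sqrt cv * sqrt cv" using q cv by (intro mult_mono) auto
    then show ?thesis using False cv by (simp add: b_def s_def)
  qed
  have b16: "b \<le> 16 * n"
  proof -
    have "real b \<le> real (16 * n)" using bcv cv m by simp
    then show ?thesis by (simp only: of_nat_le_iff)
  qed
  have as: "m \<le> a * s" "a * s < m + s"
  proof -
    have "m + s - 1 < a * s + s" unfolding a_def using s4 dividend_less_div_times[of s "m + s - 1"] by simp
    then show "m \<le> a * s" by linarith
    have "a * s \<le> m + s - 1" unfolding a_def by (rule div_times_less_eq_dividend)
    then show "a * s < m + s" using m by linarith
  qed
  have a1: "1 \<le> a" using as(1) m by (cases a) auto
  have an: "a \<le> n"
  proof -
    have "a \<le> m"
    proof (rule ccontr)
      assume "\<not> a \<le> m"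
      then have "(m + 1) * s \<le> a * s" by (intro mult_le_mono1) simp
      moreover have "m * 1 \<le> m * s" using s4 by (intro mult_le_mono2) simp
      ultimately show False using as(2) by (simp add: algebra_simps)
    qed
    then show ?thesis using m by simp
  qed
  have U: "0 < a * b" "m * s \<le> a * b"
    using a1 s4 mult_le_mono1[OF as(1), of s] by (auto simp: b_def mult.assoc)
  have ex: "16 * m \<le> s ^ (16 * m)"
  proof -
    have "16 * m \<le> 2 ^ (16 * m)" by (rule less_imp_le[OF less_exp])
    also have "\<dots> \<le> s ^ (16 * m)" using s4 by (intro power_mono) auto
    finally show ?thesis .
  qed
  define T where "T = (LEAST T. 16 * m \<le> s ^ T)"
  have T: "16 * m \<le> s ^ T" unfolding T_def using ex by (rule LeastI)
  have T16: "T \<le> 16 * n" using Least_le[of "\<lambda>T. 16 * m \<le> s ^ T", OF ex] m by (simp add: T_def)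
  have T0: "T \<noteq> 0" using T m by (cases T) auto
  \<comment> \<open>Minimality gives \<open>s ^ (T - 1) < 16 * m \<le> m ^ 5\<close>, and
    \<open>sqrt cv \<le> s * s\<close> turns this into \<open>T - 1 \<le> 20 * log cv m\<close>; the
    remaining 2 is paid by \<open>log cv m \<ge> 1\<close>.\<close>
  have Tlog: "real T + 1 \<le> 22 * log cv (real m)"
  proof -
    have "s ^ (T - 1) < 16 * m"
      using not_less_Least[of "T - 1" "\<lambda>T. 16 * m \<le> s ^ T"] T0 unfolding T_def by simp
    then have "real (s ^ (T - 1)) < real (16 * m)" by (simp only: of_nat_less_iff)
    then have "ln (real (s ^ (T - 1))) < ln (real (16 * m))" using s4 m by (subst ln_less_cancel_iff) auto
    also have "ln (real (s ^ (T - 1))) = real (T - 1) * ln (real s)" using s4 by (simp add: ln_realpow)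
    also have "ln (real (16 * m)) = ln (2 ^ 4) + ln (real m)" using m by (simp add: ln_mult)
    also have "ln ((2::real) ^ 4) = 4 * ln 2" by (subst ln_realpow) auto
    also have "4 * ln 2 + ln (real m) \<le> 5 * ln (real m)" using m by simp
    finally have 1: "real (T - 1) * ln (real s) < 5 * ln (real m)" by simp
    have "sqrt cv \<le> real s * real s"
    proof -
      have "4 * real s \<le> real s * real s" using s4 by (intro mult_right_mono) auto
      then have "real s + 1 \<le> real s * real s" using s4 by linarith
      then show ?thesis using scv by linarith
    qed
    then have "ln (sqrt cv) \<le> ln (real s * real s)" using cv s4 by (subst ln_le_cancel_iff) auto
    then have 2: "ln cv \<le> 4 * ln (real s)" using cv s4 by (simp add: ln_sqrt ln_mult)
    have "real (T - 1) * ln cv \<le> real (T - 1) * (4 * ln (real s))" using 2 by (intro mult_left_mono) auto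
    also have "\<dots> \<le> 20 * ln (real m)" using 1 by linarith
    finally have "real (T - 1) \<le> 20 * log cv (real m)"
      using cv by (simp add: log_def field_simps)
    then show ?thesis using T0 l1 by (cases T) auto
  qed
  obtain p E where p: "prime p" "n ^ ((50 + 8 * C) * k) < p" "1 \<le> E" "p \<le> 2 ^ E"
    and E: "real E \<le> real (2 * ((50 + 8 * C) * k) + 2) * log 2 (real n)"
  proof -
    have "3 \<le> (50 + 8 * C) * k" using k by (cases k) auto
    then show thesis using exists_prime_word[OF n2] that by blast
  qed
  have b1: "1 \<le> b" using s4 by (simp add: b_def)
  note large = protocol_parameters_le[OF n2 k a1 an b1 b16 T16, of C]
  have "a \<le> p"
  proof -
    have "1 * a \<le> (k + 2) * a" by (rule mult_le_mono1) simp
    then show ?thesis using large(1) p(2) by linarith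
  qed
  then have "\<exists>lag :: nat \<Rightarrow> int poly. \<forall>x<a. degree (lag x) < a \<and>
      (\<forall>y<a. [poly (lag x) (int y) = of_bool (x = y)] (mod int p))"
    using exists_lagrange_poly_mod[OF p(1)] by metis
  then obtain lag :: "nat \<Rightarrow> int poly" where lag: "\<And>x. x < a \<Longrightarrow> degree (lag x) < a"
    "\<And>x y. x < a \<Longrightarrow> y < a \<Longrightarrow> [poly (lag x) (int y) = of_bool (x = y)] (mod int p)" by blast
  obtain hf where hf: "\<And>key t i. hf key t i < a * b" "\<And>S. S \<subseteq> {1..n} \<Longrightarrow> card S \<le> m \<Longrightarrow>
      card {key. key < 48 * n \<and> \<not> good_hash m s T (hf key) S} \<le> 16 * n"
    using exists_hash_family[OF U _ _ T, of n] s4 m by auto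
  interpret MP: moment_protocol n k "n ^ C" T a b E p hf lag
  proof
    show "3 < p" using large(3) p(2) n2 by linarith
  qed (use n2 k a1 b1 p hf lag large in \<open>auto intro: order_less_le_trans less_imp_le order.strict_trans1\<close>)
  obtain P V where PV: "online_scheme (sparse_streams n m (n ^ C) N) (freq_moment k n)
      (real (E * (1 + MP.d + 16 * m div s))) (real (E * (9 + 4 * (T + 1) * b))) P V" "coins_in_memory V"
    using MP.protocol_scheme[of m s N] hf(2) s4 by auto
  have Ek: "real E \<le> real (102 + 16 * C) * (real k * log 2 (real n))"
  proof -
    have "2 * ((50 + 8 * C) * k) + 2 \<le> (102 + 16 * C) * k" using k by (simp add: algebra_simps)
    then have "real (2 * ((50 + 8 * C) * k) + 2) \<le> real ((102 + 16 * C) * k)" by (simp only: of_nat_le_iff)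
    then have "real (2 * ((50 + 8 * C) * k) + 2) * log 2 (real n) \<le> real ((102 + 16 * C) * k) * log 2 (real n)"
      using L by (intro mult_right_mono) auto
    then show ?thesis using E by (simp add: mult.assoc)
  qed
  have space: "real (E * (9 + 4 * (T + 1) * b)) \<le> K * (real k * cv * log 2 (real n) * log cv (real m))"
  proof -
    have "(real T + 1) * real b \<le> (22 * log cv (real m)) * (16 * cv)"
      using Tlog bcv l1 by (intro mult_mono) auto
    moreover have "1 * 1 \<le> log cv (real m) * cv" using l1 cv by (intro mult_mono) auto
    \<comment> \<open>1417 = 9 + 4 * 22 * 16.\<close>
    ultimately have "9 + 4 * ((real T + 1) * real b) \<le> 1417 * (log cv (real m) * cv)" by linarith
    then have "real E * (9 + 4 * ((real T + 1) * real b)) \<le>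
        (real (102 + 16 * C) * (real k * log 2 (real n))) * (1417 * (log cv (real m) * cv))"
      using Ek L by (intro mult_mono) auto
    then show ?thesis by (simp add: K_def mult_ac add.commute)
  qed
  have annotation: "real (E * (1 + MP.d + 16 * m div s)) \<le>
      K * (real k ^ 2 * real m * cv powr (- 1 / 2) * log 2 (real n) * log cv (real m))"
  proof -
    define w where "w = real m / real s"
    have s0: "0 < real s" using s4 by simp
    have w: "1 \<le> 2 * w" using sm s0 by (simp add: w_def field_simps)
    have "real (a * s) \<le> real (m + s)" using as(2) by (simp only: of_nat_le_iff)
    then have "real a \<le> w + 1" using s0 by (simp add: w_def field_simps)
    then have a3: "real a \<le> 3 * w" using w by linarith
    have "real MP.d = (real k + 2) * real a" by (simp add: MP.d_def algebra_simps)
    also have "\<dots> \<le> (3 * real k) * (3 * w)" using k a3 by (intro mult_mono) auto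
    finally have d: "real MP.d \<le> 9 * (real k * w)" by simp
    have "real (16 * m div s) \<le> real (16 * m) / real s" by (rule of_nat_div_le_of_nat)
    then have div: "real (16 * m div s) \<le> 16 * w" by (simp add: w_def)
    have "1 * w \<le> real k * w" using k w by (intro mult_right_mono) auto
    \<comment> \<open>27 = 2 + 9 + 16, where the block of the key costs \<open>1 \<le> 2 * w\<close>
      because \<open>s \<le> 2 * m\<close>.\<close>
    then have "real (1 + MP.d + 16 * m div s) \<le> 27 * (real k * w)"
      using d div w unfolding of_nat_add of_nat_1 by linarith
    also have "w \<le> 2 * (real m * cv powr (- 1 / 2))"
    proof -
      have "sqrt cv \<le> 2 * real s" using scv s4 by linarith
      then have "1 / real s \<le> 2 / sqrt cv" using s0 cv by (simp add: field_simps)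
      moreover have "cv powr (- 1 / 2) = 1 / sqrt cv"
        using cv by (simp add: powr_minus_divide powr_half_sqrt)
      ultimately have "real m * (1 / real s) \<le> real m * (2 * cv powr (- 1 / 2))"
        by (intro mult_left_mono) auto
      then show ?thesis by (simp add: w_def)
    qed
    finally have "real (1 + MP.d + 16 * m div s) \<le> 54 * (real k * (real m * cv powr (- 1 / 2)))"
      using k by (simp add: mult_left_mono)
    then have "real E * real (1 + MP.d + 16 * m div s) \<le>
        (real (102 + 16 * C) * (real k * log 2 (real n))) * (54 * (real k * (real m * cv powr (- 1 / 2))))"
      using Ek L by (intro mult_mono) auto
    also have "\<dots> = (54 * real (102 + 16 * C)) * (real k ^ 2 * real m * cv powr (- 1 / 2) * log 2 (real n)) * 1"
      by (simp add: power2_eq_square mult_ac)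
    also have "\<dots> \<le> K * (real k ^ 2 * real m * cv powr (- 1 / 2) * log 2 (real n)) * log cv (real m)"
      using L l1 by (intro mult_mono) (auto simp: K_def)
    finally show ?thesis by (simp only: of_nat_mult mult.assoc)
  qed
  show ?thesis using online_scheme_mono[OF PV(1) annotation space] PV(2) by blast
qed

theorem theorem5p1:
  shows "(\<forall>C::nat. \<exists>K::real. K > 0 \<and>
            (\<forall>(k::nat) (n::nat) (m::nat) (N::nat) (cv::real).
               k \<ge> 1 \<and> 2 \<le> m \<and> m \<le> n \<and> cv > 1 \<longrightarrow>
               (\<exists>P V.
                  online_scheme (sparse_streams n m (n ^ C) N) (freq_moment k n)
                    (K * (real k ^ 2 * real m * cv powr (- 1 / 2) * log 2 (real n) * log cv (real m)))
                    (K * (real k * cv * log 2 (real n) * log cv (real m)))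
                    P V \<and>
                  coins_in_memory V)))
         \<and>
         (\<exists>c::real. c > 0 \<and>
            (\<forall>(C::nat) (k::nat) (n::nat) (m::nat) (N::nat) (ca::real) (cv::real) P V.
               C \<ge> 1 \<and> k \<ge> 2 \<and> 1 \<le> m \<and> m \<le> n \<and> m \<le> N \<and>
               online_scheme (sparse_streams n m (n ^ C) N) (freq_moment k n) ca cv P V \<and>
               ca \<ge> log 2 (real n) \<longrightarrow>
               ca * cv \<ge> c * (real m * log 2 (real n / real m))))"
proof (intro conjI allI)
  fix C :: nat
  define K where "K = 1417 * real (102 + 16 * C)"
  have "\<exists>P V. online_scheme (sparse_streams n m (n ^ C) N) (freq_moment k n)
      (K * (real k ^ 2 * real m * cv powr (- 1 / 2) * log 2 (real n) * log cv (real m)))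
      (K * (real k * cv * log 2 (real n) * log cv (real m))) P V \<and> coins_in_memory V"
    if km: "1 \<le> k" "2 \<le> m" "m \<le> n" "1 < cv" for k n m N :: nat and cv :: real
  proof (cases "cv < real m")
    case True
    then show ?thesis using small_space_scheme[OF km] by (simp add: K_def)
  next
    case False
    then obtain P V where PV: "online_scheme (sparse_streams n m (n ^ C) N) (freq_moment k n) 0
        (real (12 * C + 48) * (real k * cv * log 2 (real n) * log cv (real m))) P V" "coins_in_memory V"
      using large_space_scheme[OF km(1-3), of cv C N] by auto
    have pos: "0 \<le> log 2 (real n)" "0 \<le> log cv (real m)" using km by auto
    have "online_scheme (sparse_streams n m (n ^ C) N) (freq_moment k n)
      (K * (real k ^ 2 * real m * cv powr (- 1 / 2) * log 2 (real n) * log cv (real m)))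
      (K * (real k * cv * log 2 (real n) * log cv (real m))) P V"
      by (rule online_scheme_mono[OF PV(1)]) (use pos km in \<open>auto simp: K_def intro!: mult_right_mono\<close>)
    then show ?thesis using PV(2) by blast
  qed
  then show "\<exists>K::real. K > 0 \<and> (\<forall>(k::nat) (n::nat) (m::nat) (N::nat) (cv::real).
      k \<ge> 1 \<and> 2 \<le> m \<and> m \<le> n \<and> cv > 1 \<longrightarrow>
      (\<exists>P V. online_scheme (sparse_streams n m (n ^ C) N) (freq_moment k n)
          (K * (real k ^ 2 * real m * cv powr (- 1 / 2) * log 2 (real n) * log cv (real m)))
          (K * (real k * cv * log 2 (real n) * log cv (real m))) P V \<and> coins_in_memory V))"
    by (intro exI[of _ K]) (auto simp: K_def)
next
  show "\<exists>c::real. c > 0 \<and>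
      (\<forall>(C::nat) (k::nat) (n::nat) (m::nat) (N::nat) (ca::real) (cv::real) P V.
         C \<ge> 1 \<and> k \<ge> 2 \<and> 1 \<le> m \<and> m \<le> n \<and> m \<le> N \<and>
         online_scheme (sparse_streams n m (n ^ C) N) (freq_moment k n) ca cv P V \<and>
         ca \<ge> log 2 (real n) \<longrightarrow>
         ca * cv \<ge> c * (real m * log 2 (real n / real m)))"
  proof (rule exI[of _ "1 / 6000"], intro conjI allI impI)
    fix C k n m N :: nat and ca cv :: real and P V
    assume H: "C \<ge> 1 \<and> k \<ge> 2 \<and> 1 \<le> m \<and> m \<le> n \<and> m \<le> N \<and>
      online_scheme (sparse_streams n m (n ^ C) N) (freq_moment k n) ca cv P V \<and> ca \<ge> log 2 (real n)"
    \<comment> \<open>\<open>C \<ge> 1\<close> makes the frequency bound \<open>n ^ C\<close> at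
      least \<open>n\<close>, which leaves room for the frequency 2 of a repeated item as soon as
      \<open>n \<ge> 2\<close>.\<close>
    then show "ca * cv \<ge> 1 / 6000 * (real m * log 2 (real n / real m))"
      by (intro annotated_space_lower_bound[of n m "n ^ C" N k ca cv P V]) (auto intro: self_le_power)
  qed simp
qed

end
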